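(* Let $t\ge 0$, $\lambda>0$, $L>0$, and consider the coarsening evolution on $[-L,L]$ with stationary extra particles at $\pm L$. (1) Starting from $n$ particles independently and uniformly distributed in $[-L,L]$, the number of particles in a given (measurable) subset $A\subseteq[-L,L]$ after time $t$ has the binomial distribution $\mathrm{Bin}\left(n, e^{-2t}\frac{|A|}{2L}\right)$, where $|A|$ is the Lebesgue measure of $A$. (2) Starting from $\mathcal{P}(\lambda,L)$, the law of the configuration after time $t$ is a Poisson configuration with intensity $\lambda e^{-2t}$ times Lebesgue measure on $[-L,L]$. (3) For $M\ge L>0$, let $\mathcal{L}(M,L)$ be the law of the time $t$ configuration restricted to $[-L,L]$, starting from $\mathcal{P}(\lambda,M)$ (evolving on $[-M,M]$ with stationary extra particles at $\pm M$). Then the law $\mathcal{L}(M,L)$ does not depend on $M$.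
   Context: $\mathcal{P}(\lambda,L)$ denotes the law of a Poisson process of intensity $\lambda$ times Lebesgue measure on $[-L,L]$. The evolution on an interval $[a,b]$ is as follows. A configuration of $n$ particles is a vector $\mathbf{x}=(x_0,\dots,x_{n+1})$ with $a=x_0<x_1<\cdots<x_n<x_{n+1}=b$, where $x_0=a$ and $x_{n+1}=b$ are stationary extra particles (not counted as particles of the configuration). It evolves by $\frac{dx_i}{dt}=-x_{i-1}+2x_i-x_{i+1}$ for $1\le i\le n$ and $\frac{dx_0}{dt}=\frac{dx_{n+1}}{dt}=0$, until the first time at which two coordinates coincide. At that time repeated entries are omitted (colliding particles merge, and particles hitting an endpoint are absorbed), the remaining particles are reindexed, and the evolution continues by the same rule with the smaller number of particles. *)

theory Defs
  imports "HOL-Probability.Probability"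
begin

text \<open>
  The list \<open>xs\<close> is the full vector \<open>(x\<^sub>0, \<dots>, x\<^sub>n\<^sub>+\<^sub>1)\<close>, stationary extra particles included;
  \<open>u i s\<close> is the position of \<open>x\<^sub>i\<close> at time \<open>s\<close>. Derivatives at the ends of \<open>[0, T]\<close> are one-sided.
\<close>

definition ode_solution :: "real list \<Rightarrow> (nat \<Rightarrow> real \<Rightarrow> real) \<Rightarrow> real \<Rightarrow> bool" where
  "ode_solution xs u T \<longleftrightarrow>
     (\<forall>i<length xs. u i 0 = xs ! i) \<and>
     (\<forall>i<length xs. \<forall>s\<in>{0..T}.
        (u i has_real_derivative
           (if i = 0 \<or> i = length xs - 1 then 0
            else - u (i - 1) s + 2 * u i s - u (i + 1) s)) (at s within {0..T}))"

definition positions :: "nat \<Rightarrow> (nat \<Rightarrow> real \<Rightarrow> real) \<Rightarrow> real \<Rightarrow> real list" where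
  "positions m u s = map (\<lambda>i. u i s) [0..<m]"

text \<open>
  \<open>evolves xs t ys\<close>: the vector \<open>xs\<close> has become \<open>ys\<close> after time \<open>t\<close>. In \<open>collision\<close>, \<open>\<tau>\<close> is the
  first time at which two coordinates coincide. By continuity the positions are still weakly
  increasing at \<open>\<tau>\<close>, so \<open>remdups\<close> keeps one copy of each position in increasing order; a particle
  that hits an endpoint is identified with the stationary entry there. A collision at time \<open>t\<close>
  itself is carried out.
\<close>

inductive evolves :: "real list \<Rightarrow> real \<Rightarrow> real list \<Rightarrow> bool" where
  no_collision:
    "0 \<le> t \<Longrightarrow> ode_solution xs u t \<Longrightarrow>
     (\<forall>s\<in>{0..t}. distinct (positions (length xs) u s)) \<Longrightarrow>
     evolves xs t (positions (length xs) u t)"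
| collision:
    "0 < \<tau> \<Longrightarrow> \<tau> \<le> t \<Longrightarrow> ode_solution xs u \<tau> \<Longrightarrow>
     (\<forall>s\<in>{0..<\<tau>}. distinct (positions (length xs) u s)) \<Longrightarrow>
     \<not> distinct (positions (length xs) u \<tau>) \<Longrightarrow>
     evolves (remdups (positions (length xs) u \<tau>)) (t - \<tau>) ys \<Longrightarrow>
     evolves xs t ys"

text \<open>
  The set of particles at time \<open>t\<close> of the evolution on \<open>[a, b]\<close> started from the finite set \<open>S\<close> of
  particles; the stationary extra particles are added at the start and not counted at the end.
  Points of \<open>S\<close> outside \<open>(a, b)\<close>, which have probability zero for the random configurations
  considered here, are discarded.
\<close>

definition coarsen :: "real \<Rightarrow> real \<Rightarrow> real \<Rightarrow> real set \<Rightarrow> real set" where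
  "coarsen a b t S =
     set (butlast (tl (THE ys. evolves (a # sorted_list_of_set (S \<inter> {a<..<b}) @ [b]) t ys)))"

text \<open>
  Configurations are finite subsets, with the \<open>\<sigma>\<close>-algebra generated by the numbers of points in
  Borel sets.
\<close>

definition config_space :: "real set \<Rightarrow> real set measure" where
  "config_space B =
     sigma {S. finite S \<and> S \<subseteq> B}
       {{S. finite S \<and> S \<subseteq> B \<and> card (S \<inter> A) = k} | A k. A \<in> sets borel}"

text \<open>
  \<open>poisson_law r L P\<close>: \<open>P\<close> is the law of a Poisson process on \<open>[-L, L]\<close> with intensity \<open>r\<close> times
  Lebesgue measure. The Poisson probabilities are written out because \<^const>\<open>poisson_pmf\<close> is specified
  only for positive rates, whereas \<open>A\<close> may be a null set.
\<close>

definition poisson_law :: "real \<Rightarrow> real \<Rightarrow> real set measure \<Rightarrow> bool" where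
  "poisson_law r L P \<longleftrightarrow>
     prob_space P \<and> sets P = sets (config_space {-L..L}) \<and>
     (\<forall>A k. A \<in> sets borel \<longrightarrow> A \<subseteq> {-L..L} \<longrightarrow>
        measure P {S \<in> space P. card (S \<inter> A) = k} =
          (r * measure lborel A) ^ k / fact k * exp (- (r * measure lborel A))) \<and>
     (\<forall>(m::nat) A. (\<forall>i<m. A i \<in> sets borel \<and> A i \<subseteq> {-L..L}) \<longrightarrow> disjoint_family_on A {..<m} \<longrightarrow>
        prob_space.indep_vars P (\<lambda>_. count_space UNIV) (\<lambda>i S. card (S \<inter> A i)) {..<m})"

end

theory Submission imports Defs begin

text \<open>
  Let \<open>n\<close> independent uniform particles evolve on \<open>[a, b]\<close>. Their ordered positions are uniform on a
  simplex, and the whole proof rests on three properties of the flow on this simplex.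

  \<^item> Up to a change of direction of time the flow is the discrete heat flow. Averaging preserves
    order, so the tuples which are free of collisions up to time \<open>t\<close> are exactly the preimage of the
    \<^emph>\<open>whole\<close> simplex under the flow for time \<open>t\<close>.
  \<^item> The flow is affine and expands volume by \<open>exp (2 n t)\<close> (\<open>volume_heat_map\<close>). The factor comes
    from uniqueness of Haar measure and a symmetry: flipping the signs of every other coordinate
    reverses the time of the volume-preserving part of the flow. Hence the first collision time is
    exponential with rate \<open>2 n\<close> and independent of the collided configuration
    (\<open>joint_law_first_collision\<close>).
  \<^item> The flux through the face of the simplex on which two given neighbours meet depends on their
    other neighbours, but the sum of these fluxes over all faces that lead to the same collided
    configuration telescopes to \<open>2 (b - a)\<close>. Hence the collided configuration consists of \<open>n - 1\<close>
    uniform particles (\<open>collided_volume_eq\<close>).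

  So the number of particles is a pure death process independent of the positions, which stay
  uniform. Laws of random finite sets are compared through their void probabilities, the
  probabilities of having no point in a closed set (\<open>config_measure_eqI\<close>). For the coarsened
  configuration they come from conditioning on the first collision
  (\<open>emeasure_simplex_coarsen_avoiding\<close>): if \<open>A\<close> has length \<open>q\<close>, then no particle is in \<open>A\<close> at time
  \<open>t\<close> with probability \<open>(1 - exp (- 2 t) q / (b - a)) ^ n\<close>.

  This is also the probability that none of the \<open>n\<close> initial particles is in the image of \<open>A\<close> under
  the contraction of \<open>[a, b]\<close> by the factor \<open>exp (- 2 t)\<close>. In other words, coarsening for time \<open>t\<close>
  has the same law as keeping the particles in the left part of \<open>[a, b]\<close> of relative length
  \<open>exp (- 2 t)\<close> and magnifying this part to \<open>[a, b]\<close> (\<open>distr_coarsen_eq_distr_magnify\<close>). For the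
  magnified configuration all three claims are immediate: counts of independent uniform particles
  are binomial, and a magnified Poisson configuration is Poisson. A Poisson configuration is covered
  because it is uniform given its number of points.
\<close>

section \<open>The discrete heat flow\<close>

text \<open>
  The factor 2 at the two ends makes \<open>nbr_sum n x - 2 x\<close> vanish there, so that the ends stay put
  without a case distinction in the flow.
\<close>

definition nbr_sum :: "nat \<Rightarrow> (nat \<Rightarrow> real) \<Rightarrow> nat \<Rightarrow> real" where
  "nbr_sum n x i = (if i = 0 \<or> n < i then 2 * x i else x (i - 1) + x (i + 1))"

text \<open>
  The exponential series of \<^const>\<open>nbr_sum\<close>. The generator of the heat flow is \<open>nbr_sum n - 2\<close>, so
  its flow is this series times \<open>exp (- 2 s)\<close>. Negative times are meaningful and describe the
  evolution of the particles.
\<close>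

definition nbr_exp :: "nat \<Rightarrow> real \<Rightarrow> (nat \<Rightarrow> real) \<Rightarrow> nat \<Rightarrow> real" where
  "nbr_exp n s x i = (\<Sum>k. (nbr_sum n ^^ k) x i / fact k * s ^ k)"

definition heat :: "nat \<Rightarrow> real \<Rightarrow> (nat \<Rightarrow> real) \<Rightarrow> nat \<Rightarrow> real" where
  "heat n s x i = exp (- (2 * s)) * nbr_exp n s x i"

lemma nbr_sum_pow_bound:
  assumes "Suc n \<le> m" "\<And>j. j \<le> m \<Longrightarrow> \<bar>x j\<bar> \<le> R"
  shows "j \<le> m \<Longrightarrow> \<bar>(nbr_sum n ^^ k) x j\<bar> \<le> 2 ^ k * R"
proof (induction k arbitrary: j)
  case 0
  then show ?case using assms by simp
next
  case (Suc k)
  let ?y = "(nbr_sum n ^^ k) x"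
  show ?case
  proof (cases "j = 0 \<or> n < j")
    case True
    then show ?thesis using Suc.IH[OF Suc.prems] by (auto simp: nbr_sum_def abs_mult)
  next
    case False
    then have "\<bar>?y (j - 1)\<bar> \<le> 2 ^ k * R" "\<bar>?y (j + 1)\<bar> \<le> 2 ^ k * R"
      using Suc.IH[of "j - 1"] Suc.IH[of "j + 1"] Suc.prems assms(1) by auto
    moreover have "nbr_sum n ?y j = ?y (j - 1) + ?y (j + 1)"
      using False by (simp add: nbr_sum_def)
    ultimately show ?thesis by simp
  qed
qed

lemma nbr_exp_summable: "summable (\<lambda>k. (nbr_sum n ^^ k) x i / fact k * s ^ k)"
proof -
  define m where "m = max (Suc n) i"
  define R where "R = Max ((\<lambda>j. \<bar>x j\<bar>) ` {..m})"
  have R: "\<bar>x j\<bar> \<le> R" if "j \<le> m" for j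
    unfolding R_def using that by (intro Max_ge) auto
  have b: "\<bar>(nbr_sum n ^^ k) x i\<bar> \<le> 2 ^ k * R" for k
    by (rule nbr_sum_pow_bound[of n m]) (auto simp: m_def intro!: R[unfolded m_def])
  have "summable (\<lambda>k. R * (inverse (fact k) * (2 * \<bar>s\<bar>) ^ k))"
    by (intro summable_mult summable_exp)
  then show ?thesis
  proof (rule summable_comparison_test')
    fix k
    have "norm ((nbr_sum n ^^ k) x i / fact k * s ^ k) \<le> (2 ^ k * R) / fact k * \<bar>s\<bar> ^ k"
      unfolding real_norm_def abs_mult abs_divide power_abs
      using b[of k] order_trans[OF abs_ge_zero b[of k]]
      by (intro mult_mono) (auto simp: divide_right_mono)
    also have "\<dots> = R * (inverse (fact k) * (2 * \<bar>s\<bar>) ^ k)"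
      by (simp add: power_mult_distrib field_simps)
    finally show "norm ((nbr_sum n ^^ k) x i / fact k * s ^ k) \<le> R * (inverse (fact k) * (2 * \<bar>s\<bar>) ^ k)" .
  qed
qed

lemma nbr_sum_lincomb:
  "nbr_sum n (\<lambda>j. c * x j + d * y j) i = c * nbr_sum n x i + d * nbr_sum n y i"
  by (auto simp: nbr_sum_def algebra_simps)

lemma nbr_sum_pow_lincomb:
  "(nbr_sum n ^^ k) (\<lambda>j. c * x j + d * y j) i = c * (nbr_sum n ^^ k) x i + d * (nbr_sum n ^^ k) y i"
proof (induction k arbitrary: i)
  case (Suc k)
  then have "(nbr_sum n ^^ k) (\<lambda>j. c * x j + d * y j)
     = (\<lambda>i. c * (nbr_sum n ^^ k) x i + d * (nbr_sum n ^^ k) y i)" by blast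
  then show ?case by (simp add: nbr_sum_lincomb)
qed simp

lemma nbr_exp_lincomb:
  "nbr_exp n s (\<lambda>j. c * x j + d * y j) i = c * nbr_exp n s x i + d * nbr_exp n s y i"
proof -
  have "c * nbr_exp n s x i + d * nbr_exp n s y i
    = (\<Sum>k. c * ((nbr_sum n ^^ k) x i / fact k * s ^ k) + d * ((nbr_sum n ^^ k) y i / fact k * s ^ k))"
    unfolding nbr_exp_def
    by (subst (1 2) suminf_mult[OF nbr_exp_summable, symmetric], rule suminf_add)
       (intro summable_mult nbr_exp_summable)+
  also have "\<dots> = nbr_exp n s (\<lambda>j. c * x j + d * y j) i"
    unfolding nbr_exp_def by (intro suminf_cong) (simp add: nbr_sum_pow_lincomb field_simps)
  finally show ?thesis by simp
qed

lemma heat_lincomb: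
  "heat n s (\<lambda>j. c * x j + d * y j) i = c * heat n s x i + d * heat n s y i"
  by (simp add: heat_def nbr_exp_lincomb algebra_simps)

lemma nbr_exp_nbr_sum: "nbr_exp n s (nbr_sum n x) i = nbr_sum n (nbr_exp n s x) i"
proof (cases "i = 0 \<or> n < i")
  case True
  have "(nbr_sum n ^^ k) (nbr_sum n x) i = 2 * (nbr_sum n ^^ k) x i" for k
    unfolding funpow_swap1[symmetric] using True by (simp add: nbr_sum_def)
  then have "nbr_exp n s (nbr_sum n x) i = (\<Sum>k. 2 * ((nbr_sum n ^^ k) x i / fact k * s ^ k))"
    by (simp add: nbr_exp_def mult.assoc)
  also have "\<dots> = 2 * nbr_exp n s x i"
    unfolding nbr_exp_def by (rule suminf_mult[OF nbr_exp_summable])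
  finally show ?thesis using True by (simp add: nbr_sum_def)
next
  case False
  have "(nbr_sum n ^^ k) (nbr_sum n x) i = (nbr_sum n ^^ k) x (i - 1) + (nbr_sum n ^^ k) x (i + 1)" for k
    unfolding funpow_swap1[symmetric] using False by (simp add: nbr_sum_def)
  then have "nbr_exp n s (nbr_sum n x) i
     = (\<Sum>k. (nbr_sum n ^^ k) x (i - 1) / fact k * s ^ k + (nbr_sum n ^^ k) x (i + 1) / fact k * s ^ k)"
    by (simp add: nbr_exp_def add_divide_distrib distrib_right)
  also have "\<dots> = nbr_exp n s x (i - 1) + nbr_exp n s x (i + 1)"
    unfolding nbr_exp_def by (intro suminf_add[symmetric] nbr_exp_summable)
  finally show ?thesis using False by (simp add: nbr_sum_def)
qed

lemma DERIV_nbr_exp: "((\<lambda>s. nbr_exp n s x i) has_real_derivative nbr_sum n (nbr_exp n s x) i) (at s)"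
proof -
  let ?c = "\<lambda>k. (nbr_sum n ^^ k) x i / fact k"
  have "((\<lambda>s. \<Sum>k. ?c k * s ^ k) has_real_derivative (\<Sum>k. diffs ?c k * s ^ k)) (at s)"
    by (rule termdiffs_strong_converges_everywhere) (rule nbr_exp_summable)
  also have "diffs ?c = (\<lambda>k. (nbr_sum n ^^ k) (nbr_sum n x) i / fact k)"
    unfolding funpow_swap1[symmetric] by (auto simp: diffs_def fun_eq_iff simp del: of_nat_Suc)
  finally show ?thesis unfolding nbr_exp_nbr_sum[symmetric] by (simp add: nbr_exp_def)
qed

lemma nbr_sum_cmult: "nbr_sum n (\<lambda>j. c * x j) i = c * nbr_sum n x i"
  using nbr_sum_lincomb[of n c x 0 x i] by simp

lemma DERIV_heat:
  "((\<lambda>s. heat n s x i) has_real_derivative (nbr_sum n (heat n s x) i - 2 * heat n s x i)) (at s)"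
  unfolding heat_def
  by (rule derivative_eq_intros DERIV_nbr_exp refl | simp)+ (simp add: nbr_sum_cmult algebra_simps nbr_sum_cmult[of n "exp (- (s * 2))", simplified mult.commute])

lemma heat_continuous: "isCont (\<lambda>s. heat n s x i) s"
  using DERIV_heat by (rule DERIV_isCont)

lemma continuous_on_heat [continuous_intros]:
  "continuous_on A f \<Longrightarrow> continuous_on A (\<lambda>z. heat n (f z) x i)"
  by (rule continuous_on_compose2[of UNIV "\<lambda>s. heat n s x i" A f])
     (auto intro!: continuous_at_imp_continuous_on heat_continuous)

lemma heat_0 [simp]: "heat n 0 x = x"
  unfolding heat_def nbr_exp_def by (rule ext) (subst powser_zero, simp)

lemma heat_end: "i = 0 \<or> n < i \<Longrightarrow> heat n s x i = x i"
proof -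
  assume i: "i = 0 \<or> n < i"
  have "(nbr_sum n ^^ k) x i = 2 ^ k * x i" for k
    by (induction k) (use i in \<open>auto simp: nbr_sum_def\<close>)
  then have "nbr_exp n s x i = (\<Sum>k. ((2 * s) ^ k /\<^sub>R fact k) * x i)"
    by (auto simp: nbr_exp_def power_mult_distrib field_simps intro!: suminf_cong)
  also have "\<dots> = exp (2 * s) * x i"
    unfolding exp_def by (rule suminf_mult2[symmetric]) (rule summable_exp_generic)
  finally show ?thesis by (simp add: heat_def exp_minus field_simps)
qed

text \<open>
  Uniqueness by an energy estimate: the derivative of \<open>\<Sum> w\<^sub>i\<^sup>2\<close> is at most a constant times
  \<open>\<Sum> w\<^sub>i\<^sup>2\<close>, so a solution that starts at zero stays there. The factor \<open>d\<close> covers both directions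
  of time.
\<close>

lemma heat_equation_zero:
  fixes w :: "nat \<Rightarrow> real \<Rightarrow> real"
  assumes w0: "\<And>i. i \<le> Suc n \<Longrightarrow> w i 0 = 0"
    and der: "\<And>i s. i \<le> Suc n \<Longrightarrow> s \<in> {0..T} \<Longrightarrow>
      (w i has_real_derivative d * (nbr_sum n (\<lambda>j. w j s) i - 2 * w i s)) (at s within {0..T})"
    and t: "0 \<le> t" "t \<le> T" and i: "i \<le> Suc n"
  shows "w i t = 0"
proof -
  define \<phi> where "\<phi> s = (\<Sum>i\<le>Suc n. (w i s)\<^sup>2)" for s
  define D where "D i s = d * (nbr_sum n (\<lambda>j. w j s) i - 2 * w i s)" for i s
  \<comment> \<open>each of the \<open>n + 2\<close> squares has derivative at most \<open>8 |d|\<close> times the whole energy\<close>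
  define K where "K = real (n + 2) * (8 * \<bar>d\<bar>)"
  have le: "(w i s)\<^sup>2 \<le> \<phi> s" if "i \<le> Suc n" for i s
    unfolding \<phi>_def using that by (intro member_le_sum) auto
  have ww: "\<bar>w i s * w j s\<bar> \<le> \<phi> s" if "i \<le> Suc n" "j \<le> Suc n" for i j s
  proof -
    have "2 * \<bar>w i s * w j s\<bar> \<le> (w i s)\<^sup>2 + (w j s)\<^sup>2"
      using sum_squares_bound[of "\<bar>w i s\<bar>" "\<bar>w j s\<bar>"] by (simp add: abs_mult)
    then show ?thesis using le[OF that(1), of s] le[OF that(2), of s] by linarith
  qed
  have bnd: "2 * w i s * D i s \<le> 8 * \<bar>d\<bar> * \<phi> s" if i: "i \<le> Suc n" for i s
  proof -
    have "\<bar>w i s * nbr_sum n (\<lambda>j. w j s) i\<bar> \<le> 2 * \<phi> s"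
    proof (cases "i = 0 \<or> n < i")
      case True
      then show ?thesis using ww[OF i i, of s] by (auto simp: nbr_sum_def)
    next
      case False
      then have "\<bar>w i s * w (i - 1) s\<bar> \<le> \<phi> s" "\<bar>w i s * w (i + 1) s\<bar> \<le> \<phi> s"
        using i by (auto intro!: ww)
      then show ?thesis using False
        by (simp add: nbr_sum_def distrib_left)
    qed
    moreover have "\<bar>w i s * w i s\<bar> \<le> \<phi> s" by (rule ww[OF i i])
    ultimately have "\<bar>w i s * nbr_sum n (\<lambda>j. w j s) i - 2 * (w i s * w i s)\<bar> \<le> 4 * \<phi> s"
      by linarith
    then have "\<bar>d\<bar> * \<bar>w i s * nbr_sum n (\<lambda>j. w j s) i - 2 * (w i s * w i s)\<bar> \<le> \<bar>d\<bar> * (4 * \<phi> s)"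
      by (intro mult_left_mono) auto
    moreover have "2 * w i s * D i s = 2 * (d * (w i s * nbr_sum n (\<lambda>j. w j s) i - 2 * (w i s * w i s)))"
      by (simp add: D_def algebra_simps)
    ultimately show ?thesis
      using abs_ge_self[of "d * (w i s * nbr_sum n (\<lambda>j. w j s) i - 2 * (w i s * w i s))"]
      unfolding abs_mult by linarith
  qed
  have \<phi>': "(\<phi> has_real_derivative (\<Sum>i\<le>Suc n. 2 * w i s * D i s)) (at s within {0..T})"
    if "s \<in> {0..T}" for s
    unfolding \<phi>_def
    by (rule derivative_eq_intros der[OF _ that] refl | simp)+
       (simp add: D_def ac_simps)
  define \<psi> where "\<psi> s = - (exp (- (K * s)) * \<phi> s)" for s
  have \<psi>': "(\<psi> has_real_derivative exp (- (K * s)) * (K * \<phi> s - (\<Sum>i\<le>Suc n. 2 * w i s * D i s)))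
      (at s within {0..T})" if "s \<in> {0..T}" for s
    unfolding \<psi>_def
    by (rule derivative_eq_intros \<phi>'[OF that] refl | simp)+ (simp add: algebra_simps)
  have pos: "0 \<le> exp (- (K * s)) * (K * \<phi> s - (\<Sum>i\<le>Suc n. 2 * w i s * D i s))" for s
  proof -
    have "(\<Sum>i\<le>Suc n. 2 * w i s * D i s) \<le> (\<Sum>i\<le>Suc n. 8 * \<bar>d\<bar> * \<phi> s)"
      by (intro sum_mono bnd) auto
    also have "\<dots> = K * \<phi> s" by (simp add: K_def algebra_simps)
    finally show ?thesis by simp
  qed
  have "\<psi> 0 \<le> \<psi> t"
  proof (rule DERIV_nonneg_imp_increasing_open[OF t(1)])
    fix s assume s: "0 < s" "s < t"
    then have "at s within {0..T} = at s" using t by (intro at_within_Icc_at) auto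
    then show "\<exists>y. DERIV \<psi> s :> y \<and> 0 \<le> y" using \<psi>'[of s] pos[of s] s t by auto
  next
    have "continuous_on {0..T} \<psi>" using \<psi>' by (rule DERIV_continuous_on)
    then show "continuous_on {0..t} \<psi>" by (rule continuous_on_subset) (use t in auto)
  qed
  moreover have "\<psi> 0 = 0" using w0 by (simp add: \<psi>_def \<phi>_def)
  ultimately have "\<phi> t \<le> 0" by (simp add: \<psi>_def zero_le_mult_iff mult_le_0_iff)
  then show ?thesis using le[OF i, of t] by (metis order_trans power2_less_eq_zero_iff)
qed

lemma nbr_sum_diff: "nbr_sum n (\<lambda>j. x j - y j) i = nbr_sum n x i - nbr_sum n y i"
  using nbr_sum_lincomb[of n 1 x "-1" y i] by simp

lemma heat_add: "heat n (s + t) x = heat n s (heat n t x)"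
proof
  fix i
  show "heat n (s + t) x i = heat n s (heat n t x) i"
  proof (cases "i \<le> Suc n")
    case False
    then show ?thesis by (simp add: heat_end)
  next
    case True
    \<comment> \<open>follow the flow from time \<open>t\<close> in the direction of the sign of \<open>s\<close>\<close>
    define d :: real where "d = (if 0 \<le> s then 1 else -1)"
    define w where "w i r = heat n (d * r + t) x i - heat n (d * r) (heat n t x) i" for i r
    have "w i \<bar>s\<bar> = 0"
    proof (rule heat_equation_zero[where w = w and T = "\<bar>s\<bar>" and d = d and n = n])
      fix j r
      have "(w j has_real_derivative
          (nbr_sum n (heat n (d * r + t) x) j - 2 * heat n (d * r + t) x j) * d
          - (nbr_sum n (heat n (d * r) (heat n t x)) j - 2 * heat n (d * r) (heat n t x) j) * d) (at r)"
        unfolding w_def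
        by (intro DERIV_diff DERIV_chain2[OF DERIV_heat]) (auto intro!: derivative_eq_intros)
      then show "(w j has_real_derivative d * (nbr_sum n (\<lambda>j. w j r) j - 2 * w j r)) (at r within {0..\<bar>s\<bar>})"
        by (rule DERIV_cong[OF has_field_derivative_at_within]) (simp add: w_def nbr_sum_diff algebra_simps)
    qed (use True in \<open>auto simp: w_def\<close>)
    moreover have "d * \<bar>s\<bar> = s" by (simp add: d_def)
    ultimately show ?thesis by (simp add: w_def)
  qed
qed

lemma heat_inverse [simp]: "heat n s (heat n (- s) x) = x" "heat n (- s) (heat n s x) = x"
  using heat_add[of n s "- s" x] heat_add[of n "- s" s x] by simp_all

definition increasing_upto :: "nat \<Rightarrow> (nat \<Rightarrow> real) \<Rightarrow> bool" where
  "increasing_upto n x \<longleftrightarrow> (\<forall>i\<le>n. x i < x (Suc i))"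

lemma increasing_less: "increasing_upto n x \<Longrightarrow> i < j \<Longrightarrow> j \<le> Suc n \<Longrightarrow> x i < x j"
proof (induction j)
  case (Suc j)
  then have "x j < x (Suc j)" by (auto simp: increasing_upto_def)
  then show ?case using Suc by (cases "i = j") auto
qed simp

lemma increasing_nbr_sum:
  assumes "increasing_upto n x"
  shows "increasing_upto n (nbr_sum n x)"
  unfolding increasing_upto_def
proof safe
  fix i assume i: "i \<le> n"
  have 1: "x i < x (Suc i)" using assms i by (simp add: increasing_upto_def)
  have 2: "x (i - 1) < x i" if "0 < i" by (rule increasing_less[OF assms]) (use that i in auto)
  have 3: "x (Suc i) < x (Suc (Suc i))" if "i < n" using assms that by (simp add: increasing_upto_def)
  show "nbr_sum n x i < nbr_sum n x (Suc i)"
    using 1 2 3 i by (cases "i = 0"; cases "i = n") (auto simp: nbr_sum_def)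
qed

text \<open>The heat flow averages, and averaging neighbouring positions keeps their strict order.\<close>

lemma increasing_heat:
  assumes "increasing_upto n x" "0 \<le> s"
  shows "increasing_upto n (heat n s x)"
  unfolding increasing_upto_def
proof safe
  fix i assume i: "i \<le> n"
  define g where "g k = ((nbr_sum n ^^ k) x (Suc i) - (nbr_sum n ^^ k) x i) / fact k * s ^ k" for k
  have "increasing_upto n ((nbr_sum n ^^ k) x)" for k
    by (induction k) (auto intro: increasing_nbr_sum assms)
  then have g: "0 \<le> g k" for k
    using i assms(2) by (auto simp: g_def increasing_upto_def less_imp_le intro!: mult_nonneg_nonneg divide_nonneg_nonneg)
  have gd: "g k = (nbr_sum n ^^ k) x (Suc i) / fact k * s ^ k - (nbr_sum n ^^ k) x i / fact k * s ^ k" for k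
    by (simp add: g_def diff_divide_distrib left_diff_distrib)
  have sm: "summable g" unfolding gd by (intro summable_diff nbr_exp_summable)
  have "0 < g 0" using assms(1) i by (simp add: g_def increasing_upto_def)
  also have "g 0 \<le> suminf g" using sum_le_suminf[OF sm, of "{0}"] g by simp
  also have "suminf g = nbr_exp n s x (Suc i) - nbr_exp n s x i"
    unfolding gd nbr_exp_def by (intro suminf_diff[symmetric] nbr_exp_summable)
  finally show "heat n s x i < heat n s x (Suc i)" by (simp add: heat_def)
qed

section \<open>The first collision\<close>

definition collision_time :: "nat \<Rightarrow> (nat \<Rightarrow> real) \<Rightarrow> real" where
  "collision_time n x = Inf {s. 0 \<le> s \<and> \<not> increasing_upto n (heat n (- s) x)}"

text \<open>
  The evolution run backwards is the heat flow, which keeps strict order.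
\<close>

lemma increasing_earlier:
  assumes "increasing_upto n (heat n (- t) x)" "s \<le> t"
  shows "increasing_upto n (heat n (- s) x)"
proof -
  have "increasing_upto n (heat n (t - s) (heat n (- t) x))"
    using increasing_heat[OF assms(1), of "t - s"] assms(2) by simp
  then show ?thesis by (simp add: heat_add[symmetric])
qed

lemma closed_not_increasing: "closed {s. 0 \<le> s \<and> \<not> increasing_upto n (heat n (- s) x)}"
proof -
  have "{s. 0 \<le> s \<and> \<not> increasing_upto n (heat n (- s) x)}
    = {0..} \<inter> (\<Union>i\<in>{..n}. {s. heat n (- s) x (Suc i) \<le> heat n (- s) x i})"
    by (auto simp: increasing_upto_def not_less)
  then show ?thesis
    by (auto intro!: closed_Int closed_UN closed_Collect_le continuous_intros)
qed

lemma collision_time: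
  assumes "increasing_upto n x" "0 \<le> t" "\<not> increasing_upto n (heat n (- t) x)"
  shows "0 < collision_time n x" "collision_time n x \<le> t"
    "\<not> increasing_upto n (heat n (- collision_time n x) x)"
    "\<And>s. s < collision_time n x \<Longrightarrow> increasing_upto n (heat n (- s) x)"
proof -
  let ?D = "{s. 0 \<le> s \<and> \<not> increasing_upto n (heat n (- s) x)}"
  have bdd: "bdd_below ?D" by (rule bdd_belowI[of _ 0]) auto
  have "collision_time n x \<in> ?D"
    unfolding collision_time_def
    by (rule closed_contains_Inf) (use assms bdd closed_not_increasing in auto)
  then show 1: "\<not> increasing_upto n (heat n (- collision_time n x) x)" and "0 < collision_time n x"
    using assms(1) by (auto simp: order_le_less)
  show "collision_time n x \<le> t"
    unfolding collision_time_def by (rule cInf_lower) (use assms bdd in auto)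
  show "increasing_upto n (heat n (- s) x)" if "s < collision_time n x" for s
  proof (rule ccontr)
    assume s: "\<not> increasing_upto n (heat n (- s) x)"
    then have "0 \<le> s" using increasing_earlier[of n 0 x s] assms(1) by fastforce
    then have "collision_time n x \<le> s"
      unfolding collision_time_def by (intro cInf_lower) (use s bdd in auto)
    then show False using that by simp
  qed
qed

lemma collision_time_eqI:
  assumes "increasing_upto n x" "0 \<le> t" "\<not> increasing_upto n (heat n (- t) x)"
    "\<And>s. 0 \<le> s \<Longrightarrow> s < t \<Longrightarrow> increasing_upto n (heat n (- s) x)"
  shows "collision_time n x = t"
  using collision_time[OF assms(1-3)] assms(4)[of "collision_time n x"]
  by (auto simp: order_le_less)

lemma increasing_iff_less_collision_time:
  assumes "increasing_upto n x" "0 \<le> t" "\<not> increasing_upto n (heat n (- t) x)"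
  shows "increasing_upto n (heat n (- s) x) \<longleftrightarrow> s < collision_time n x"
  using collision_time(3,4)[OF assms] increasing_earlier[of n s x "collision_time n x"]
  by (meson not_less)

lemma collision_time_weakly_increasing:
  assumes "increasing_upto n x" "0 \<le> t" "\<not> increasing_upto n (heat n (- t) x)" "i \<le> n"
  defines "y \<equiv> heat n (- collision_time n x) x"
  shows "y i \<le> y (Suc i)"
proof -
  let ?\<tau> = "collision_time n x"
  have "((\<lambda>s. heat n (- s) x (Suc i) - heat n (- s) x i) \<longlongrightarrow> y (Suc i) - y i) (at_left ?\<tau>)"
    unfolding y_def
    by (intro tendsto_diff isCont_tendsto_compose[OF heat_continuous] tendsto_minus tendsto_ident_at)
  moreover have "eventually (\<lambda>s. 0 \<le> heat n (- s) x (Suc i) - heat n (- s) x i) (at_left ?\<tau>)"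
    unfolding eventually_at_filter
    using collision_time(4)[OF assms(1-3)] assms(4)
    by (intro always_eventually) (auto simp: increasing_upto_def less_imp_le)
  ultimately have "0 \<le> y (Suc i) - y i"
    by (rule tendsto_lowerbound) simp
  then show ?thesis by simp
qed

lemma weakly_increasing_le:
  fixes y :: "nat \<Rightarrow> real"
  assumes "\<And>i. i \<le> n \<Longrightarrow> y i \<le> y (Suc i)"
  shows "i \<le> j \<Longrightarrow> j \<le> Suc n \<Longrightarrow> y i \<le> y j"
proof (induction j)
  case (Suc j)
  then have "i = Suc j \<or> y i \<le> y j" by (auto simp: le_Suc_eq)
  then show ?case using assms[of j] Suc.prems by auto
qed simp

lemma ode_solution_heat:
  "ode_solution (map x [0..<n + 2]) (\<lambda>i s. heat n (- s) x i) T"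
  unfolding ode_solution_def
proof (intro conjI allI ballI impI)
  fix i s assume "i < length (map x [0..<n + 2])"
  then have i: "i \<le> Suc n" by simp
  have "((\<lambda>s. heat n (- s) x i) has_real_derivative
      (nbr_sum n (heat n (- s) x) i - 2 * heat n (- s) x i) * (- 1)) (at s within {0..T})"
    by (rule has_field_derivative_at_within, rule DERIV_chain2[OF DERIV_heat])
       (auto intro!: derivative_eq_intros)
  then show "((\<lambda>s. heat n (- s) x i) has_real_derivative
      (if i = 0 \<or> i = length (map x [0..<n + 2]) - 1 then 0
       else - heat n (- s) x (i - 1) + 2 * heat n (- s) x i - heat n (- s) x (i + 1))) (at s within {0..T})"
    by (rule DERIV_cong) (use i in \<open>auto simp: nbr_sum_def\<close>)
qed (simp del: upt_Suc)

lemma ode_solution_unique: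
  assumes u: "ode_solution (map x [0..<n + 2]) u T" and s: "s \<in> {0..T}" and i: "i \<le> Suc n"
  shows "u i s = heat n (- s) x i"
proof -
  define F where "F u i s = (if i = 0 \<or> n < i then 0 else - u (i - 1) s + 2 * u i s - u (i + 1) s)"
    for u :: "nat \<Rightarrow> real \<Rightarrow> real" and i s
  have len: "length (map x [0..<n + 2]) = n + 2" by (simp del: upt_Suc)
  have sol: "v i 0 = x i" "\<And>s. s \<in> {0..T} \<Longrightarrow> (v i has_real_derivative F v i s) (at s within {0..T})"
    if "ode_solution (map x [0..<n + 2]) v T" "i \<le> Suc n" for v i
  proof -
    show "v i 0 = x i"
      using that unfolding ode_solution_def len by (simp del: upt_Suc)
    show "(v i has_real_derivative F v i s) (at s within {0..T})" if s: "s \<in> {0..T}" for s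
    proof -
      have "(v i has_real_derivative (if i = 0 \<or> i = n + 2 - 1 then 0
            else - v (i - 1) s + 2 * v i s - v (i + 1) s)) (at s within {0..T})"
        using \<open>ode_solution _ v T\<close> \<open>i \<le> Suc n\<close> s unfolding ode_solution_def len by simp
      then show ?thesis
        by (rule DERIV_cong) (use \<open>i \<le> Suc n\<close> in \<open>auto simp: F_def\<close>)
    qed
  qed
  define w where "w i s = u i s - heat n (- s) x i" for i s
  have "w i s = 0"
  proof (rule heat_equation_zero[where w = w and T = T and d = "-1" and n = n])
    fix i assume i: "i \<le> Suc n"
    show "w i 0 = 0" using sol(1)[OF u i] by (simp add: w_def)
    fix s assume s: "s \<in> {0..T}"
    have "(w i has_real_derivative F u i s - F (\<lambda>i s. heat n (- s) x i) i s) (at s within {0..T})"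
      unfolding w_def
      by (rule DERIV_diff[OF sol(2)[OF u i s] sol(2)[OF ode_solution_heat i s]])
    then show "(w i has_real_derivative - 1 * (nbr_sum n (\<lambda>j. w j s) i - 2 * w i s)) (at s within {0..T})"
      by (rule DERIV_cong) (simp add: F_def w_def nbr_sum_def algebra_simps)
  qed (use s i in auto)
  then show ?thesis by (simp add: w_def)
qed

lemma distinct_increasing: "increasing_upto n x \<Longrightarrow> distinct (map x [0..<n + 2])"
  unfolding distinct_map
  by (auto simp: inj_on_def simp del: upt_Suc) (metis increasing_less less_Suc_eq_le linorder_neqE_nat order_less_irrefl)

text \<open>
  Coordinates that never meet cannot change their order, by the intermediate value theorem.
\<close>

lemma increasing_if_distinct:
  assumes "increasing_upto n x" "0 \<le> t" "\<And>s. s \<in> {0..t} \<Longrightarrow> distinct (map (heat n (- s) x) [0..<n + 2])"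
  shows "increasing_upto n (heat n (- t) x)"
  unfolding increasing_upto_def
proof (intro allI impI, rule ccontr)
  fix i assume i: "i \<le> n" and neg: "\<not> heat n (- t) x i < heat n (- t) x (Suc i)"
  define g where "g s = heat n (- s) x (Suc i) - heat n (- s) x i" for s
  have "\<exists>s\<ge>0. s \<le> t \<and> g s = 0"
    by (rule IVT2') (use neg assms(1,2) i in \<open>auto simp: g_def increasing_upto_def less_imp_le intro!: continuous_intros\<close>)
  then obtain s where s: "0 \<le> s" "s \<le> t" "heat n (- s) x (Suc i) = heat n (- s) x i"
    by (auto simp: g_def)
  have "inj_on (heat n (- s) x) {0..<n + 2}"
    using assms(3)[of s] s by (auto simp: distinct_map simp del: upt_Suc)
  then have "Suc i = i" using s(3) i by (auto dest!: inj_onD)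
  then show False by simp
qed

lemma positions_heat:
  assumes "ode_solution (map x [0..<n + 2]) u T" "s \<in> {0..T}"
  shows "positions (length (map x [0..<n + 2])) u s = map (heat n (- s) x) [0..<n + 2]"
  unfolding positions_def using ode_solution_unique[OF assms] by (simp del: upt_Suc)

text \<open>
  Since the evolution is determined up to and including its first collision, the set of its possible
  outcomes unfolds by one collision. As an identity of predicates this suffices for
  \<^const>\<open>coarsen\<close>, which selects the outcome by a definite description.
\<close>

lemma evolves_first_step:
  assumes x: "increasing_upto n x" and t: "0 \<le> t"
  defines "\<tau> \<equiv> collision_time n x"
  shows "evolves (map x [0..<n + 2]) t ys \<longleftrightarrow>
    (if increasing_upto n (heat n (- t) x) then ys = map (heat n (- t) x) [0..<n + 2]
     else evolves (remdups (map (heat n (- \<tau>) x) [0..<n + 2])) (t - \<tau>) ys)"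
    (is "?L \<longleftrightarrow> ?R")
proof
  assume ?L
  then show ?R
  proof cases
    case (no_collision u)
    then have "increasing_upto n (heat n (- t) x)"
      by (intro increasing_if_distinct[OF x t]) (metis positions_heat)
    moreover have "ys = map (heat n (- t) x) [0..<n + 2]"
      using no_collision positions_heat[of x n u t t] by auto
    ultimately show ?thesis by simp
  next
    case (collision \<sigma> u)
    have d: "distinct (map (heat n (- s) x) [0..<n + 2])" if "s \<in> {0..<\<sigma>}" for s
    proof -
      have "positions (length (map x [0..<n + 2])) u s = map (heat n (- s) x) [0..<n + 2]"
        by (rule positions_heat[OF collision(3)]) (use that in auto)
      then show ?thesis using bspec[OF collision(4) that] by metis
    qed
    have i: "increasing_upto n (heat n (- s) x)" if "0 \<le> s" "s < \<sigma>" for s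
      by (rule increasing_if_distinct[OF x]) (use that d in \<open>auto simp del: upt_Suc\<close>)
    have p: "positions (length (map x [0..<n + 2])) u \<sigma> = map (heat n (- \<sigma>) x) [0..<n + 2]"
      using collision positions_heat[of x n u \<sigma> \<sigma>] by (auto simp del: upt_Suc)
    have n: "\<not> increasing_upto n (heat n (- \<sigma>) x)"
      using collision(5) distinct_increasing unfolding p by blast
    have "\<tau> = \<sigma>" unfolding \<tau>_def
      by (rule collision_time_eqI[OF x]) (use collision i n in auto)
    moreover have "\<not> increasing_upto n (heat n (- t) x)"
      using increasing_earlier[of n t x \<sigma>] collision n by auto
    ultimately show ?thesis using collision(6) p by simp
  qed
next
  assume R: ?R
  show ?L
  proof (cases "increasing_upto n (heat n (- t) x)")
    case True
    have "evolves (map x [0..<n + 2]) t (positions (length (map x [0..<n + 2])) (\<lambda>i s. heat n (- s) x i) t)"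
    proof (rule evolves.no_collision[OF t ode_solution_heat], rule)
      fix s assume "s \<in> {0..t}"
      then show "distinct (positions (length (map x [0..<n + 2])) (\<lambda>i s. heat n (- s) x i) s)"
        using distinct_increasing[OF increasing_earlier[OF True, of s]] by (simp add: positions_def del: upt_Suc)
    qed
    then show ?thesis using R True by (simp add: positions_def del: upt_Suc)
  next
    case False
    note \<tau> = collision_time[OF x t False, folded \<tau>_def]
    have eq: "positions (length (map x [0..<n + 2])) (\<lambda>i s. heat n (- s) x i) s
       = map (heat n (- s) x) [0..<n + 2]" for s
      by (simp add: positions_def del: upt_Suc)
    obtain i where i: "i \<le> n" "heat n (- \<tau>) x i = heat n (- \<tau>) x (Suc i)"
      using \<tau>(3) collision_time_weakly_increasing[OF x t False, folded \<tau>_def]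
      by (force simp: increasing_upto_def not_less)
    have nd: "\<not> distinct (map (heat n (- \<tau>) x) [0..<n + 2])"
    proof
      assume "distinct (map (heat n (- \<tau>) x) [0..<n + 2])"
      then have "inj_on (heat n (- \<tau>) x) {0..<n + 2}" by (simp add: distinct_map del: upt_Suc)
      then have "i = Suc i" using i by (auto dest!: inj_onD)
      then show False by simp
    qed
    show ?thesis
      by (rule evolves.collision[where \<tau> = \<tau>, OF \<tau>(1,2) ode_solution_heat], unfold eq)
         (use \<tau>(4) distinct_increasing nd R False in \<open>auto simp del: upt_Suc\<close>)
  qed
qed

definition pad :: "real \<Rightarrow> real \<Rightarrow> nat \<Rightarrow> (nat \<Rightarrow> real) \<Rightarrow> nat \<Rightarrow> real" where
  "pad a b n x i = (if i = 0 then a else if i \<le> n then x i else b)"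

text \<open>
  The lists occurring in the evolution are determined by their sets of entries, because they are
  sorted from \<open>a\<close> to \<open>b\<close>.
\<close>

lemma sorted_ends_list:
  fixes y :: "nat \<Rightarrow> real"
  assumes "\<And>i. i \<le> n \<Longrightarrow> y i \<le> y (Suc i)" "y 0 = a" "y (Suc n) = b" "a < b"
  shows "remdups (map y [0..<n + 2]) = a # sorted_list_of_set (y ` {..Suc n} \<inter> {a<..<b}) @ [b]"
proof (rule sorted_distinct_set_unique)
  have "sorted (map y [0..<n + 2])"
    unfolding sorted_iff_nth_mono
    by (auto simp del: upt_Suc intro!: weakly_increasing_le[of n y, OF assms(1)])
  then show "sorted (remdups (map y [0..<n + 2]))" by (rule sorted_remdups)
  have m: "a \<le> y i" "y i \<le> b" if "i \<le> Suc n" for i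
    using weakly_increasing_le[of n y, OF assms(1), of 0 i]
      weakly_increasing_le[of n y, OF assms(1), of i "Suc n"] that assms(2,3) by simp_all
  have fin: "finite (y ` {..Suc n} \<inter> {a<..<b})" by simp
  show "sorted (a # sorted_list_of_set (y ` {..Suc n} \<inter> {a<..<b}) @ [b])"
    using fin assms(4) by (auto simp: sorted_append)
  show "distinct (a # sorted_list_of_set (y ` {..Suc n} \<inter> {a<..<b}) @ [b])"
    using fin assms(4) by auto
  have "set (remdups (map y [0..<n + 2])) = y ` {..Suc n}"
    by (simp add: atLeast0LessThan lessThan_Suc_atMost del: upt_Suc)
  also have "\<dots> = insert a (insert b (y ` {..Suc n} \<inter> {a<..<b}))"
  proof safe
    fix i assume "i \<le> Suc n" "y i \<noteq> b" "y i \<noteq> a"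
    then show "y i \<in> {a<..<b}" using m[of i] by simp
  next
    show "a \<in> y ` {..Suc n}" "b \<in> y ` {..Suc n}" using assms(2,3) by (auto simp del: atMost_Suc)
  qed auto
  finally show "set (remdups (map y [0..<n + 2])) = set (a # sorted_list_of_set (y ` {..Suc n} \<inter> {a<..<b}) @ [b])"
    using fin by auto
qed simp

lemma pad_image_inter:
  assumes "increasing_upto n (pad a b n x)"
  shows "pad a b n x ` {..Suc n} \<inter> {a<..<b} = x ` {1..n}" "x ` {1..n} \<subseteq> {a<..<b}"
proof -
  have l: "a < x i" "x i < b" if "i \<in> {1..n}" for i
    using increasing_less[OF assms, of 0 i] increasing_less[OF assms, of i "Suc n"] that
    by (auto simp: pad_def)
  then show "x ` {1..n} \<subseteq> {a<..<b}" by auto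
  have "pad a b n x i \<in> x ` {1..n}" if "i \<le> Suc n" "pad a b n x i \<in> {a<..<b}" for i
    using that by (auto simp: pad_def split: if_splits)
  moreover have "x i \<in> pad a b n x ` {..Suc n}" if "i \<in> {1..n}" for i
    using that by (intro image_eqI[of _ _ i]) (auto simp: pad_def)
  ultimately show "pad a b n x ` {..Suc n} \<inter> {a<..<b} = x ` {1..n}" using l by auto
qed

definition after_collision :: "real \<Rightarrow> real \<Rightarrow> nat \<Rightarrow> (nat \<Rightarrow> real) \<Rightarrow> real set" where
  "after_collision a b n x =
     heat n (- collision_time n (pad a b n x)) (pad a b n x) ` {..Suc n} \<inter> {a<..<b}"

lemma coarsen_alive:
  assumes x: "increasing_upto n (pad a b n x)" and t: "0 \<le> t" and ab: "a < b"
    and al: "increasing_upto n (heat n (- t) (pad a b n x))"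
  shows "coarsen a b t (x ` {1..n}) = heat n (- t) (pad a b n x) ` {1..n}"
proof -
  let ?X = "pad a b n x"
  have eq: "a # sorted_list_of_set (x ` {1..n} \<inter> {a<..<b}) @ [b] = map ?X [0..<n + 2]"
    using sorted_ends_list[of n ?X a b] x ab pad_image_inter[OF x] distinct_increasing[OF x]
    by (auto simp: increasing_upto_def less_imp_le pad_def distinct_remdups_id Int_absorb2 simp del: upt_Suc)
  have "coarsen a b t (x ` {1..n}) = set (butlast (tl (map (heat n (- t) ?X) [0..<n + 2])))"
    unfolding coarsen_def eq evolves_first_step[OF x t] using al by (simp del: upt_Suc)
  also have "[0..<n + 2] = 0 # [1..<Suc n] @ [Suc n]"
    by (simp add: upt_rec[of 0])
  finally show ?thesis by (simp add: atLeastLessThanSuc_atLeastAtMost del: upt_Suc)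
qed

lemma coarsen_collision:
  assumes x: "increasing_upto n (pad a b n x)" and t: "0 \<le> t" and ab: "a < b"
    and al: "\<not> increasing_upto n (heat n (- t) (pad a b n x))"
  shows "coarsen a b t (x ` {1..n}) =
    coarsen a b (t - collision_time n (pad a b n x)) (after_collision a b n x)"
proof -
  let ?X = "pad a b n x" let ?\<tau> = "collision_time n ?X"
  have eq: "a # sorted_list_of_set (x ` {1..n} \<inter> {a<..<b}) @ [b] = map ?X [0..<n + 2]"
    using sorted_ends_list[of n ?X a b] x ab pad_image_inter[OF x] distinct_increasing[OF x]
    by (auto simp: increasing_upto_def less_imp_le pad_def distinct_remdups_id Int_absorb2 simp del: upt_Suc)
  have rd: "remdups (map (heat n (- ?\<tau>) ?X) [0..<n + 2])
    = a # sorted_list_of_set (after_collision a b n x \<inter> {a<..<b}) @ [b]"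
    using sorted_ends_list[of n "heat n (- ?\<tau>) ?X" a b] collision_time_weakly_increasing[OF x t al] ab
    by (simp add: after_collision_def heat_end pad_def[of _ _ _ _ 0] pad_def[of _ _ _ _ "Suc n"] Int_assoc del: upt_Suc)
  show ?thesis
    unfolding coarsen_def eq evolves_first_step[OF x t] rd using al by (simp del: upt_Suc)
qed

text \<open>
  The collision removes a particle: the one with index \<open>i\<close> if it meets the next one, and the first
  one if it meets the left end.
\<close>

lemma card_after_collision:
  assumes x: "increasing_upto n (pad a b n x)" and t: "0 \<le> t" and ab: "a < b"
    and al: "\<not> increasing_upto n (heat n (- t) (pad a b n x))"
  shows "card (after_collision a b n x) < n"
proof -
  let ?y = "heat n (- collision_time n (pad a b n x)) (pad a b n x)"
  have e: "?y 0 = a" "?y (Suc n) = b" by (simp_all add: heat_end pad_def)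
  obtain i where i: "i \<le> n" "?y i = ?y (Suc i)"
    using collision_time(3)[OF x t al] collision_time_weakly_increasing[OF x t al]
    by (force simp: increasing_upto_def not_less)
  have "0 < n" using i e ab by (cases n) auto
  have "?y j \<in> ?y ` ({1..n} - {max 1 i})" if "j \<le> Suc n" "?y j \<in> {a<..<b}" for j
  proof -
    have j: "j \<noteq> 0" "j \<noteq> Suc n" using that e by (metis greaterThanLessThan_iff less_irrefl)+
    show ?thesis
    proof (cases "j = max 1 i")
      case True
      have "i \<noteq> 0"
      proof
        assume "i = 0"
        then have "?y j = a" using True i e by simp
        then show False using that by simp
      qed
      then have ji: "j = i" using True by simp
      have "Suc i \<noteq> Suc n"
      proof
        assume "Suc i = Suc n"
        then have "?y j = b" using ji i e by simp
        then show False using that by simp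
      qed
      then show ?thesis using ji i \<open>i \<noteq> 0\<close> by (intro image_eqI[of _ _ "Suc i"]) auto
    qed (use j that in auto)
  qed
  then have "after_collision a b n x \<subseteq> ?y ` ({1..n} - {max 1 i})"
    by (auto simp: after_collision_def)
  then have "card (after_collision a b n x) \<le> card (?y ` ({1..n} - {max 1 i}))"
    by (intro card_mono) auto
  also have "\<dots> \<le> card ({1..n} - {max 1 i})" by (rule card_image_le) simp
  also have "\<dots> < n" using i \<open>0 < n\<close> by (simp add: card_Diff_singleton)
  finally show ?thesis .
qed

section \<open>Void events determine the law of a configuration\<close>

lemma space_config_space: "space (config_space B) = {S. finite S \<and> S \<subseteq> B}"
  unfolding config_space_def by (rule space_measure_of) auto

lemma sets_config_space:
  "sets (config_space B) = sigma_sets {S. finite S \<and> S \<subseteq> B}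
     {{S. finite S \<and> S \<subseteq> B \<and> card (S \<inter> A) = k} | A k. A \<in> sets borel}"
  unfolding config_space_def by (rule sets_measure_of) auto

lemma measurable_card_Int [measurable]:
  assumes "A \<in> sets borel"
  shows "(\<lambda>S. card (S \<inter> A)) \<in> config_space B \<rightarrow>\<^sub>M count_space UNIV"
proof (subst measurable_count_space_eq2_countable, safe)
  fix k
  have "(\<lambda>S. card (S \<inter> A)) -` {k} \<inter> space (config_space B) = {S. finite S \<and> S \<subseteq> B \<and> card (S \<inter> A) = k}"
    by (auto simp: space_config_space)
  then show "(\<lambda>S. card (S \<inter> A)) -` {k} \<inter> space (config_space B) \<in> sets (config_space B)"
    unfolding sets_config_space using assms by (auto intro!: sigma_sets.Basic)
qed auto

lemma sets_void_event [measurable]: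
  assumes "A \<in> sets borel"
  shows "{S \<in> space (config_space B). S \<inter> A = {}} \<in> sets (config_space B)"
proof -
  have "{S \<in> space (config_space B). S \<inter> A = {}} = {S \<in> space (config_space B). card (S \<inter> A) = 0}"
    by (auto simp: space_config_space)
  also have "\<dots> \<in> sets (config_space B)" using assms by measurable
  finally show ?thesis .
qed

text \<open>
  A finite set has at least \<open>k + 1\<close> points in a closed set \<open>A\<close> iff some rationals \<open>q < q'\<close> separate
  one of its points in \<open>A\<close> from \<open>k\<close> others. Thus counts in closed sets are expressed by void
  events of closed sets, and counts in Borel sets follow by a Dynkin argument.
\<close>

lemma sets_card_ge_if_void:
  fixes f :: "'a \<Rightarrow> real set"
  assumes fin: "\<And>x. x \<in> space M \<Longrightarrow> finite (f x)"
    and void: "\<And>A. closed A \<Longrightarrow> {x \<in> space M. f x \<inter> A = {}} \<in> sets M"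
  shows "closed A \<Longrightarrow> {x \<in> space M. k \<le> card (f x \<inter> A)} \<in> sets M"
proof (induction k arbitrary: A)
  case (Suc k)
  have hit: "{x \<in> space M. f x \<inter> C \<noteq> {}} \<in> sets M" if "closed C" for C
  proof -
    have "{x \<in> space M. f x \<inter> C \<noteq> {}} = space M - {x \<in> space M. f x \<inter> C = {}}" by auto
    then show ?thesis using void[OF that] by auto
  qed
  have eq: "Suc k \<le> card (F \<inter> A) \<longleftrightarrow> (\<exists>q q'::rat. q < q' \<and>
      F \<inter> (A \<inter> {..of_rat q}) \<noteq> {} \<and> k \<le> card (F \<inter> (A \<inter> {of_rat q'..})))" (is "_ \<longleftrightarrow> ?R")
    if F: "finite F" for F :: "real set"
  proof
    assume c: "Suc k \<le> card (F \<inter> A)"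
    define m where "m = Min (F \<inter> A)"
    have ne: "F \<inter> A \<noteq> {}" using c by auto
    then have m: "m \<in> F \<inter> A" unfolding m_def using F by (intro Min_in) auto
    define G where "G = F \<inter> A - {m}"
    have G: "finite G" "k \<le> card G" using c F m by (auto simp: G_def)
    have "\<exists>m'>m. \<forall>y\<in>G. m' \<le> y"
    proof (cases "G = {}")
      case True
      then show ?thesis by (auto intro: gt_ex)
    next
      case False
      then have "Min G \<in> G" using G by (intro Min_in) auto
      moreover have "m \<le> Min G" using \<open>Min G \<in> G\<close> F unfolding m_def G_def by (intro Min_le) auto
      ultimately have "m < Min G" by (auto simp: G_def order_le_less)
      then show ?thesis using G by (intro exI[of _ "Min G"]) auto
    qed
    then obtain m' where m': "m < m'" "\<And>y. y \<in> G \<Longrightarrow> m' \<le> y" by auto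
    obtain q where q: "m < of_rat q" "of_rat q < m'" using of_rat_dense[OF m'(1)] by auto
    obtain q' where q': "of_rat q < (of_rat q' :: real)" "of_rat q' < m'" using of_rat_dense[OF q(2)] by auto
    have "G \<subseteq> F \<inter> (A \<inter> {of_rat q'..})" using m'(2) q'(2) by (force simp: G_def)
    then have "k \<le> card (F \<inter> (A \<inter> {of_rat q'..}))" using G F card_mono order_trans by (metis finite_Int)
    moreover have "m \<in> F \<inter> (A \<inter> {..of_rat q})" using m q by auto
    ultimately show ?R using q'(1) by (intro exI[of _ q] exI[of _ q']) (auto simp: of_rat_less)
  next
    assume ?R
    then obtain q q' y where q: "q < q'" "y \<in> F \<inter> (A \<inter> {..of_rat q})" "k \<le> card (F \<inter> (A \<inter> {of_rat q'..}))"
      by auto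
    have "of_rat q < (of_rat q' :: real)" using q by (simp add: of_rat_less)
    then have "y \<notin> F \<inter> (A \<inter> {of_rat q'..})" using q by auto
    then have "Suc k \<le> card (insert y (F \<inter> (A \<inter> {of_rat q'..})))" using F q by simp
    also have "\<dots> \<le> card (F \<inter> A)" using F q by (intro card_mono) auto
    finally show "Suc k \<le> card (F \<inter> A)" .
  qed
  have "{x \<in> space M. Suc k \<le> card (f x \<inter> A)} = (\<Union>(q, q')\<in>{(q, q'). q < q'}.
      {x \<in> space M. f x \<inter> (A \<inter> {..of_rat q}) \<noteq> {}} \<inter> {x \<in> space M. k \<le> card (f x \<inter> (A \<inter> {of_rat q'..}))})"
    using eq fin by auto
  also have "\<dots> \<in> sets M"
    using Suc by (intro sets.countable_UN' sets.Int countableI_type)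
      (auto intro!: hit Suc.IH closed_Int sets.Int)
  finally show ?case .
qed simp

lemma measurable_config_spaceI:
  fixes f :: "'a \<Rightarrow> real set"
  assumes f: "\<And>x. x \<in> space M \<Longrightarrow> finite (f x) \<and> f x \<subseteq> B"
    and void: "\<And>A. closed A \<Longrightarrow> {x \<in> space M. f x \<inter> A = {}} \<in> sets M"
  shows "f \<in> M \<rightarrow>\<^sub>M config_space B"
proof -
  let ?\<mu> = "\<lambda>A x. emeasure (count_space UNIV) (f x \<inter> A)"
  have fin: "finite (f x)" if "x \<in> space M" for x using f[OF that] by simp
  have \<mu>: "?\<mu> A x = ennreal (card (f x \<inter> A))" if "x \<in> space M" for A x
    using fin[OF that] by (simp add: emeasure_count_space ennreal_of_nat_eq_real_of_nat)
  have cl: "?\<mu> A \<in> borel_measurable M" if "closed A" for A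
  proof -
    have "(\<lambda>x. card (f x \<inter> A)) \<in> M \<rightarrow>\<^sub>M count_space UNIV"
    proof (subst measurable_count_space_eq2_countable, safe)
      fix k
      have "(\<lambda>x. card (f x \<inter> A)) -` {k} \<inter> space M =
         {x \<in> space M. k \<le> card (f x \<inter> A)} - {x \<in> space M. Suc k \<le> card (f x \<inter> A)}" by auto
      then show "(\<lambda>x. card (f x \<inter> A)) -` {k} \<inter> space M \<in> sets M"
        using sets_card_ge_if_void[OF fin void that] by auto
    qed auto
    then have "(\<lambda>x. ennreal (card (f x \<inter> A))) \<in> borel_measurable M" by measurable
    then show ?thesis using \<mu> by (simp cong: measurable_cong)
  qed
  have bor: "?\<mu> A \<in> borel_measurable M" if "A \<in> sets borel" for A
  proof -
    have "Int_stable {C::real set. closed C}" "{C::real set. closed C} \<subseteq> Pow UNIV"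
      by (auto simp: Int_stable_def)
    moreover have "A \<in> sigma_sets UNIV {C::real set. closed C}"
      using that unfolding borel_eq_closed by (simp add: sets_measure_of_conv)
    ultimately show ?thesis
    proof (induction rule: sigma_sets_induct_disjoint)
      case (basic C)
      then show ?case by (auto intro: cl)
    next
      case (compl C)
      have "?\<mu> (UNIV - C) x = ?\<mu> UNIV x - ?\<mu> C x" if "x \<in> space M" for x
      proof -
        have "f x \<inter> (UNIV - C) = f x \<inter> UNIV - f x \<inter> C" by auto
        moreover have "?\<mu> C x \<noteq> \<top>" using \<mu>[OF that] by simp
        ultimately show ?thesis by (simp only:) (rule emeasure_Diff, auto)
      qed
      then show ?case using compl cl[of UNIV] by (simp cong: measurable_cong)
    next
      case (union C)
      have "?\<mu> (\<Union>(range C)) x = (\<Sum>i. ?\<mu> (C i) x)" for x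
      proof -
        have "f x \<inter> \<Union>(range C) = (\<Union>i. f x \<inter> C i)" by auto
        moreover have "disjoint_family (\<lambda>i. f x \<inter> C i)"
          using union(1) by (auto simp: disjoint_family_on_def)
        ultimately show ?thesis by (simp only:) (rule suminf_emeasure[symmetric], auto)
      qed
      then show ?case using union by simp
    next
      case empty
      then show ?case by simp
    qed
  qed
  have card: "(\<lambda>x. card (f x \<inter> A)) \<in> M \<rightarrow>\<^sub>M count_space UNIV" if "A \<in> sets borel" for A
  proof -
    have "(\<lambda>x. nat \<lfloor>enn2real (?\<mu> A x)\<rfloor>) \<in> M \<rightarrow>\<^sub>M count_space UNIV" using bor[OF that] by measurable
    then show ?thesis using \<mu> by (simp cong: measurable_cong)
  qed
  show ?thesis
    unfolding config_space_def
  proof (rule measurable_measure_of)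
    fix y assume "y \<in> {{S. finite S \<and> S \<subseteq> B \<and> card (S \<inter> A) = k} | A k. A \<in> sets borel}"
    then obtain A k where y: "y = {S. finite S \<and> S \<subseteq> B \<and> card (S \<inter> A) = k}" and A: "A \<in> sets borel" by auto
    have "f -` y \<inter> space M = {x \<in> space M. card (f x \<inter> A) = k}" using f unfolding y by auto
    also have "\<dots> \<in> sets M" using card[OF A] by measurable
    finally show "f -` y \<inter> space M \<in> sets M" .
  qed (use f in auto)
qed

lemma config_space_eq_sigma_void:
  "sets (config_space B) = sigma_sets {S. finite S \<and> S \<subseteq> B}
     {{S. finite S \<and> S \<subseteq> B \<and> S \<inter> A = {}} | A. closed A}" (is "_ = sigma_sets ?\<Omega> ?E")
proof
  have E: "?E \<subseteq> Pow ?\<Omega>" by auto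
  have "(\<lambda>S. S) \<in> sigma ?\<Omega> ?E \<rightarrow>\<^sub>M config_space B"
    using E by (intro measurable_config_spaceI)
      (auto simp: space_measure_of[OF E] sets_measure_of[OF E] conj_assoc intro!: sigma_sets.Basic)
  then have "(\<lambda>S. S) -` X \<inter> ?\<Omega> \<in> sigma_sets ?\<Omega> ?E" if "X \<in> sets (config_space B)" for X
    using that by (auto dest!: measurable_sets simp: space_measure_of[OF E] sets_measure_of[OF E])
  moreover have "X \<subseteq> ?\<Omega>" if "X \<in> sets (config_space B)" for X
    using sets.sets_into_space[OF that] by (simp add: space_config_space)
  ultimately show "sets (config_space B) \<subseteq> sigma_sets ?\<Omega> ?E"
    by (auto simp: Int_absorb2)
  have "?E \<subseteq> sets (config_space B)"
    using sets_void_event[of _ B] by (auto simp: space_config_space conj_assoc)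
  then show "sigma_sets ?\<Omega> ?E \<subseteq> sets (config_space B)"
    using sets.sigma_sets_subset[of ?E "config_space B"] by (simp add: space_config_space)
qed

text \<open>
  Void events are closed under intersection because \<open>S\<close> misses \<open>A\<close> and \<open>A'\<close> iff it misses
  \<open>A \<union> A'\<close>.
\<close>

lemma config_measure_eqI:
  assumes M: "sets M = sets (config_space B)" and N: "sets N = sets (config_space B)"
    and fin: "emeasure M (space M) \<noteq> \<infinity>"
    and eq: "\<And>A. closed A \<Longrightarrow> emeasure M {S \<in> space M. S \<inter> A = {}} = emeasure N {S \<in> space N. S \<inter> A = {}}"
  shows "M = N"
proof -
  let ?\<Omega> = "{S. finite S \<and> S \<subseteq> B}"
  let ?E = "{{S. finite S \<and> S \<subseteq> B \<and> S \<inter> A = {}} | A. closed A}"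
  have sp: "space M = ?\<Omega>" "space N = ?\<Omega>"
    using sets_eq_imp_space_eq[OF M] sets_eq_imp_space_eq[OF N] by (auto simp: space_config_space)
  show ?thesis
  proof (rule measure_eqI_generator_eq[where E = ?E and \<Omega> = ?\<Omega> and A = "\<lambda>_. ?\<Omega>"])
    show "Int_stable ?E"
    proof (rule Int_stableI, safe)
      fix A A' :: "real set" assume "closed A" "closed A'"
      then show "\<exists>C. {S. finite S \<and> S \<subseteq> B \<and> S \<inter> A = {}} \<inter> {S. finite S \<and> S \<subseteq> B \<and> S \<inter> A' = {}}
          = {S. finite S \<and> S \<subseteq> B \<and> S \<inter> C = {}} \<and> closed C"
        by (intro exI[of _ "A \<union> A'"]) auto
    qed
    fix X assume "X \<in> ?E"
    then show "emeasure M X = emeasure N X" using eq by (auto simp: sp)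
  next
    show "range (\<lambda>_::nat. ?\<Omega>) \<subseteq> ?E" by (auto intro!: exI[of _ "{}"])
  qed (use M N fin sp in \<open>auto simp: config_space_eq_sigma_void\<close>)
qed

section \<open>Volumes in a varying dimension\<close>

(* keeps the index sets {1..n} in this form *)
declare One_nat_def [simp del]

lemma emeasure_vimage:
  assumes [measurable]: "F \<in> M \<rightarrow>\<^sub>M N" "B \<in> sets N"
  shows "emeasure M (F -` B \<inter> space M) = (\<integral>\<^sup>+x. indicator B (F x) \<partial>M)"
proof -
  have "emeasure M (F -` B \<inter> space M) = (\<integral>\<^sup>+x. indicator B x \<partial>distr M N F)"
    by (simp add: emeasure_distr)
  then show ?thesis by (subst (asm) nn_integral_distr) auto
qed

abbreviation Leb :: "nat \<Rightarrow> (nat \<Rightarrow> real) measure" where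
  "Leb n \<equiv> Pi\<^sub>M {1..n} (\<lambda>_. lborel)"

interpretation lborel: product_sigma_finite "\<lambda>_::nat. lborel :: real measure"
  by standard

lemma sigma_finite_Leb: "sigma_finite_measure (Leb n)"
  by (intro lborel.sigma_finite) simp

lemma Leb_component [measurable]: "i \<in> {1..n} \<Longrightarrow> (\<lambda>x. x i) \<in> borel_measurable (Leb n)"
  using measurable_component_singleton[of i "{1..n}" "\<lambda>_. lborel :: real measure"] by simp

lemma measurable_into_Leb:
  assumes "\<And>i. i \<in> {1..n} \<Longrightarrow> (\<lambda>z. f z i) \<in> borel_measurable M"
  shows "(\<lambda>z. restrict (f z) {1..n}) \<in> M \<rightarrow>\<^sub>M Leb n"
  by (rule measurable_restrict) (use assms in simp)

lemma measurable_pad [measurable]: "(\<lambda>x. pad a b n x i) \<in> borel_measurable (Leb n)"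
proof (cases "i \<in> {1..n}")
  case True
  then show ?thesis using Leb_component[OF True] by (simp add: pad_def)
next
  case False
  then have "i = 0 \<or> n < i" by auto
  then show ?thesis by (auto simp: pad_def)
qed

lemma measurable_heat:
  assumes f [measurable]: "f \<in> borel_measurable M"
    and X: "\<And>i. (\<lambda>z. X z i) \<in> borel_measurable M"
  shows "(\<lambda>z. heat n (f z) (X z) i) \<in> borel_measurable M"
proof -
  have [measurable]: "(\<lambda>z. (nbr_sum n ^^ k) (X z) i) \<in> borel_measurable M" for k i
  proof (induction k arbitrary: i)
    case (Suc k)
    then show ?case by (cases "i = 0 \<or> n < i") (auto simp: nbr_sum_def)
  qed (simp add: X)
  show ?thesis unfolding heat_def nbr_exp_def by measurable
qed

definition vadd :: "nat \<Rightarrow> (nat \<Rightarrow> real) \<Rightarrow> (nat \<Rightarrow> real) \<Rightarrow> nat \<Rightarrow> real" where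
  "vadd n x y = (\<lambda>i\<in>{1..n}. x i + y i)"

lemma measurable_vadd [measurable (raw)]:
  assumes "f \<in> M \<rightarrow>\<^sub>M Leb n" "g \<in> M \<rightarrow>\<^sub>M Leb n"
  shows "(\<lambda>z. vadd n (f z) (g z)) \<in> M \<rightarrow>\<^sub>M Leb n"
  unfolding vadd_def
  by (intro measurable_into_Leb borel_measurable_add)
     (use measurable_compose[OF assms(1) Leb_component] measurable_compose[OF assms(2) Leb_component] in auto)

lemma distr_Leb_coordinatewise:
  assumes \<phi>: "\<And>i. i \<in> {1..n} \<Longrightarrow> \<phi> i \<in> borel_measurable borel"
    and pres: "\<And>i. i \<in> {1..n} \<Longrightarrow> distr lborel borel (\<phi> i) = lborel"
  shows "distr (Leb n) (Leb n) (\<lambda>x. \<lambda>i\<in>{1..n}. \<phi> i (x i)) = Leb n"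
proof (rule lborel.PiM_eqI)
  have meas: "(\<lambda>x. \<lambda>i\<in>{1..n}. \<phi> i (x i)) \<in> Leb n \<rightarrow>\<^sub>M Leb n"
    by (intro measurable_into_Leb measurable_compose[OF Leb_component \<phi>])
  fix A :: "nat \<Rightarrow> real set" assume A: "\<And>i. i \<in> {1..n} \<Longrightarrow> A i \<in> sets lborel"
  have "emeasure (distr (Leb n) (Leb n) (\<lambda>x. \<lambda>i\<in>{1..n}. \<phi> i (x i))) (Pi\<^sub>E {1..n} A)
    = emeasure (Leb n) (Pi\<^sub>E {1..n} (\<lambda>i. \<phi> i -` A i))"
    using A by (subst emeasure_distr[OF meas]) (auto intro!: arg_cong2[where f = emeasure] sets_PiM_I_finite simp: space_PiM PiE_iff)
  also have "\<dots> = (\<Prod>i\<in>{1..n}. emeasure lborel (\<phi> i -` A i))"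
    by (rule lborel.emeasure_PiM) (use A \<phi> in \<open>auto dest: measurable_sets_borel\<close>)
  also have "\<dots> = (\<Prod>i\<in>{1..n}. emeasure lborel (A i))"
  proof (rule prod.cong[OF refl])
    fix i assume i: "i \<in> {1..n}"
    have "emeasure lborel (A i) = emeasure (distr lborel borel (\<phi> i)) (A i)" by (simp only: pres[OF i])
    also have "\<dots> = emeasure lborel (\<phi> i -` A i)" using A[OF i] \<phi>[OF i] by (subst emeasure_distr) auto
    finally show "emeasure lborel (\<phi> i -` A i) = emeasure lborel (A i)" by simp
  qed
  finally show "emeasure (distr (Leb n) (Leb n) (\<lambda>x. \<lambda>i\<in>{1..n}. \<phi> i (x i))) (Pi\<^sub>E {1..n} A)
    = (\<Prod>i\<in>{1..n}. emeasure lborel (A i))" .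
qed auto

lemma nn_integral_vadd:
  assumes [measurable]: "f \<in> borel_measurable (Leb n)" and "y \<in> space (Leb n)"
  shows "(\<integral>\<^sup>+x. f (vadd n x y) \<partial>Leb n) = (\<integral>\<^sup>+x. f x \<partial>Leb n)"
proof -
  have d: "distr (Leb n) (Leb n) (\<lambda>x. vadd n x y) = Leb n"
    unfolding vadd_def
    by (rule distr_Leb_coordinatewise) (auto simp: add.commute[of _ "y _"] lborel_distr_plus)
  have [measurable]: "(\<lambda>x. vadd n x y) \<in> Leb n \<rightarrow>\<^sub>M Leb n" using assms(2) by measurable
  show ?thesis by (subst (2) d[symmetric]) (rule nn_integral_distr[symmetric]; measurable)
qed

lemma nn_integral_vsub:
  assumes [measurable]: "f \<in> borel_measurable (Leb n)" and "y \<in> space (Leb n)"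
  shows "(\<integral>\<^sup>+x. f (vadd n y (restrict (\<lambda>i. - x i) {1..n})) \<partial>Leb n) = (\<integral>\<^sup>+x. f x \<partial>Leb n)"
proof -
  have d1: "distr (Leb n) (Leb n) (\<lambda>x. \<lambda>i\<in>{1..n}. - x i) = Leb n"
    using lborel_distr_uminus by (intro distr_Leb_coordinatewise) auto
  have [measurable]: "(\<lambda>x. restrict (\<lambda>i. - x i) {1..n}) \<in> Leb n \<rightarrow>\<^sub>M Leb n"
    by (intro measurable_into_Leb borel_measurable_uminus Leb_component)
  have c: "vadd n y z = vadd n z y" for z by (auto simp: vadd_def fun_eq_iff)
  have "(\<integral>\<^sup>+x. f x \<partial>Leb n) = (\<integral>\<^sup>+x. f (vadd n y x) \<partial>Leb n)"
    unfolding c by (rule nn_integral_vadd[symmetric]) (use assms in auto)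
  also have "\<dots> = (\<integral>\<^sup>+x. f (vadd n y (restrict (\<lambda>i. - x i) {1..n})) \<partial>Leb n)"
    using assms(2) by (subst (1) d1[symmetric]) (rule nn_integral_distr; measurable)
  finally show ?thesis by simp
qed

definition unit_cube :: "nat \<Rightarrow> (nat \<Rightarrow> real) set" where
  "unit_cube n = (\<Pi>\<^sub>E i\<in>{1..n}. {0..1})"

lemma unit_cube_sets [measurable]: "unit_cube n \<in> sets (Leb n)"
  unfolding unit_cube_def by (intro sets_PiM_I_finite) auto

lemma emeasure_unit_cube [simp]: "emeasure (Leb n) (unit_cube n) = 1"
  unfolding unit_cube_def by (subst lborel.emeasure_PiM) auto

text \<open>
  Stated with preimages, so that the factors multiply under composition.
\<close>

definition scales_volume :: "nat \<Rightarrow> ((nat \<Rightarrow> real) \<Rightarrow> nat \<Rightarrow> real) \<Rightarrow> ennreal \<Rightarrow> bool" where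
  "scales_volume n F r \<longleftrightarrow> F \<in> Leb n \<rightarrow>\<^sub>M Leb n \<and>
     (\<forall>B\<in>sets (Leb n). emeasure (Leb n) (F -` B \<inter> space (Leb n)) = r * emeasure (Leb n) B)"

text \<open>
  This is the uniqueness of Haar measure: integrate \<open>1\<^sub>B(F x) 1\<^sub>Q(y)\<close> over \<open>x\<close> and \<open>y\<close>, with \<open>Q\<close>
  the unit cube. Shifting \<open>y\<close> by \<open>F x\<close> and then \<open>x\<close> so that \<open>F x\<close> is shifted by \<open>-y\<close> turns the
  integrand into \<open>1\<^sub>B(F x - y) 1\<^sub>Q(F x)\<close>. The resulting factor plays the role of the determinant of
  \<open>F\<close>.
\<close>

lemma scales_volume_if_translation_covariant:
  assumes F [measurable]: "F \<in> Leb n \<rightarrow>\<^sub>M Leb n"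
    and cov: "\<And>y. y \<in> space (Leb n) \<Longrightarrow>
      \<exists>y'\<in>space (Leb n). \<forall>x\<in>space (Leb n). F (vadd n x y') = vadd n (F x) y"
  shows "scales_volume n F (emeasure (Leb n) (F -` unit_cube n \<inter> space (Leb n)))"
  unfolding scales_volume_def
proof (intro conjI ballI F)
  fix B assume B [measurable]: "B \<in> sets (Leb n)"
  interpret sigma_finite_measure "Leb n" by (rule sigma_finite_Leb)
  interpret P: pair_sigma_finite "Leb n" "Leb n" by standard
  let ?L = "Leb n"
  let ?neg = "\<lambda>y. restrict (\<lambda>i. - y i) {1..n} :: nat \<Rightarrow> real"
  let ?I = "indicator B :: _ \<Rightarrow> ennreal" and ?Q = "indicator (unit_cube n) :: _ \<Rightarrow> ennreal"
  have neg [measurable]: "?neg \<in> ?L \<rightarrow>\<^sub>M ?L"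
    by (intro measurable_into_Leb borel_measurable_uminus Leb_component)
  have sp: "F x \<in> space ?L" if "x \<in> space ?L" for x using measurable_space[OF F that] .
  have "emeasure ?L (F -` B \<inter> space ?L) = (\<integral>\<^sup>+x. ?I (F x) * (\<integral>\<^sup>+y. ?Q y \<partial>?L) \<partial>?L)"
    by (simp add: emeasure_vimage[OF F B])
  also have "\<dots> = (\<integral>\<^sup>+x. \<integral>\<^sup>+y. ?I (F x) * ?Q (vadd n y (F x)) \<partial>?L \<partial>?L)"
  proof (rule nn_integral_cong)
    fix x assume x: "x \<in> space ?L"
    note sp[OF x, measurable]
    have "?I (F x) * (\<integral>\<^sup>+y. ?Q y \<partial>?L) = ?I (F x) * (\<integral>\<^sup>+y. ?Q (vadd n y (F x)) \<partial>?L)"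
      using sp[OF x] by (subst nn_integral_vadd) auto
    also have "\<dots> = (\<integral>\<^sup>+y. ?I (F x) * ?Q (vadd n y (F x)) \<partial>?L)"
      by (rule nn_integral_cmult[symmetric]) measurable
    finally show "?I (F x) * (\<integral>\<^sup>+y. ?Q y \<partial>?L) = (\<integral>\<^sup>+y. ?I (F x) * ?Q (vadd n y (F x)) \<partial>?L)" .
  qed
  also have "\<dots> = (\<integral>\<^sup>+y. \<integral>\<^sup>+x. ?I (F x) * ?Q (vadd n y (F x)) \<partial>?L \<partial>?L)"
    by (rule P.Fubini'[symmetric]) measurable
  also have "\<dots> = (\<integral>\<^sup>+y. \<integral>\<^sup>+x. ?I (vadd n (F x) (?neg y)) * ?Q (F x) \<partial>?L \<partial>?L)"
  proof (rule nn_integral_cong)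
    fix y assume y: "y \<in> space ?L"
    note y[measurable]
    obtain y' where y': "y' \<in> space ?L" "\<And>x. x \<in> space ?L \<Longrightarrow> F (vadd n x y') = vadd n (F x) (?neg y)"
      using cov[of "?neg y"] measurable_space[OF neg y] by auto
    have "(\<integral>\<^sup>+x. ?I (F x) * ?Q (vadd n y (F x)) \<partial>?L)
      = (\<integral>\<^sup>+x. ?I (F (vadd n x y')) * ?Q (vadd n y (F (vadd n x y'))) \<partial>?L)"
      by (rule nn_integral_vadd[symmetric]) (measurable, rule y')
    also have "\<dots> = (\<integral>\<^sup>+x. ?I (vadd n (F x) (?neg y)) * ?Q (F x) \<partial>?L)"
    proof (rule nn_integral_cong)
      fix x assume x: "x \<in> space ?L"
      have "vadd n y (vadd n (F x) (?neg y)) = F x"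
        using sp[OF x] by (auto simp: vadd_def space_PiM PiE_def extensional_def fun_eq_iff)
      then show "?I (F (vadd n x y')) * ?Q (vadd n y (F (vadd n x y'))) = ?I (vadd n (F x) (?neg y)) * ?Q (F x)"
        using y'(2)[OF x] by simp
    qed
    finally show "(\<integral>\<^sup>+x. ?I (F x) * ?Q (vadd n y (F x)) \<partial>?L) = \<dots>" .
  qed
  also have "\<dots> = (\<integral>\<^sup>+x. \<integral>\<^sup>+y. ?I (vadd n (F x) (?neg y)) * ?Q (F x) \<partial>?L \<partial>?L)"
    by (rule P.Fubini') measurable
  also have "\<dots> = (\<integral>\<^sup>+x. emeasure ?L B * ?Q (F x) \<partial>?L)"
  proof (rule nn_integral_cong)
    fix x assume x: "x \<in> space ?L"
    note sp[OF x, measurable]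
    have "(\<integral>\<^sup>+y. ?I (vadd n (F x) (?neg y)) * ?Q (F x) \<partial>?L)
      = (\<integral>\<^sup>+y. ?I (vadd n (F x) (?neg y)) \<partial>?L) * ?Q (F x)"
      by (rule nn_integral_multc) measurable
    then show "(\<integral>\<^sup>+y. ?I (vadd n (F x) (?neg y)) * ?Q (F x) \<partial>?L) = emeasure ?L B * ?Q (F x)"
      using sp[OF x] by (simp add: nn_integral_vsub)
  qed
  also have "\<dots> = emeasure ?L B * (\<integral>\<^sup>+x. ?Q (F x) \<partial>?L)"
    by (rule nn_integral_cmult) measurable
  also have "(\<integral>\<^sup>+x. ?Q (F x) \<partial>?L) = emeasure ?L (F -` unit_cube n \<inter> space ?L)"
    by (rule emeasure_vimage[OF F unit_cube_sets, symmetric])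
  finally show "emeasure ?L (F -` B \<inter> space ?L) = emeasure ?L (F -` unit_cube n \<inter> space ?L) * emeasure ?L B"
    by (simp add: mult.commute)
qed

lemma scales_volume_unique: "scales_volume n F r \<Longrightarrow> scales_volume n F r' \<Longrightarrow> r = r'"
  unfolding scales_volume_def using emeasure_unit_cube[of n] unit_cube_sets[of n] by (metis mult.right_neutral)

lemma scales_volume_comp:
  assumes "scales_volume n F r" "scales_volume n G r'"
  shows "scales_volume n (\<lambda>x. F (G x)) (r * r')"
  unfolding scales_volume_def
proof (intro conjI ballI)
  have F: "F \<in> Leb n \<rightarrow>\<^sub>M Leb n" and G: "G \<in> Leb n \<rightarrow>\<^sub>M Leb n"
    using assms by (auto simp: scales_volume_def)
  then show "(\<lambda>x. F (G x)) \<in> Leb n \<rightarrow>\<^sub>M Leb n" by measurable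
  fix B assume B: "B \<in> sets (Leb n)"
  have "(\<lambda>x. F (G x)) -` B \<inter> space (Leb n) = G -` (F -` B \<inter> space (Leb n)) \<inter> space (Leb n)"
    using measurable_space[OF G] by auto
  then show "emeasure (Leb n) ((\<lambda>x. F (G x)) -` B \<inter> space (Leb n)) = r * r' * emeasure (Leb n) B"
    using assms(1) B bspec[OF conjunct2[OF assms(2)[unfolded scales_volume_def]] measurable_sets[OF F B]]
    by (simp only: scales_volume_def ac_simps)
qed

lemma scales_volume_cong:
  assumes "\<And>x. x \<in> space (Leb n) \<Longrightarrow> F x = G x"
  shows "scales_volume n F r \<longleftrightarrow> scales_volume n G r"
proof -
  have "F -` B \<inter> space (Leb n) = G -` B \<inter> space (Leb n)" for B using assms by auto
  then show ?thesis using assms by (simp add: scales_volume_def cong: measurable_cong)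
qed

lemma scales_volume_id: "scales_volume n (\<lambda>x. x) 1"
  using sets.sets_into_space[of _ "Leb n"] by (auto simp: scales_volume_def Int_absorb2)

lemma scales_volume_vadd:
  assumes "w \<in> space (Leb n)"
  shows "scales_volume n (\<lambda>x. vadd n x w) 1"
  unfolding scales_volume_def
proof (intro conjI ballI)
  show m [measurable]: "(\<lambda>x. vadd n x w) \<in> Leb n \<rightarrow>\<^sub>M Leb n" using assms by measurable
  fix B assume [measurable]: "B \<in> sets (Leb n)"
  have "emeasure (Leb n) ((\<lambda>x. vadd n x w) -` B \<inter> space (Leb n)) = (\<integral>\<^sup>+x. indicator B (vadd n x w) \<partial>Leb n)"
    by (rule emeasure_vimage[OF m]) measurable
  also have "\<dots> = 1 * emeasure (Leb n) B" using assms by (simp add: nn_integral_vadd)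
  finally show "emeasure (Leb n) ((\<lambda>x. vadd n x w) -` B \<inter> space (Leb n)) = 1 * emeasure (Leb n) B" .
qed

lemma space_Leb_restrict: "restrict x {1..n} \<in> space (Leb n)"
  by (auto simp: space_PiM)

lemma scales_volume_diagonal:
  assumes c: "\<And>i. c i \<noteq> 0"
  shows "\<exists>r. scales_volume n (\<lambda>x. \<lambda>i\<in>{1..n}. c i * x i) r"
proof (rule exI, rule scales_volume_if_translation_covariant)
  show "(\<lambda>x. \<lambda>i\<in>{1..n}. c i * x i) \<in> Leb n \<rightarrow>\<^sub>M Leb n"
    by (intro measurable_into_Leb borel_measurable_times Leb_component) auto
  fix y assume "y \<in> space (Leb n)"
  then show "\<exists>y'\<in>space (Leb n). \<forall>x\<in>space (Leb n).
      (\<lambda>i\<in>{1..n}. c i * vadd n x y' i) = vadd n (\<lambda>i\<in>{1..n}. c i * x i) y"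
    by (intro bexI[of _ "\<lambda>i\<in>{1..n}. y i / c i"] space_Leb_restrict)
       (auto simp: vadd_def fun_eq_iff c distrib_left)
qed

lemma scales_volume_homothety:
  assumes c: "0 < c"
  shows "scales_volume n (\<lambda>x. \<lambda>i\<in>{1..n}. c * x i) (ennreal ((1 / c) ^ n))"
proof -
  let ?F = "\<lambda>x. \<lambda>i\<in>{1..n}. c * x i"
  obtain r where r: "scales_volume n ?F r" using scales_volume_diagonal[of "\<lambda>_. c" n] c by auto
  have "?F -` unit_cube n \<inter> space (Leb n) = (\<Pi>\<^sub>E i\<in>{1..n}. {0..1 / c})"
    using c by (auto simp: unit_cube_def space_PiM PiE_iff field_simps zero_le_mult_iff)
  moreover have "emeasure (Leb n) (\<Pi>\<^sub>E i\<in>{1..n}. {0..1 / c}) = ennreal (1 / c) ^ n"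
    using c by (subst lborel.emeasure_PiM) auto
  moreover have "emeasure (Leb n) (?F -` unit_cube n \<inter> space (Leb n)) = r * emeasure (Leb n) (unit_cube n)"
    using r unit_cube_sets unfolding scales_volume_def by blast
  ultimately have "r = ennreal (1 / c) ^ n" by (simp only: emeasure_unit_cube mult_1_right)
  also have "\<dots> = ennreal ((1 / c) ^ n)" using c by (intro ennreal_power) simp
  finally have "r = ennreal ((1 / c) ^ n)" .
  then show ?thesis using r by simp
qed

definition heat_map :: "real \<Rightarrow> real \<Rightarrow> nat \<Rightarrow> real \<Rightarrow> (nat \<Rightarrow> real) \<Rightarrow> nat \<Rightarrow> real" where
  "heat_map a b n s x = restrict (heat n s (pad a b n x)) {1..n}"

lemma pad_heat_map: "pad a b n (heat_map a b n s x) = heat n s (pad a b n x)"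
proof
  fix i
  show "pad a b n (heat_map a b n s x) i = heat n s (pad a b n x) i"
  proof (cases "i = 0 \<or> n < i")
    case True
    then show ?thesis by (auto simp: heat_end) (auto simp: pad_def)
  next
    case False
    then show ?thesis by (simp add: pad_def heat_map_def)
  qed
qed

lemma heat_map_space: "heat_map a b n s x \<in> space (Leb n)"
  by (simp add: heat_map_def space_Leb_restrict)

lemma measurable_heat_map [measurable]: "heat_map a b n s \<in> Leb n \<rightarrow>\<^sub>M Leb n"
  unfolding heat_map_def by (intro measurable_into_Leb measurable_heat) auto

lemma heat_map_inverse:
  assumes "x \<in> space (Leb n)"
  shows "heat_map a b n s (heat_map a b n (- s) x) = x"
proof -
  have "heat_map a b n s (heat_map a b n (- s) x) = restrict (pad a b n x) {1..n}"
    by (simp add: heat_map_def[of _ _ _ s] pad_heat_map)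
  also have "\<dots> = x" using assms by (auto simp: space_PiM pad_def PiE_def extensional_def fun_eq_iff)
  finally show ?thesis .
qed

lemma heat_map_vadd: "heat_map a b n s (vadd n x y) = vadd n (heat_map a b n s x) (heat_map 0 0 n s y)"
proof -
  have eq: "pad a b n (vadd n x y) = (\<lambda>j. 1 * pad a b n x j + 1 * pad 0 0 n y j)"
    by (auto simp: pad_def vadd_def fun_eq_iff)
  have "heat n s (pad a b n (vadd n x y)) i = heat n s (pad a b n x) i + heat n s (pad 0 0 n y) i" for i
    unfolding eq heat_lincomb by simp
  then show ?thesis by (auto simp: heat_map_def vadd_def fun_eq_iff)
qed

lemma scales_volume_heat_map: "\<exists>r. scales_volume n (heat_map a b n s) r"
proof (rule exI, rule scales_volume_if_translation_covariant, rule measurable_heat_map)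
  fix y assume "y \<in> space (Leb n)"
  then show "\<exists>y'\<in>space (Leb n). \<forall>x\<in>space (Leb n). heat_map a b n s (vadd n x y') = vadd n (heat_map a b n s x) y"
    by (intro bexI[of _ "heat_map 0 0 n (- s) y"] heat_map_space) (simp add: heat_map_vadd heat_map_inverse)
qed

text \<open>
  Neighbouring indices have opposite parity, so flipping the signs of the odd coordinates turns
  the sum of the neighbours into its negative, that is, reverses time in \<^const>\<open>nbr_exp\<close>.
\<close>

lemma nbr_exp_alternate:
  assumes "\<And>i. i = 0 \<or> n < i \<Longrightarrow> x i = 0"
  shows "nbr_exp n s (\<lambda>i. (- 1) ^ i * x i) i = (- 1) ^ i * nbr_exp n (- s) x i"
proof -
  have at_end: "nbr_sum n y i = 2 * y i" if "i = 0 \<or> n < i" for y i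
    using that by (simp add: nbr_sum_def)
  have inner: "nbr_sum n y (Suc j) = y j + y (Suc (Suc j))" if "Suc j \<le> n" for y j
    using that by (simp add: nbr_sum_def One_nat_def)
  have z: "(nbr_sum n ^^ k) x i = 0" if "i = 0 \<or> n < i" for k i
    by (induction k) (simp_all add: assms that at_end[OF that])
  have "(nbr_sum n ^^ k) (\<lambda>i. (- 1) ^ i * x i) i = (- 1) ^ i * ((- 1) ^ k * (nbr_sum n ^^ k) x i)" for k i
  proof (induction k arbitrary: i)
    case (Suc k)
    then have IH: "(nbr_sum n ^^ k) (\<lambda>i. (- 1) ^ i * x i)
      = (\<lambda>i. (- 1) ^ i * ((- 1) ^ k * (nbr_sum n ^^ k) x i))" by blast
    show ?case
    proof (cases "i = 0 \<or> n < i")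
      case True
      then show ?thesis using z[OF True, of k] by (simp add: IH at_end[OF True])
    next
      case False
      then obtain j where j: "i = Suc j" by (cases i) auto
      then have "Suc j \<le> n" using False by simp
      then show ?thesis
        unfolding j funpow.simps o_apply IH by (subst (1 2) inner) (simp_all add: algebra_simps)
    qed
  qed simp
  then have "nbr_exp n s (\<lambda>i. (- 1) ^ i * x i) i
     = (\<Sum>k. (- 1) ^ i * ((nbr_sum n ^^ k) x i / fact k * (- s) ^ k))"
    unfolding nbr_exp_def by (intro suminf_cong) (simp add: power_minus[of s] field_simps)
  also have "\<dots> = (- 1) ^ i * nbr_exp n (- s) x i"
    unfolding nbr_exp_def by (rule suminf_mult[OF nbr_exp_summable])
  finally show ?thesis .
qed

lemma heat_map_alternate:
  "heat_map 0 0 n s (\<lambda>i\<in>{1..n}. (- 1) ^ i * x i) =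
     (\<lambda>i\<in>{1..n}. exp (- (4 * s)) * (\<lambda>i\<in>{1..n}. (- 1) ^ i * heat_map 0 0 n (- s) x i) i)"
proof
  fix i
  let ?y = "pad 0 0 n x"
  define z where "z = (\<lambda>i\<in>{1..n}. (- 1) ^ i * x i)"
  have "pad 0 0 n z = (\<lambda>i. (- 1) ^ i * ?y i)"
    by (auto simp: pad_def fun_eq_iff z_def)
  then have "heat n s (pad 0 0 n z) i = heat n s (\<lambda>i. (- 1) ^ i * ?y i) i"
    by (rule arg_cong)
  also have "\<dots> = exp (- (2 * s)) * ((- 1) ^ i * nbr_exp n (- s) ?y i)"
    unfolding heat_def by (subst nbr_exp_alternate) (auto simp: pad_def)
  also have "exp (- (2 * s)) = exp (- (4 * s)) * exp (- (2 * - s))"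
    by (simp flip: exp_add)
  also have "exp (- (4 * s)) * exp (- (2 * - s)) * ((- 1) ^ i * nbr_exp n (- s) ?y i)
      = exp (- (4 * s)) * ((- 1) ^ i * heat n (- s) ?y i)"
    unfolding heat_def by (simp only: mult.assoc mult.left_commute)
  finally have "heat n s (pad 0 0 n z) i = exp (- (4 * s)) * ((- 1) ^ i * heat n (- s) ?y i)" .
  then have "heat_map 0 0 n s z i =
     (\<lambda>i\<in>{1..n}. exp (- (4 * s)) * (\<lambda>i\<in>{1..n}. (- 1) ^ i * heat_map 0 0 n (- s) x i) i) i"
    by (cases "i \<in> {1..n}") (auto simp: heat_map_def)
  then show "heat_map 0 0 n s (\<lambda>i\<in>{1..n}. (- 1) ^ i * x i) i =
     (\<lambda>i\<in>{1..n}. exp (- (4 * s)) * (\<lambda>i\<in>{1..n}. (- 1) ^ i * heat_map 0 0 n (- s) x i) i) i"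
    unfolding z_def .
qed

lemma ennreal_square_eq_1:
  assumes "r * r = (1::ennreal)"
  shows "r = 1"
proof (cases r)
  case (real q)
  then have "ennreal (q * q) = ennreal 1" using assms by (simp add: ennreal_mult)
  then have "q * q = 1" using real by (subst (asm) ennreal_inj) auto
  then have "q = 1" using real by (auto simp: square_eq_1_iff)
  then show ?thesis using real by simp
qed (use assms in simp)

text \<open>
  Up to the factor \<open>e\<^sup>-\<^sup>2\<^sup>s\<close> in each coordinate the heat flow is \<^const>\<open>nbr_exp\<close>, which is
  conjugate to its own inverse and therefore preserves volume.
\<close>

lemma volume_heat_map: "scales_volume n (heat_map a b n s) (ennreal (exp (2 * s * real n)))"
proof -
  let ?F = "\<lambda>s. heat_map 0 0 n s"
  let ?J = "\<lambda>x. \<lambda>i\<in>{1..n}. (- 1) ^ i * x i :: real"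
  obtain r where r: "\<And>s. scales_volume n (?F s) (r s)"
    using scales_volume_heat_map[of n 0 0] by metis
  obtain j where j: "scales_volume n ?J j"
    using scales_volume_diagonal[of "\<lambda>i. (- 1) ^ i" n] by auto
  have sq: "(- 1) ^ i * ((- 1) ^ i * y) = y" for i and y :: real by (cases "even i") auto
  have JJ: "?J (?J x) = x" if "x \<in> space (Leb n)" for x
  proof
    fix i show "?J (?J x) i = x i"
      using that sq[of i "x i"] by (cases "i \<in> {1..n}") (auto simp: space_PiM PiE_def extensional_def)
  qed
  have "scales_volume n (\<lambda>x. x) (j * j)"
    using scales_volume_comp[OF j j] scales_volume_cong[of n "\<lambda>x. ?J (?J x)" "\<lambda>x. x"] JJ by blast
  then have "j * j = 1" using scales_volume_id scales_volume_unique by blast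
  then have j1: "j = 1" by (rule ennreal_square_eq_1)
  have "scales_volume n (\<lambda>x. ?F s (?F (- s) x)) (r s * r (- s))" by (rule scales_volume_comp[OF r r])
  also have "?this \<longleftrightarrow> scales_volume n (\<lambda>x. x) (r s * r (- s))"
    by (rule scales_volume_cong) (simp add: heat_map_inverse)
  finally have inv: "r s * r (- s) = 1" using scales_volume_id scales_volume_unique by blast
  have "scales_volume n (\<lambda>x. ?F s (?J x)) (r s * j)" by (rule scales_volume_comp[OF r j])
  moreover have "scales_volume n (\<lambda>x. ?F s (?J x)) (ennreal ((1 / exp (- (4 * s))) ^ n) * (j * r (- s)))"
    unfolding heat_map_alternate
    by (rule scales_volume_comp[OF scales_volume_homothety scales_volume_comp[OF j r]]) simp
  ultimately have "r s = ennreal ((1 / exp (- (4 * s))) ^ n) * r (- s)"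
    using scales_volume_unique unfolding j1 by fastforce
  moreover define E where "E = exp (2 * s * real n)"
  moreover have "(1 / exp (- (4 * s))) ^ n = E * E"
  proof -
    have "1 / exp (- (4 * s)) = exp (4 * s)" by (simp add: exp_minus field_simps)
    moreover have "exp (4 * s) ^ n = exp (real n * (4 * s))" by (rule exp_of_nat_mult[symmetric])
    moreover have "real n * (4 * s) = 2 * s * real n + 2 * s * real n" by simp
    ultimately show ?thesis unfolding E_def by (metis exp_add)
  qed
  ultimately have rs: "r s = ennreal (E * E) * r (- s)" by simp
  have E: "0 < E" by (simp add: E_def)
  have "r s = ennreal E"
  proof (cases "r (- s)")
    case (real q)
    have Eq: "0 \<le> E * E" "0 \<le> E * q" "0 \<le> E * (E * q)" using E real(1) by simp_all
    have "r s = ennreal (E * E) * ennreal q" using rs real(2) by (rule trans[OF _ arg_cong])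
    also have "\<dots> = ennreal (E * E * q)" by (rule ennreal_mult[symmetric, OF Eq(1) real(1)])
    finally have rsq: "r s = ennreal (E * (E * q))" by (simp only: mult.assoc)
    have "ennreal (E * q) * ennreal (E * q) = ennreal ((E * q) * (E * q))"
      by (rule ennreal_mult[symmetric, OF Eq(2) Eq(2)])
    also have "(E * q) * (E * q) = E * (E * q) * q" by (simp only: ac_simps)
    also have "ennreal \<dots> = ennreal (E * (E * q)) * ennreal q" by (rule ennreal_mult[OF Eq(3) real(1)])
    also have "\<dots> = r s * r (- s)" by (simp only: rsq real(2))
    finally have "ennreal (E * q) = 1"
      unfolding inv by (rule ennreal_square_eq_1)
    then have "E * q = 1" using Eq(2) by (metis ennreal_1 ennreal_inj zero_le_one)
    then show ?thesis using rsq by simp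
  next
    case top
    then have "r s = \<top>" using rs E by (simp add: ennreal_mult_top)
    then show ?thesis using inv top by simp
  qed
  then have F0: "scales_volume n (?F s) (ennreal (exp (2 * s * real n)))" using r[of s] by (simp add: E_def)
  define w where "w = heat_map a b n s (\<lambda>i\<in>{1..n}. 0)"
  have "heat_map a b n s x = vadd n (?F s x) w" if "x \<in> space (Leb n)" for x
  proof -
    have "x = vadd n (\<lambda>i\<in>{1..n}. 0) x"
      using that by (auto simp: vadd_def space_PiM PiE_def extensional_def fun_eq_iff)
    then have "heat_map a b n s x = vadd n w (?F s x)" unfolding w_def using heat_map_vadd by metis
    then show ?thesis by (auto simp: vadd_def)
  qed
  then have "scales_volume n (heat_map a b n s) (1 * ennreal (exp (2 * s * real n)))"
    using scales_volume_comp[OF scales_volume_vadd[of w n] F0] heat_map_space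
    by (subst scales_volume_cong) (auto simp: w_def)
  then show ?thesis by simp
qed

section \<open>The ordered simplex\<close>

definition ins :: "nat \<Rightarrow> nat \<Rightarrow> (nat \<Rightarrow> real) \<Rightarrow> real \<Rightarrow> nat \<Rightarrow> real" where
  "ins m k z y = (\<lambda>i\<in>{1..Suc m}. if i < k then z i else if i = k then y else z (i - 1))"

lemma measurable_ins [measurable]:
  assumes k: "k \<in> {1..Suc m}"
  shows "(\<lambda>(z, y). ins m k z y) \<in> Leb m \<Otimes>\<^sub>M lborel \<rightarrow>\<^sub>M Leb (Suc m)"
  unfolding ins_def case_prod_beta
proof (rule measurable_into_Leb)
  fix i assume i: "i \<in> {1..Suc m}"
  show "(\<lambda>p. if i < k then fst p i else if i = k then snd p else fst p (i - 1))
      \<in> borel_measurable (Leb m \<Otimes>\<^sub>M lborel)"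
  proof (cases i k rule: linorder_cases)
    case less
    then have "i \<in> {1..m}" using i k by auto
    then show ?thesis using less measurable_compose[OF measurable_fst Leb_component] by simp
  next
    case greater
    then have "i - 1 \<in> {1..m}" using i k by auto
    then show ?thesis using greater measurable_compose[OF measurable_fst Leb_component] by simp
  qed simp
qed

text \<open>
  Inserting a coordinate permutes the factors of the product measure.
\<close>

lemma distr_ins:
  assumes k: "k \<in> {1..Suc m}"
  shows "distr (Leb m \<Otimes>\<^sub>M lborel) (Leb (Suc m)) (\<lambda>(z, y). ins m k z y) = Leb (Suc m)"
proof (rule lborel.PiM_eqI)
  interpret sigma_finite_measure "Leb m" by (rule sigma_finite_Leb)
  interpret pair_sigma_finite "Leb m" lborel by standard
  fix A :: "nat \<Rightarrow> real set" assume A: "\<And>i. i \<in> {1..Suc m} \<Longrightarrow> A i \<in> sets lborel"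
  let ?g = "\<lambda>i. if i < k then i else Suc i"
  have g: "?g i \<in> {1..Suc m} - {k}" if "i \<in> {1..m}" for i using that by auto
  have box: "Pi\<^sub>E {1..Suc m} A \<in> sets (Leb (Suc m))" using A by (intro sets_PiM_I_finite) auto
  have "(\<lambda>(z, y). ins m k z y) -` Pi\<^sub>E {1..Suc m} A \<inter> space (Leb m \<Otimes>\<^sub>M lborel)
    = Pi\<^sub>E {1..m} (\<lambda>i. A (?g i)) \<times> A k" (is "?lhs = ?rhs")
  proof (intro set_eqI, clarify)
    fix z y
    have "ins m k z y \<in> Pi\<^sub>E {1..Suc m} A \<longleftrightarrow> (\<forall>i\<in>{1..m}. z i \<in> A (?g i)) \<and> y \<in> A k" (is "?l \<longleftrightarrow> ?r")
    proof
      assume l: ?l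
      have "z i \<in> A (?g i)" if "i \<in> {1..m}" for i
        using l g[OF that] that by (auto simp: ins_def PiE_iff dest!: bspec[of _ _ "?g i"] split: if_splits)
      moreover have "y \<in> A k" using l k by (auto simp: ins_def PiE_iff dest!: bspec[of _ _ k])
      ultimately show ?r by blast
    next
      assume r: ?r
      have "ins m k z y i \<in> A i" if i: "i \<in> {1..Suc m}" for i
      proof (cases i k rule: linorder_cases)
        case less
        then show ?thesis using r i k by (auto simp: ins_def dest!: bspec[of _ _ i])
      next
        case greater
        then have "i - 1 \<in> {1..m}" "?g (i - 1) = i" using i k by auto
        then have "z (i - 1) \<in> A i" using r by metis
        then show ?thesis using greater i by (simp add: ins_def)
      qed (use r i in \<open>simp add: ins_def\<close>)
      then show ?l by (auto simp: PiE_iff ins_def)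
    qed
    then show "(z, y) \<in> ?lhs \<longleftrightarrow> (z, y) \<in> ?rhs"
      by (auto simp: space_pair_measure space_PiM PiE_iff)
  qed
  then have "emeasure (distr (Leb m \<Otimes>\<^sub>M lborel) (Leb (Suc m)) (\<lambda>(z, y). ins m k z y)) (Pi\<^sub>E {1..Suc m} A)
    = emeasure (Leb m \<Otimes>\<^sub>M lborel) (Pi\<^sub>E {1..m} (\<lambda>i. A (?g i)) \<times> A k)"
    using box by (subst emeasure_distr[OF measurable_ins[OF k]]) auto
  also have "\<dots> = (\<Prod>i\<in>{1..m}. emeasure lborel (A (?g i))) * emeasure lborel (A k)"
  proof -
    have Ag: "A (?g i) \<in> sets lborel" if "i \<in> {1..m}" for i using A g[OF that] by blast
    then have "Pi\<^sub>E {1..m} (\<lambda>i. A (?g i)) \<in> sets (Leb m)"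
      by (intro sets_PiM_I_finite) auto
    moreover have "emeasure (Leb m) (Pi\<^sub>E {1..m} (\<lambda>i. A (?g i))) = (\<Prod>i\<in>{1..m}. emeasure lborel (A (?g i)))"
      by (rule lborel.emeasure_PiM) (use Ag in auto)
    ultimately show ?thesis using A[OF k] by (subst lborel.emeasure_pair_measure_Times) auto
  qed
  also have "(\<Prod>i\<in>{1..m}. emeasure lborel (A (?g i))) = (\<Prod>i\<in>{1..Suc m} - {k}. emeasure lborel (A i))"
    by (rule prod.reindex_bij_witness[of _ "\<lambda>i. if i < k then i else i - 1" ?g]) (use k in auto)
  also have "\<dots> * emeasure lborel (A k) = (\<Prod>i\<in>{1..Suc m}. emeasure lborel (A i))"
    using k by (subst (2) prod.remove[of _ k]) (auto simp: mult.commute)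
  finally show "emeasure (distr (Leb m \<Otimes>\<^sub>M lborel) (Leb (Suc m)) (\<lambda>(z, y). ins m k z y)) (Pi\<^sub>E {1..Suc m} A)
    = (\<Prod>i\<in>{1..Suc m}. emeasure lborel (A i))" .
qed auto

lemma nn_integral_ins:
  assumes k: "k \<in> {1..Suc m}" and [measurable]: "f \<in> borel_measurable (Leb (Suc m))"
  shows "(\<integral>\<^sup>+x. f x \<partial>Leb (Suc m)) = (\<integral>\<^sup>+z. \<integral>\<^sup>+y. f (ins m k z y) \<partial>lborel \<partial>Leb m)"
proof -
  note measurable_ins[OF k, measurable]
  have "(\<integral>\<^sup>+x. f x \<partial>Leb (Suc m)) = (\<integral>\<^sup>+p. f (case p of (z, y) \<Rightarrow> ins m k z y) \<partial>(Leb m \<Otimes>\<^sub>M lborel))"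
    by (subst distr_ins[OF k, symmetric]) (rule nn_integral_distr; measurable)
  also have "\<dots> = (\<integral>\<^sup>+z. \<integral>\<^sup>+y. f (ins m k z y) \<partial>lborel \<partial>Leb m)"
  proof (subst lborel.nn_integral_fst[symmetric])
    show "(\<lambda>p. f (case p of (z, y) \<Rightarrow> ins m k z y)) \<in> borel_measurable (Leb m \<Otimes>\<^sub>M lborel)"
      by measurable
  qed simp
  finally show ?thesis .
qed

lemma pad_ins:
  assumes "k \<in> {1..Suc m}"
  shows "pad a b (Suc m) (ins m k z y) i =
    (if i < k then pad a b m z i else if i = k then y else pad a b m z (i - 1))"
  using assms by (auto simp: pad_def ins_def)

lemma increasing_upto_ins:
  assumes k: "k \<in> {1..Suc m}"
  shows "increasing_upto (Suc m) (pad a b (Suc m) (ins m k z y)) \<longleftrightarrow>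
    increasing_upto m (pad a b m z) \<and> pad a b m z (k - 1) < y \<and> y < pad a b m z k"
    (is "?l \<longleftrightarrow> ?r")
proof
  let ?P = "pad a b m z" and ?X = "pad a b (Suc m) (ins m k z y)"
  assume l: ?l
  have "?X (k - 1) < ?X k" "?X k < ?X (Suc k)"
    using k by (auto intro!: increasing_less[OF l])
  then have y: "?P (k - 1) < y" "y < ?P k" using k by (auto simp: pad_ins[OF k])
  moreover have "?P i < ?P (Suc i)" if "i \<le> m" for i
  proof (cases "Suc i" k rule: linorder_cases)
    case less
    then show ?thesis using increasing_less[OF l, of i "Suc i"] that by (simp add: pad_ins[OF k])
  next
    case equal
    then show ?thesis using y by auto
  next
    case greater
    then show ?thesis using increasing_less[OF l, of "Suc i" "Suc (Suc i)"] that by (simp add: pad_ins[OF k])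
  qed
  ultimately show ?r by (auto simp: increasing_upto_def)
next
  assume r: ?r
  then have P: "pad a b m z i < pad a b m z (Suc i)" if "i \<le> m" for i
    using that by (auto simp: increasing_upto_def)
  show ?l unfolding increasing_upto_def
  proof safe
    fix i assume i: "i \<le> Suc m"
    consider "Suc i < k" | "Suc i = k" | "i = k" | "k < i" by linarith
    then show "pad a b (Suc m) (ins m k z y) i < pad a b (Suc m) (ins m k z y) (Suc i)"
      using r i k P[of i] P[of "i - 1"] by cases (auto simp: pad_ins[OF k])
  qed
qed

definition ordered_simplex :: "real \<Rightarrow> real \<Rightarrow> nat \<Rightarrow> (nat \<Rightarrow> real) set" where
  "ordered_simplex a b n = {x \<in> space (Leb n). increasing_upto n (pad a b n x)}"

lemma sets_simplex [measurable]: "ordered_simplex a b n \<in> sets (Leb n)"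
  unfolding ordered_simplex_def increasing_upto_def by measurable

lemma simplexD:
  assumes "x \<in> ordered_simplex a b n"
  shows "x \<in> space (Leb n)" "increasing_upto n (pad a b n x)" "x ` {1..n} \<subseteq> {a<..<b}"
  using assms pad_image_inter(2)[of n a b x] by (auto simp: ordered_simplex_def)

lemma inj_on_simplex: "x \<in> ordered_simplex a b n \<Longrightarrow> inj_on x {1..n}"
proof (rule linorder_inj_onI')
  fix i j assume x: "x \<in> ordered_simplex a b n" and ij: "i \<in> {1..n}" "j \<in> {1..n}" "i < j"
  have "pad a b n x i < pad a b n x j"
    by (rule increasing_less[OF simplexD(2)[OF x]]) (use ij in auto)
  then show "x i \<noteq> x j" using ij by (auto simp: pad_def)
qed

lemma ins_in_simplex_iff:
  assumes "k \<in> {1..Suc m}" "z \<in> space (Leb m)"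
  shows "ins m k z y \<in> ordered_simplex a b (Suc m) \<longleftrightarrow>
    z \<in> ordered_simplex a b m \<and> pad a b m z (k - 1) < y \<and> y < pad a b m z k"
  using increasing_upto_ins[OF assms(1), of a b z y] assms(2) space_Leb_restrict[of _ "Suc m"]
  by (auto simp: ordered_simplex_def ins_def)

lemma ins_all_in_iff:
  assumes "k \<in> {1..Suc m}"
  shows "(\<forall>i\<in>{1..Suc m}. ins m k z y i \<in> C) \<longleftrightarrow> (\<forall>i\<in>{1..m}. z i \<in> C) \<and> y \<in> C"
proof -
  have "ins m k z y ` {1..Suc m} = insert y (z ` {1..m})"
  proof safe
    fix i assume "i \<in> {1..Suc m}" "ins m k z y i \<notin> z ` {1..m}"
    moreover have "i - 1 \<in> {1..m}" if "k < i" using that assms \<open>i \<in> _\<close> by auto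
    moreover have "i \<in> {1..m}" if "i < k" using that assms \<open>i \<in> _\<close> by auto
    ultimately show "ins m k z y i = y"
      by (cases i k rule: linorder_cases) (auto simp: ins_def)
  next
    show "y \<in> ins m k z y ` {1..Suc m}" using assms by (intro image_eqI[of _ _ k]) (auto simp: ins_def)
  next
    fix i assume "i \<in> {1..m}"
    then show "z i \<in> ins m k z y ` {1..Suc m}"
      using assms by (intro image_eqI[of _ _ "if i < k then i else Suc i"]) (auto simp: ins_def)
  qed
  then show ?thesis by (metis (no_types, lifting) image_subset_iff insert_subset)
qed

lemma unique_gap:
  assumes P: "increasing_upto m P" and y: "P 0 < y" "y < P (Suc m)" "y \<notin> P ` {..Suc m}"
  shows "\<exists>!k. k \<in> {1..Suc m} \<and> P (k - 1) < y \<and> y < P k"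
proof -
  define k where "k = (LEAST j. y < P j)"
  have k: "y < P k" "k \<le> Suc m" using y(2) unfolding k_def by (auto intro: LeastI Least_le)
  then have "k \<noteq> 0" using y(1) by (intro notI) auto
  have "\<not> y < P (k - 1)" using \<open>k \<noteq> 0\<close> unfolding k_def by (intro not_less_Least) auto
  moreover have "y \<noteq> P (k - 1)" using y(3) k(2) by auto
  ultimately have "P (k - 1) < y" by simp
  moreover have "j = k" if "j \<in> {1..Suc m}" "P (j - 1) < y" "y < P j" for j
  proof (rule ccontr)
    assume "j \<noteq> k"
    then consider "j \<le> k - 1" | "k \<le> j - 1" by linarith
    then show False
    proof cases
      case 1
      then have "P j \<le> P (k - 1)" using increasing_less[OF P, of j "k - 1"] k by (cases "j = k - 1") (simp_all add: less_imp_le)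
      then show False using that \<open>P (k - 1) < y\<close> by simp
    next
      case 2
      then have "P k \<le> P (j - 1)" using increasing_less[OF P, of k "j - 1"] that by (cases "k = j - 1") (simp_all add: less_imp_le)
      then show False using that k by simp
    qed
  qed
  ultimately show ?thesis using k \<open>k \<noteq> 0\<close> by (intro ex1I[of _ k]) auto
qed

lemma sum_over_gaps:
  assumes P: "increasing_upto m P" and y: "y \<notin> P ` {..Suc m}"
  shows "(\<Sum>k\<in>{1..Suc m}. if P (k - 1) < y \<and> y < P k then c else 0)
    = (if P 0 < y \<and> y < P (Suc m) then c else (0 :: 'a :: comm_monoid_add))"
proof (cases "P 0 < y \<and> y < P (Suc m)")
  case True
  then have "\<exists>!k. k \<in> {1..Suc m} \<and> P (k - 1) < y \<and> y < P k"
    using unique_gap[OF P _ _ y] by blast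
  then obtain k where k: "k \<in> {1..Suc m}" "P (k - 1) < y \<and> y < P k"
      "\<And>j. j \<in> {1..Suc m} \<and> P (j - 1) < y \<and> y < P j \<Longrightarrow> j = k"
    by (rule ex1E) blast
  have "(\<Sum>j\<in>{1..Suc m}. if P (j - 1) < y \<and> y < P j then c else 0) = (\<Sum>j\<in>{1..Suc m}. if j = k then c else 0)"
  proof (rule sum.cong[OF refl])
    fix j assume "j \<in> {1..Suc m}"
    then have "P (j - 1) < y \<and> y < P j \<longleftrightarrow> j = k" using k by blast
    then show "(if P (j - 1) < y \<and> y < P j then c else 0) = (if j = k then c else 0)" by simp
  qed
  also have "\<dots> = c" using k(1) by (subst sum.delta) auto
  finally show ?thesis using True by simp
next
  case False
  have "\<not> (P (j - 1) < y \<and> y < P j)" if "j \<in> {1..Suc m}" for j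
  proof -
    have "P 0 \<le> P (j - 1)" using increasing_less[OF P, of 0 "j - 1"] that
      by (cases "j - 1 = 0") (simp_all add: less_imp_le)
    moreover have "P j \<le> P (Suc m)" using increasing_less[OF P, of j "Suc m"] that by (cases "j = Suc m") auto
    ultimately show ?thesis using False by auto
  qed
  then show ?thesis using False by (simp only: if_False sum.neutral_const cong: sum.cong)
qed

text \<open>
  A further point of \<open>C\<close> can be inserted into an ordered \<open>m\<close>-tuple in exactly one place, so
  \<open>m + 1\<close> times the volume of the ordered \<open>m + 1\<close>-tuples is the volume of the ordered \<open>m\<close>-tuples
  times the length of \<open>C\<close>.
\<close>

lemma emeasure_simplex_all_in:
  assumes C [measurable]: "C \<in> sets borel" and "a < b"
  shows "emeasure (Leb n) {x \<in> ordered_simplex a b n. \<forall>i\<in>{1..n}. x i \<in> C}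
    = ennreal (measure lborel (C \<inter> {a<..<b}) ^ n / fact n)"
proof (induction n)
  case 0
  have "{x \<in> ordered_simplex a b 0. \<forall>i\<in>{1..0}. x i \<in> C} = {\<lambda>x. undefined}"
    using \<open>a < b\<close> by (auto simp: ordered_simplex_def increasing_upto_def pad_def space_PiM)
  then show ?case by (simp add: PiM_empty One_nat_def)
next
  case (Suc m)
  define E where "E n = {x \<in> ordered_simplex a b n. \<forall>i\<in>{1..n}. x i \<in> C}" for n
  define q where "q = measure lborel (C \<inter> {a<..<b})"
  have E [measurable]: "E n \<in> sets (Leb n)" for n
  proof -
    have "E n = ordered_simplex a b n \<inter> {x \<in> space (Leb n). \<forall>i\<in>{1..n}. x i \<in> C}"
      using simplexD(1) by (auto simp: E_def)
    then show ?thesis by simp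
  qed
  have fin: "emeasure lborel (C \<inter> {a<..<b}) = ennreal q"
    unfolding q_def
  proof (rule emeasure_eq_ennreal_measure)
    have "emeasure lborel (C \<inter> {a<..<b}) \<le> emeasure lborel {a<..<b}" by (intro emeasure_mono) auto
    also have "\<dots> < \<top>" using \<open>a < b\<close> by simp
    finally show "emeasure lborel (C \<inter> {a<..<b}) \<noteq> \<top>" by simp
  qed
  have memb: "ins m k z y \<in> E (Suc m) \<longleftrightarrow> z \<in> E m \<and> y \<in> C \<and> pad a b m z (k - 1) < y \<and> y < pad a b m z k"
    if "k \<in> {1..Suc m}" "z \<in> space (Leb m)" for k z y
    using ins_in_simplex_iff[OF that, of y a b] ins_all_in_iff[OF that(1), of z y C] by (auto simp: E_def)
  define g :: "nat \<Rightarrow> (nat \<Rightarrow> real) \<Rightarrow> real \<Rightarrow> ennreal" where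
    "g k z y = (if z \<in> E m \<and> y \<in> C \<and> pad a b m z (k - 1) < y \<and> y < pad a b m z k then 1 else 0)" for k z y
  have g3: "(\<lambda>(z, y). g k z y) \<in> borel_measurable (Leb m \<Otimes>\<^sub>M lborel)" for k
    unfolding g_def case_prod_beta by measurable
  have g2: "(\<lambda>z. \<integral>\<^sup>+y. g k z y \<partial>lborel) \<in> borel_measurable (Leb m)" for k
    by (rule lborel.borel_measurable_nn_integral[OF g3])
  have g1: "g k z \<in> borel_measurable lborel" for k z
    unfolding g_def by measurable
  have ind: "indicator (E (Suc m)) (ins m k z y) = g k z y"
    if "k \<in> {1..Suc m}" "z \<in> space (Leb m)" for k z y
    using memb[OF that, of y] by (simp add: indicator_def g_def)
  have "of_nat (Suc m) * emeasure (Leb (Suc m)) (E (Suc m))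
    = (\<Sum>k\<in>{1..Suc m}. \<integral>\<^sup>+x. indicator (E (Suc m)) x \<partial>Leb (Suc m))" by simp
  also have "\<dots> = (\<Sum>k\<in>{1..Suc m}. \<integral>\<^sup>+z. \<integral>\<^sup>+y. g k z y \<partial>lborel \<partial>Leb m)"
  proof (rule sum.cong[OF refl])
    fix k assume k: "k \<in> {1..Suc m}"
    have "(\<integral>\<^sup>+x. indicator (E (Suc m)) x \<partial>Leb (Suc m))
        = (\<integral>\<^sup>+z. \<integral>\<^sup>+y. indicator (E (Suc m)) (ins m k z y) \<partial>lborel \<partial>Leb m)"
      by (rule nn_integral_ins[OF k]) measurable
    then show "(\<integral>\<^sup>+x. indicator (E (Suc m)) x \<partial>Leb (Suc m))
        = (\<integral>\<^sup>+z. \<integral>\<^sup>+y. g k z y \<partial>lborel \<partial>Leb m)"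
      using ind[OF k] by (simp cong: nn_integral_cong)
  qed
  also have "\<dots> = (\<integral>\<^sup>+z. \<integral>\<^sup>+y. (\<Sum>k\<in>{1..Suc m}. g k z y) \<partial>lborel \<partial>Leb m)"
  proof -
    have "(\<integral>\<^sup>+z. \<integral>\<^sup>+y. (\<Sum>k\<in>{1..Suc m}. g k z y) \<partial>lborel \<partial>Leb m)
        = (\<integral>\<^sup>+z. (\<Sum>k\<in>{1..Suc m}. \<integral>\<^sup>+y. g k z y \<partial>lborel) \<partial>Leb m)"
      by (rule nn_integral_cong, rule nn_integral_sum, rule g1)
    also have "\<dots> = (\<Sum>k\<in>{1..Suc m}. \<integral>\<^sup>+z. \<integral>\<^sup>+y. g k z y \<partial>lborel \<partial>Leb m)"
      by (rule nn_integral_sum, rule g2)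
    finally show ?thesis by (rule sym)
  qed
  also have "\<dots> = (\<integral>\<^sup>+z. \<integral>\<^sup>+y. indicator (E m) z * indicator (C \<inter> {a<..<b}) y \<partial>lborel \<partial>Leb m)"
  proof (rule nn_integral_cong, rule nn_integral_cong_AE)
    fix z
    let ?P = "pad a b m z"
    have "?P ` {..Suc m} \<in> null_sets lborel" by (intro finite_imp_null_set_lborel) auto
    then have "AE y in lborel. y \<notin> ?P ` {..Suc m}" by (rule AE_not_in)
    then show "AE y in lborel. (\<Sum>k\<in>{1..Suc m}. g k z y) = (indicator (E m) z * indicator (C \<inter> {a<..<b}) y :: ennreal)"
    proof eventually_elim
      case (elim y)
      show ?case
      proof (cases "z \<in> E m")
        case True
        then have P: "increasing_upto m ?P" by (auto simp: E_def dest: simplexD)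
        have ends: "?P 0 = a" "?P (Suc m) = b" by (auto simp: pad_def)
        have "(\<Sum>k\<in>{1..Suc m}. g k z y) =
            (\<Sum>k\<in>{1..Suc m}. if ?P (k - 1) < y \<and> y < ?P k then indicator C y else 0)"
          using True by (intro sum.cong refl) (simp add: g_def indicator_def)
        also have "\<dots> = (if a < y \<and> y < b then indicator C y else 0)"
          using sum_over_gaps[OF P elim, of "indicator C y :: ennreal"] unfolding ends .
        finally show ?thesis using True by (simp only: indicator_def) auto
      qed (simp add: g_def)
    qed
  qed
  also have "\<dots> = (\<integral>\<^sup>+z. indicator (E m) z * ennreal q \<partial>Leb m)"
    by (intro nn_integral_cong) (simp add: nn_integral_cmult fin)
  also have "\<dots> = emeasure (Leb m) (E m) * ennreal q"
    by (simp add: nn_integral_multc)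
  also have "\<dots> = ennreal (q ^ m / fact m) * ennreal q"
    using Suc.IH by (simp add: E_def q_def)
  also have "\<dots> = of_nat (Suc m) * ennreal (q ^ Suc m / fact (Suc m))"
  proof -
    have "0 \<le> q" by (simp add: q_def)
    moreover have "q ^ m / fact m * q = real (Suc m) * (q ^ Suc m / fact (Suc m))"
      by (simp add: mult.commute del: of_nat_Suc)
    ultimately show ?thesis
      by (simp add: ennreal_mult[symmetric] ennreal_of_nat_eq_real_of_nat del: of_nat_Suc)
  qed
  finally have "of_nat (Suc m) * emeasure (Leb (Suc m)) (E (Suc m)) = of_nat (Suc m) * ennreal (q ^ Suc m / fact (Suc m))" .
  then have "emeasure (Leb (Suc m)) (E (Suc m)) = ennreal (q ^ Suc m / fact (Suc m))"
    by (subst (asm) ennreal_mult_cancel_left) (auto simp: ennreal_of_nat_eq_real_of_nat simp del: of_nat_Suc)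
  then show ?case by (simp add: E_def q_def)
qed

lemma emeasure_simplex:
  assumes "a < b"
  shows "emeasure (Leb n) (ordered_simplex a b n) = ennreal ((b - a) ^ n / fact n)"
  using emeasure_simplex_all_in[of UNIV a b n] assms by simp

section \<open>The first collision time is exponential and independent of the collided configuration\<close>

definition alive :: "real \<Rightarrow> real \<Rightarrow> nat \<Rightarrow> real \<Rightarrow> (nat \<Rightarrow> real) set" where
  "alive a b n t = {x \<in> ordered_simplex a b n. increasing_upto n (heat n (- t) (pad a b n x))}"

definition colliding :: "real \<Rightarrow> real \<Rightarrow> nat \<Rightarrow> (nat \<Rightarrow> real) set" where
  "colliding a b n = {x \<in> ordered_simplex a b n. \<exists>t\<ge>0. \<not> increasing_upto n (heat n (- t) (pad a b n x))}"

abbreviation first_collision :: "real \<Rightarrow> real \<Rightarrow> nat \<Rightarrow> (nat \<Rightarrow> real) \<Rightarrow> real" where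
  "first_collision a b n x \<equiv> collision_time n (pad a b n x)"

lemma measurable_heat_pad [measurable]: "(\<lambda>x. heat n s (pad a b n x) i) \<in> borel_measurable (Leb n)"
  by (rule measurable_heat) auto

lemma sets_alive [measurable]: "alive a b n t \<in> sets (Leb n)"
proof -
  have "alive a b n t = ordered_simplex a b n \<inter>
      {x \<in> space (Leb n). \<forall>i\<le>n. heat n (- t) (pad a b n x) i < heat n (- t) (pad a b n x) (Suc i)}"
    using simplexD(1) by (auto simp: alive_def increasing_upto_def)
  then show ?thesis by simp
qed

lemma colliding_eq: "colliding a b n = ordered_simplex a b n - (\<Inter>k. alive a b n (real k))"
proof (intro set_eqI iffI)
  fix x assume x: "x \<in> colliding a b n"
  then obtain t where t: "0 \<le> t" "\<not> increasing_upto n (heat n (- t) (pad a b n x))"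
    by (auto simp: colliding_def)
  obtain k :: nat where k: "t \<le> real k" using real_arch_simple by auto
  then have "x \<notin> alive a b n (real k)" using increasing_earlier[OF _ k] t by (auto simp: alive_def)
  then show "x \<in> ordered_simplex a b n - (\<Inter>k. alive a b n (real k))" using x by (auto simp: colliding_def)
qed (auto simp: colliding_def alive_def intro: of_nat_0_le_iff)

lemma sets_colliding [measurable]: "colliding a b n \<in> sets (Leb n)"
  unfolding colliding_eq by measurable

lemma collidingD:
  assumes "x \<in> colliding a b n"
  shows "x \<in> ordered_simplex a b n" "x \<in> space (Leb n)" "0 < first_collision a b n x"
    "x \<in> alive a b n s \<longleftrightarrow> s < first_collision a b n x"
proof -
  obtain t where t: "0 \<le> t" "\<not> increasing_upto n (heat n (- t) (pad a b n x))"
    using assms by (auto simp: colliding_def)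
  show 1: "x \<in> ordered_simplex a b n" using assms by (simp add: colliding_def)
  then show "x \<in> space (Leb n)" by (rule simplexD)
  note x = simplexD(2)[OF 1]
  show "0 < first_collision a b n x" by (rule collision_time(1)[OF x t])
  show "x \<in> alive a b n s \<longleftrightarrow> s < first_collision a b n x"
    using increasing_iff_less_collision_time[OF x t, of s] 1 by (simp add: alive_def)
qed

lemma space_colliding: "space (restrict_space (Leb n) (colliding a b n)) = colliding a b n"
  using collidingD(2) by (auto simp: space_restrict_space)

lemma measurable_first_collision [measurable]:
  "first_collision a b n \<in> borel_measurable (restrict_space (Leb n) (colliding a b n))"
proof (rule borel_measurableI_greater)
  fix s
  have "{x \<in> space (restrict_space (Leb n) (colliding a b n)). s < first_collision a b n x}
     = colliding a b n \<inter> alive a b n s"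
    unfolding space_colliding using collidingD(4)[of _ a b n s] by blast
  then show "{x \<in> space (restrict_space (Leb n) (colliding a b n)). s < first_collision a b n x}
      \<in> sets (restrict_space (Leb n) (colliding a b n))"
    by (simp add: sets_restrict_space image_iff) (use sets_alive in blast)
qed

lemma finite_after_collision: "finite (after_collision a b n x)" "after_collision a b n x \<subseteq> {a<..<b}"
  by (auto simp: after_collision_def)

lemma measurable_after_collision [measurable]:
  "after_collision a b n \<in> restrict_space (Leb n) (colliding a b n) \<rightarrow>\<^sub>M config_space {a..b}"
proof (rule measurable_config_spaceI)
  fix x show "finite (after_collision a b n x) \<and> after_collision a b n x \<subseteq> {a..b}"
    using finite_after_collision[of a b n x] by auto
next
  fix A :: "real set" assume "closed A"
  then have [measurable]: "A \<in> sets borel" by auto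
  let ?M = "restrict_space (Leb n) (colliding a b n)"
  have [measurable]: "(\<lambda>x. pad a b n x i) \<in> borel_measurable ?M" for i
    by (intro measurable_restrict_space1 measurable_pad)
  have [measurable]: "(\<lambda>x. heat n (- first_collision a b n x) (pad a b n x) i) \<in> borel_measurable ?M" for i
    by (rule measurable_heat) measurable
  have "{x \<in> space ?M. after_collision a b n x \<inter> A = {}} =
     {x \<in> space ?M. \<forall>i\<le>Suc n. heat n (- first_collision a b n x) (pad a b n x) i \<notin> {a<..<b} \<inter> A}"
    unfolding after_collision_def by (intro Collect_cong) blast
  also have "\<dots> \<in> sets ?M" by measurable
  finally show "{x \<in> space ?M. after_collision a b n x \<inter> A = {}} \<in> sets ?M" .
qed

lemma heat_map_in_simplex_iff:
  assumes "x \<in> space (Leb n)" "0 \<le> t"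
  shows "heat_map a b n (- t) x \<in> ordered_simplex a b n \<longleftrightarrow> x \<in> alive a b n t"
proof
  assume "heat_map a b n (- t) x \<in> ordered_simplex a b n"
  then have i: "increasing_upto n (heat n (- t) (pad a b n x))"
    by (simp add: ordered_simplex_def pad_heat_map)
  then have "increasing_upto n (pad a b n x)" using increasing_earlier[OF i assms(2)] by simp
  then show "x \<in> alive a b n t" using i assms by (simp add: alive_def ordered_simplex_def)
qed (simp add: alive_def ordered_simplex_def pad_heat_map heat_map_space)

lemma emeasure_alive_preimage:
  assumes "0 \<le> t" and B: "B \<in> sets (Leb n)" "B \<subseteq> ordered_simplex a b n"
  shows "emeasure (Leb n) {x \<in> alive a b n t. heat_map a b n (- t) x \<in> B}
    = ennreal (exp (- (2 * t * real n))) * emeasure (Leb n) B"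
proof -
  have "{x \<in> alive a b n t. heat_map a b n (- t) x \<in> B} = heat_map a b n (- t) -` B \<inter> space (Leb n)"
  proof (intro set_eqI iffI)
    fix x assume x: "x \<in> heat_map a b n (- t) -` B \<inter> space (Leb n)"
    then have "heat_map a b n (- t) x \<in> ordered_simplex a b n" using B(2) by blast
    then have "x \<in> alive a b n t" using heat_map_in_simplex_iff[OF _ assms(1)] x by blast
    then show "x \<in> {x \<in> alive a b n t. heat_map a b n (- t) x \<in> B}" using x by blast
  next
    fix x assume x: "x \<in> {x \<in> alive a b n t. heat_map a b n (- t) x \<in> B}"
    then have "x \<in> space (Leb n)" by (auto simp: alive_def ordered_simplex_def)
    then show "x \<in> heat_map a b n (- t) -` B \<inter> space (Leb n)" using x by blast
  qed
  then show ?thesis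
    using volume_heat_map[of n a b "- t"] B(1) by (simp add: scales_volume_def)
qed

lemma emeasure_alive:
  assumes "0 \<le> t"
  shows "emeasure (Leb n) (alive a b n t) = ennreal (exp (- (2 * t * real n))) * emeasure (Leb n) (ordered_simplex a b n)"
proof -
  have "alive a b n t = {x \<in> alive a b n t. heat_map a b n (- t) x \<in> ordered_simplex a b n}"
  proof -
    have "heat_map a b n (- t) x \<in> ordered_simplex a b n" if "x \<in> alive a b n t" for x
    proof -
      have "x \<in> space (Leb n)" using that by (auto simp: alive_def ordered_simplex_def)
      then show ?thesis using heat_map_in_simplex_iff[OF _ assms] that by blast
    qed
    then show ?thesis by blast
  qed
  then show ?thesis
    using emeasure_alive_preimage[OF assms sets_simplex order_refl, of n a b] by simp
qed

text \<open>
  Flowing for time \<open>s\<close> advances the collision by \<open>s\<close> and leaves the collided configuration alone.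
\<close>

lemma colliding_shift:
  assumes x: "x \<in> alive a b n s" and s: "0 \<le> s"
  defines "y \<equiv> heat_map a b n (- s) x"
  shows "y \<in> colliding a b n \<longleftrightarrow> x \<in> colliding a b n"
    and "x \<in> colliding a b n \<Longrightarrow> after_collision a b n y = after_collision a b n x"
proof -
  have xs: "x \<in> ordered_simplex a b n" using x by (simp add: alive_def)
  then have ys: "y \<in> ordered_simplex a b n"
    using x heat_map_in_simplex_iff[OF _ s] simplexD(1) unfolding y_def by blast
  have h: "heat n (- r) (pad a b n y) = heat n (- (r + s)) (pad a b n x)" for r
    by (simp add: y_def pad_heat_map heat_add[symmetric])
  show iff: "y \<in> colliding a b n \<longleftrightarrow> x \<in> colliding a b n"
  proof
    assume "y \<in> colliding a b n"
    then obtain r where "0 \<le> r" "\<not> increasing_upto n (heat n (- (r + s)) (pad a b n x))"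
      by (auto simp: colliding_def h)
    then show "x \<in> colliding a b n" using xs s by (auto simp: colliding_def intro!: exI[of _ "r + s"])
  next
    assume c: "x \<in> colliding a b n"
    then have "s < first_collision a b n x" using collidingD(4) x by blast
    moreover have "x \<notin> alive a b n (first_collision a b n x)" using collidingD(4)[OF c] by simp
    ultimately have "0 \<le> first_collision a b n x - s"
      "\<not> increasing_upto n (heat n (- (first_collision a b n x - s)) (pad a b n y))"
      unfolding h using xs by (simp_all add: alive_def)
    then show "y \<in> colliding a b n" using ys unfolding colliding_def by blast
  qed
  assume c: "x \<in> colliding a b n"
  have lt: "s < first_collision a b n x" using collidingD(4)[OF c] x by blast
  have "collision_time n (pad a b n y) = first_collision a b n x - s"
  proof (rule collision_time_eqI)
    show "increasing_upto n (pad a b n y)" using ys by (rule simplexD)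
    have "x \<notin> alive a b n (first_collision a b n x)" using collidingD(4)[OF c] by simp
    then show "\<not> increasing_upto n (heat n (- (first_collision a b n x - s)) (pad a b n y))"
      unfolding h using xs by (simp add: alive_def)
    fix r assume "r < first_collision a b n x - s"
    then have "x \<in> alive a b n (r + s)" using collidingD(4)[OF c] by simp
    then show "increasing_upto n (heat n (- r) (pad a b n y))" unfolding h by (simp add: alive_def)
  qed (use lt in simp)
  then show "after_collision a b n y = after_collision a b n x"
    unfolding after_collision_def by (simp only: h) simp
qed

text \<open>
  The configuration after the collision is constant along the flow, and the flow for time \<open>s\<close>
  maps the tuples that survive beyond \<open>s\<close> onto all of the simplex. Hence the tuples with a given
  kind of collision later than \<open>s\<close> have \<open>e\<^sup>-\<^sup>2\<^sup>n\<^sup>s\<close> times the volume of all tuples with that kind of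
  collision.
\<close>

lemma emeasure_late_collision:
  assumes E: "E \<in> sets (config_space {a..b})" and s: "0 \<le> s"
  shows "emeasure (Leb n) {x \<in> colliding a b n. s < first_collision a b n x \<and> after_collision a b n x \<in> E}
    = ennreal (exp (- (2 * s * real n))) * emeasure (Leb n) {x \<in> colliding a b n. after_collision a b n x \<in> E}"
proof -
  let ?B = "{x \<in> colliding a b n. after_collision a b n x \<in> E}"
  have "{x \<in> space (restrict_space (Leb n) (colliding a b n)). after_collision a b n x \<in> E}
      \<in> sets (restrict_space (Leb n) (colliding a b n))"
    using E by measurable
  then have B: "?B \<in> sets (Leb n)"
    by (subst (asm) sets_restrict_space_iff) (auto simp: space_colliding)
  have "{x \<in> colliding a b n. s < first_collision a b n x \<and> after_collision a b n x \<in> E}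
    = {x \<in> alive a b n s. heat_map a b n (- s) x \<in> ?B}"
  proof (intro set_eqI iffI)
    fix x assume x: "x \<in> {x \<in> colliding a b n. s < first_collision a b n x \<and> after_collision a b n x \<in> E}"
    then have "x \<in> alive a b n s" using collidingD(4) by blast
    then show "x \<in> {x \<in> alive a b n s. heat_map a b n (- s) x \<in> ?B}"
      using x colliding_shift[of x a b n s, OF _ s] by simp
  next
    fix x assume x: "x \<in> {x \<in> alive a b n s. heat_map a b n (- s) x \<in> ?B}"
    then have al: "x \<in> alive a b n s" by simp
    have "x \<in> colliding a b n" using x colliding_shift(1)[OF al s] by simp
    moreover from this have "after_collision a b n x \<in> E" using x colliding_shift(2)[OF al s] by simp
    ultimately show "x \<in> {x \<in> colliding a b n. s < first_collision a b n x \<and> after_collision a b n x \<in> E}"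
      using x collidingD(4)[of x a b n s] by simp
  qed
  moreover have "?B \<subseteq> ordered_simplex a b n" using collidingD(1) by blast
  ultimately show ?thesis
    using emeasure_alive_preimage[OF s B] by simp
qed

text \<open>
  The volume of the tuples without a collision up to time \<open>k\<close> tends to 0.
\<close>

lemma emeasure_colliding:
  assumes n: "0 < n" and ab: "a < b"
  shows "emeasure (Leb n) (colliding a b n) = emeasure (Leb n) (ordered_simplex a b n)"
proof -
  let ?V = "(b - a) ^ n / fact n"
  have V: "emeasure (Leb n) (alive a b n (real k)) = ennreal (exp (- (2 * real n)) ^ k * ?V)" for k
  proof -
    have "exp (- (2 * real k * real n)) = exp (- (2 * real n)) ^ k"
      by (simp add: exp_of_nat_mult[symmetric] mult.commute mult.left_commute)
    moreover have "0 \<le> ?V" using ab by simp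
    ultimately show ?thesis using ab by (simp only: emeasure_alive emeasure_simplex ennreal_mult of_nat_0_le_iff exp_ge_zero zero_le_power)
  qed
  have "exp (- (2 * real n)) < 1" using n by simp
  then have "(\<lambda>k. exp (- (2 * real n)) ^ k * ?V) \<longlonglongrightarrow> 0 * ?V"
    by (intro tendsto_mult LIMSEQ_realpow_zero tendsto_const) auto
  then have lim: "(\<lambda>k. emeasure (Leb n) (alive a b n (real k))) \<longlonglongrightarrow> 0"
    unfolding V using tendsto_ennrealI by fastforce
  have "emeasure (Leb n) (\<Inter>k. alive a b n (real k)) \<le> emeasure (Leb n) (alive a b n (real k))" for k
    by (intro emeasure_mono) auto
  then have "emeasure (Leb n) (\<Inter>k. alive a b n (real k)) \<le> 0"
    using lim by (intro LIMSEQ_le_const[OF lim]) auto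
  then have "(\<Inter>k. alive a b n (real k)) \<in> null_sets (Leb n)" by (auto simp: null_sets_def)
  then show ?thesis unfolding colliding_eq by (simp add: emeasure_Diff_null_set)
qed

definition collided_volume :: "real \<Rightarrow> real \<Rightarrow> nat \<Rightarrow> real set measure" where
  "collided_volume a b n =
     distr (restrict_space (Leb n) (colliding a b n)) (config_space {a..b}) (after_collision a b n)"

lemma sets_collided_volume [measurable_cong]: "sets (collided_volume a b n) = sets (config_space {a..b})"
  by (simp add: collided_volume_def)

lemma emeasure_collided_volume:
  assumes "E \<in> sets (config_space {a..b})"
  shows "emeasure (collided_volume a b n) E = emeasure (Leb n) {x \<in> colliding a b n. after_collision a b n x \<in> E}"
proof -
  have "emeasure (collided_volume a b n) E = emeasure (restrict_space (Leb n) (colliding a b n))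
      (after_collision a b n -` E \<inter> space (restrict_space (Leb n) (colliding a b n)))"
    unfolding collided_volume_def using assms by (intro emeasure_distr) auto
  also have "after_collision a b n -` E \<inter> space (restrict_space (Leb n) (colliding a b n))
      = {x \<in> colliding a b n. after_collision a b n x \<in> E}"
    by (auto simp: space_colliding)
  finally show ?thesis by (subst (asm) emeasure_restrict_space) auto
qed

lemma emeasure_collided_volume_space:
  assumes "0 < n" "a < b"
  shows "emeasure (collided_volume a b n) (space (collided_volume a b n)) = ennreal ((b - a) ^ n / fact n)"
proof -
  have "space (collided_volume a b n) = space (config_space {a..b})" by (simp add: collided_volume_def)
  moreover have "after_collision a b n x \<in> space (config_space {a..b})" for x
    using finite_after_collision[of a b n x] by (auto simp: space_config_space)
  ultimately show ?thesis
    using emeasure_colliding[OF assms] assms by (simp add: emeasure_collided_volume emeasure_simplex)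
qed

lemma emeasure_exponential_tail:
  assumes "0 < l"
  shows "emeasure (density lborel (exponential_density l)) {s<..} = ennreal (exp (- (l * max 0 s)))"
proof -
  interpret prob_space "density lborel (exponential_density l)"
    by (rule prob_space_exponential_density[OF assms])
  have "prob {..s} = erlang_CDF 0 l s"
    using emeasure_erlang_density[OF assms, of 0 s] assms by (simp add: emeasure_eq_measure)
  moreover have "{s<..} = space (density lborel (exponential_density l)) - {..s}" by auto
  then have "prob {s<..} = 1 - prob {..s}" by (simp only:) (rule prob_compl, simp)
  ultimately show ?thesis
    using assms by (auto simp: emeasure_eq_measure erlang_CDF_def max_def mult.commute)
qed

lemma joint_law_first_collision:
  assumes n: "0 < n" and ab: "a < b"
  shows "distr (restrict_space (Leb n) (colliding a b n)) (borel \<Otimes>\<^sub>M config_space {a..b})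
      (\<lambda>x. (first_collision a b n x, after_collision a b n x))
    = density lborel (exponential_density (2 * real n)) \<Otimes>\<^sub>M collided_volume a b n"
    (is "?J = ?X \<Otimes>\<^sub>M ?C")
proof (rule sym, rule pair_measure_eqI)
  let ?M = "restrict_space (Leb n) (colliding a b n)"
  have l: "0 < 2 * real n" using n by simp
  interpret X: prob_space ?X by (rule prob_space_exponential_density[OF l])
  interpret C: finite_measure ?C
    by standard (simp add: emeasure_collided_volume_space[OF n ab])
  show "sigma_finite_measure ?X" "sigma_finite_measure ?C" by unfold_locales
  show "sets (?X \<Otimes>\<^sub>M ?C) = sets ?J"
    by (simp add: sets_collided_volume cong: sets_pair_measure_cong)
  fix A B assume A: "A \<in> sets ?X" and "B \<in> sets ?C"
  then have B [measurable]: "B \<in> sets (config_space {a..b})" by (simp add: sets_collided_volume)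
  let ?N = "distr (restrict_space ?M {x \<in> space ?M. after_collision a b n x \<in> B}) borel (first_collision a b n)"
  have m: "first_collision a b n \<in> borel_measurable (restrict_space ?M {x \<in> space ?M. after_collision a b n x \<in> B})"
    by (rule measurable_restrict_space1) measurable
  note sp = space_colliding[of n a b]
  have N: "emeasure ?N S = emeasure (Leb n) {x \<in> colliding a b n. first_collision a b n x \<in> S \<and> after_collision a b n x \<in> B}"
    if S: "S \<in> sets borel" for S
  proof -
    have "emeasure ?N S = emeasure (restrict_space ?M {x \<in> space ?M. after_collision a b n x \<in> B})
        {x \<in> colliding a b n. first_collision a b n x \<in> S \<and> after_collision a b n x \<in> B}"
      using S by (subst emeasure_distr[OF m])
        (auto simp: sp space_restrict_space intro!: arg_cong2[where f = emeasure])
    also have "\<dots> = emeasure ?M {x \<in> colliding a b n. first_collision a b n x \<in> S \<and> after_collision a b n x \<in> B}"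
    proof (rule emeasure_restrict_space)
      have "{x \<in> space ?M. after_collision a b n x \<in> B} \<in> sets ?M" by measurable
      then show "{x \<in> space ?M. after_collision a b n x \<in> B} \<inter> space ?M \<in> sets ?M"
        by (rule sets.Int) (rule sets.top)
    qed (auto simp: sp)
    also have "\<dots> = emeasure (Leb n) {x \<in> colliding a b n. first_collision a b n x \<in> S \<and> after_collision a b n x \<in> B}"
      by (rule emeasure_restrict_space) auto
    finally show ?thesis .
  qed
  have "?N = scale_measure (emeasure ?C B) ?X"
  proof (rule measure_eqI_lessThan)
    fix s
    have eq: "emeasure ?N {s<..} = ennreal (exp (- (2 * max 0 s * real n))) * emeasure ?C B"
    proof -
      have eq: "{x \<in> colliding a b n. first_collision a b n x \<in> {s<..} \<and> after_collision a b n x \<in> B}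
        = {x \<in> colliding a b n. max 0 s < first_collision a b n x \<and> after_collision a b n x \<in> B}"
        using collidingD(3) by auto
      have "emeasure ?N {s<..} = emeasure (Leb n)
          {x \<in> colliding a b n. first_collision a b n x \<in> {s<..} \<and> after_collision a b n x \<in> B}"
        by (rule N) simp
      also have "\<dots> = ennreal (exp (- (2 * max 0 s * real n))) * emeasure ?C B"
        unfolding eq emeasure_collided_volume[OF B] by (rule emeasure_late_collision[OF B]) simp
      finally show ?thesis .
    qed
    then show "emeasure ?N {s<..} = emeasure (scale_measure (emeasure ?C B) ?X) {s<..}"
      using emeasure_exponential_tail[OF l, of s] by (simp add: mult.commute mult.left_commute)
    show "emeasure ?N {s<..} < \<infinity>"
      unfolding eq using C.emeasure_finite[of B] by (simp add: ennreal_mult_eq_top_iff less_top[symmetric])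
  qed simp_all
  then have "emeasure ?X A * emeasure ?C B = emeasure ?N A" using A by (simp add: mult.commute)
  also have "\<dots> = emeasure ?M {x \<in> colliding a b n. first_collision a b n x \<in> A \<and> after_collision a b n x \<in> B}"
    using A by (subst N) (auto simp: emeasure_restrict_space)
  also have "\<dots> = emeasure ?J (A \<times> B)"
    using A by (subst emeasure_distr) (auto simp: sp intro!: arg_cong2[where f = emeasure])
  finally show "emeasure ?X A * emeasure ?C B = emeasure ?J (A \<times> B)" .
qed

section \<open>The flux through the collision faces\<close>

definition points :: "real \<Rightarrow> real \<Rightarrow> nat \<Rightarrow> (nat \<Rightarrow> real) \<Rightarrow> real set" where
  "points a b n x = x ` {1..n} \<inter> {a<..<b}"

lemma points_simplex: "x \<in> ordered_simplex a b n \<Longrightarrow> points a b n x = x ` {1..n}"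
  using simplexD(3)[of x a b n] by (auto simp: points_def)

lemma measurable_points [measurable]: "points a b n \<in> Leb n \<rightarrow>\<^sub>M config_space {a..b}"
proof (rule measurable_config_spaceI)
  fix x show "finite (points a b n x) \<and> points a b n x \<subseteq> {a..b}" by (auto simp: points_def)
next
  fix A :: "real set" assume "closed A"
  then have [measurable]: "A \<in> sets borel" by auto
  have "{x \<in> space (Leb n). points a b n x \<inter> A = {}} =
     {x \<in> space (Leb n). \<forall>i\<in>{1..n}. x i \<notin> {a<..<b} \<inter> A}"
    unfolding points_def by blast
  also have "\<dots> \<in> sets (Leb n)" by measurable
  finally show "{x \<in> space (Leb n). points a b n x \<inter> A = {}} \<in> sets (Leb n)" .
qed

text \<open>
  The point of the \<open>p\<close>-th face that becomes \<open>z\<close> when the double entry is merged.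
\<close>

definition dup :: "nat \<Rightarrow> (nat \<Rightarrow> real) \<Rightarrow> nat \<Rightarrow> real" where
  "dup p z i = (if i \<le> p then z i else z (i - 1))"

text \<open>
  The speed at which the \<open>p\<close>-th gap closes on its face.
\<close>

definition flux :: "nat \<Rightarrow> (nat \<Rightarrow> real) \<Rightarrow> nat \<Rightarrow> real" where
  "flux n z p = nbr_sum n (dup p z) (Suc p) - nbr_sum n (dup p z) p"

lemma flux_eq:
  assumes "p \<le> n" "0 < n"
  shows "flux n z p = z (min (Suc p) n) - z (p - 1)"
proof -
  consider "p = 0" | "p = n" "p \<noteq> 0" | "p \<noteq> 0" "p < n" using assms by linarith
  then show ?thesis
    using assms by cases (auto simp: flux_def nbr_sum_def dup_def One_nat_def)
qed

text \<open>
  The speed at which the faces of the simplex are crossed differs from face to face, but its sum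
  over all faces telescopes to a constant. This is why the collided configuration is uniform.
\<close>

lemma sum_flux:
  assumes "0 < n"
  shows "(\<Sum>p\<le>n. flux n z p) = 2 * (z n - z 0)"
proof -
  obtain m where m: "n = Suc m" using assms by (cases n) auto
  have "(\<Sum>p\<le>n. flux n z p) = (\<Sum>p\<le>n. z (min (Suc p) n)) - (\<Sum>p\<le>n. z (p - 1))"
    using assms by (simp add: flux_eq sum_subtractf)
  also have "(\<Sum>p\<le>n. z (min (Suc p) n)) = (\<Sum>p<n. z (Suc p)) + z n"
    by (simp add: lessThan_Suc_atMost[symmetric] Suc_le_eq min_absorb1)
  also have "(\<Sum>p\<le>n. z (p - 1)) = z 0 + (\<Sum>p<n. z p)"
    unfolding m by (subst sum.atMost_Suc_shift) (simp add: lessThan_Suc_atMost)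
  also have "(\<Sum>p<n. z (Suc p)) + z n - (z 0 + (\<Sum>p<n. z p)) = 2 * (z n - z 0)"
    using sum_lessThan_telescope[of z n] by (simp add: sum_subtractf)
  finally show ?thesis .
qed

definition inserted_index :: "nat \<Rightarrow> nat \<Rightarrow> nat" where
  "inserted_index n p = (if p < n then Suc p else n)"

definition inserted_side :: "nat \<Rightarrow> nat \<Rightarrow> real" where
  "inserted_side n p = (if p < n then 1 else - 1)"

text \<open>
  The tuple \<open>z\<close> with one more particle at distance \<open>h * r\<close> from \<open>z\<^sub>p\<close>: to its right if \<open>p \<le> m\<close>,
  and to the left of the right end if \<open>p = m + 1\<close>.
\<close>

definition near_face :: "real \<Rightarrow> real \<Rightarrow> nat \<Rightarrow> nat \<Rightarrow> real \<Rightarrow> (nat \<Rightarrow> real) \<Rightarrow> real \<Rightarrow> nat \<Rightarrow> real" where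
  "near_face a b m p h z r =
     ins m (inserted_index (Suc m) p) z (pad a b m z p + inserted_side (Suc m) p * h * r)"

lemma inserted_index_range: "p \<le> Suc m \<Longrightarrow> inserted_index (Suc m) p \<in> {1..Suc m}"
  by (auto simp: inserted_index_def One_nat_def)

definition inserted_direction :: "nat \<Rightarrow> nat \<Rightarrow> nat \<Rightarrow> real" where
  "inserted_direction n p i = (if i = inserted_index n p then inserted_side n p else 0)"

lemma pad_near_face:
  assumes "p \<le> Suc m"
  shows "pad a b (Suc m) (near_face a b m p h z r) =
    (\<lambda>i. 1 * dup p (pad a b m z) i + (h * r) * inserted_direction (Suc m) p i)"
proof
  fix i
  show "pad a b (Suc m) (near_face a b m p h z r) i =
    1 * dup p (pad a b m z) i + (h * r) * inserted_direction (Suc m) p i"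
  proof (cases "p < Suc m")
    case True
    then show ?thesis
      unfolding near_face_def pad_ins[OF inserted_index_range[OF assms]]
      by (auto simp: inserted_index_def inserted_side_def inserted_direction_def dup_def)
  next
    case False
    then have p: "p = Suc m" using assms by simp
    then show ?thesis
      unfolding near_face_def pad_ins[OF inserted_index_range[OF assms]]
      by (auto simp: inserted_index_def inserted_side_def inserted_direction_def dup_def pad_def)
  qed
qed

lemma inserted_direction_gap:
  "p \<le> n \<Longrightarrow> 0 < n \<Longrightarrow> inserted_direction n p (Suc p) - inserted_direction n p p = 1"
  by (auto simp: inserted_direction_def inserted_index_def inserted_side_def)

text \<open>
  Joint continuity of \<open>(s, h) \<mapsto> u s + h v s\<close> at the origin, to control all times up to the
  collision at once.
\<close>

lemma eventually_near_origin:
  fixes u v :: "real \<Rightarrow> real"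
  assumes u: "isCont u 0" and v: "isCont v 0" and U: "open U" "u 0 \<in> U"
  shows "\<forall>\<^sub>F h in at_right 0. \<forall>s\<in>{0..h}. u s + h * v s \<in> U"
proof -
  let ?g = "\<lambda>q. u (fst q) + snd q * v (fst q)"
  have "isCont ?g (0, 0)"
  proof -
    have "isCont (\<lambda>q. w (fst q)) (0, 0 :: real)" if "isCont w 0" for w :: "real \<Rightarrow> real"
      by (rule isCont_o2[where f = fst and g = w]) (use that in \<open>auto intro!: continuous_intros\<close>)
    then show ?thesis using u v by (intro continuous_intros) auto
  qed
  then have "(?g \<longlongrightarrow> ?g (0, 0)) (nhds (0, 0))"
    unfolding isCont_def by (rule iffD1[OF tendsto_at_iff_tendsto_nhds])
  then have "\<forall>\<^sub>F q in nhds (0, 0). ?g q \<in> U"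
    by (rule topological_tendstoD) (use U in auto)
  then obtain d where d: "0 < d" "\<And>q. dist q (0, 0) < d \<Longrightarrow> ?g q \<in> U"
    unfolding eventually_nhds_metric by blast
  have "u s + h * v s \<in> U" if "0 < h" "h < d / 2" "s \<in> {0..h}" for h s
  proof -
    have "dist (s, h) (0, 0) = sqrt (s\<^sup>2 + h\<^sup>2)" by (simp add: dist_Pair_Pair)
    also have "\<dots> \<le> \<bar>s\<bar> + \<bar>h\<bar>" by (rule sqrt_sum_squares_le_sum_abs)
    also have "\<dots> < d" using that by auto
    finally show ?thesis using d(2)[of "(s, h)"] by simp
  qed
  then show ?thesis
    using d(1) by (intro eventually_at_rightI[of 0 "d / 2"]) auto
qed

lemma isCont_heat_minus: "isCont (\<lambda>s. heat n (- s) x i) s"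
  by (rule isCont_o2[of s uminus "\<lambda>s. heat n s x i"]) (auto intro!: heat_continuous continuous_intros)

context
  fixes a b :: real and m p :: nat and z :: "nat \<Rightarrow> real" and r :: real
  assumes ab: "a < b" and p: "p \<le> Suc m" and z: "z \<in> ordered_simplex a b m"
    and r: "0 < r" "r < flux (Suc m) (pad a b m z) p"
begin

lemma gap_dup:
  assumes "i \<le> Suc m"
  shows "i \<noteq> p \<Longrightarrow> dup p (pad a b m z) i < dup p (pad a b m z) (Suc i)"
    and "dup p (pad a b m z) p = dup p (pad a b m z) (Suc p)"
proof -
  note P = simplexD(2)[OF z]
  show "dup p (pad a b m z) i < dup p (pad a b m z) (Suc i)" if "i \<noteq> p"
    using that assms increasing_less[OF P, of i "Suc i"] increasing_less[OF P, of "i - 1" i] p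
    by (cases "i < p") (auto simp: dup_def)
  show "dup p (pad a b m z) p = dup p (pad a b m z) (Suc p)" by (simp add: dup_def)
qed

lemma heat_near_face:
  "heat (Suc m) s (pad a b (Suc m) (near_face a b m p h z r)) i =
     heat (Suc m) s (dup p (pad a b m z)) i + h * (r * heat (Suc m) s (inserted_direction (Suc m) p) i)"
  unfolding pad_near_face[OF p] heat_lincomb by simp

text \<open>
  At time \<open>h\<close> the gap of initial size \<open>h * r\<close> is \<open>h * (r - flux)\<close> up to terms of order \<open>h\<^sup>2\<close>.
\<close>

lemma eventually_gap_closed:
  "\<forall>\<^sub>F h in at_right 0. \<not> increasing_upto (Suc m) (heat (Suc m) (- h) (pad a b (Suc m) (near_face a b m p h z r)))"
proof -
  let ?n = "Suc m"
  let ?\<iota> = "dup p (pad a b m z)" and ?e = "inserted_direction ?n p"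
  define G where "G x h = heat ?n (- h) x (Suc p) - heat ?n (- h) x p" for x h
  define f where "f h = G ?\<iota> h + h * (r * G ?e h)" for h
  have DG: "(G x has_real_derivative - (nbr_sum ?n x (Suc p) - nbr_sum ?n x p) + 2 * (x (Suc p) - x p)) (at 0)" for x
  proof -
    have "((\<lambda>h. heat ?n (- h) x i) has_real_derivative (nbr_sum ?n (heat ?n (- 0) x) i - 2 * heat ?n (- 0) x i) * (- 1)) (at 0)" for i
      by (rule DERIV_chain2[OF DERIV_heat]) (auto intro!: derivative_eq_intros)
    from DERIV_diff[OF this[of "Suc p"] this[of p]] show ?thesis
      unfolding G_def by (rule DERIV_cong) simp
  qed
  have G0: "G ?\<iota> 0 = 0" "G ?e 0 = 1"
    using gap_dup(2)[of p] p inserted_direction_gap[OF p] by (auto simp: G_def)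
  have "(f has_real_derivative - flux ?n (pad a b m z) p + r) (at 0)"
  proof -
    have "(f has_real_derivative (- (nbr_sum ?n ?\<iota> (Suc p) - nbr_sum ?n ?\<iota> p) + 2 * (?\<iota> (Suc p) - ?\<iota> p)) +
        (1 * (r * G ?e 0) + (r * (- (nbr_sum ?n ?e (Suc p) - nbr_sum ?n ?e p) + 2 * (?e (Suc p) - ?e p))) * 0)) (at 0)"
      unfolding f_def by (intro DERIV_add DERIV_mult DERIV_ident DERIV_cmult DG)
    then show ?thesis
      by (rule DERIV_cong) (use G0 gap_dup(2)[of p] p in \<open>simp add: flux_def\<close>)
  qed
  moreover have "- flux ?n (pad a b m z) p + r < 0" using r by simp
  ultimately obtain d where d: "0 < d" "\<And>h. 0 < h \<Longrightarrow> h < d \<Longrightarrow> f (0 + h) < f 0"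
    using DERIV_neg_dec_right by blast
  have "\<not> increasing_upto ?n (heat ?n (- h) (pad a b ?n (near_face a b m p h z r)))" if "0 < h" "h < d" for h
  proof -
    have "f h < 0" using d(2)[OF that] G0 by (simp add: f_def)
    then have "heat ?n (- h) (pad a b ?n (near_face a b m p h z r)) (Suc p)
      < heat ?n (- h) (pad a b ?n (near_face a b m p h z r)) p"
      unfolding heat_near_face by (simp add: f_def G_def algebra_simps)
    then show ?thesis using p by (auto simp: increasing_upto_def not_less intro!: exI[of _ p])
  qed
  then show ?thesis using d(1) by (intro eventually_at_rightI[of 0 d]) auto
qed

lemma eventually_in_simplex: "\<forall>\<^sub>F h in at_right 0. near_face a b m p h z r \<in> ordered_simplex a b (Suc m)"
proof -
  let ?P = "pad a b m z"
  note P = simplexD(2)[OF z]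
  define d where "d = (if p < Suc m then ?P (Suc p) - ?P p else ?P (Suc m) - ?P m) / r"
  have "0 < d" using increasing_less[OF P, of p "Suc p"] increasing_less[OF P, of m "Suc m"] r
    by (auto simp: d_def)
  moreover have "near_face a b m p h z r \<in> ordered_simplex a b (Suc m)" if h: "0 < h" "h < d" for h
  proof -
    have "h * r < d * r" using h r by simp
    then have hr: "0 < h * r" "h * r < (if p < Suc m then ?P (Suc p) - ?P p else ?P (Suc m) - ?P m)"
      using h r by (simp_all add: d_def)
    show ?thesis
      unfolding near_face_def ins_in_simplex_iff[OF inserted_index_range[OF p] simplexD(1)[OF z]]
      using z hr p by (auto simp: inserted_index_def inserted_side_def One_nat_def split: if_splits)
  qed
  ultimately show ?thesis by (intro eventually_at_rightI[of 0 d]) auto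
qed

text \<open>
  The gap that is about to close is the smallest one. This separates the neighbourhoods of different
  faces.
\<close>

lemma eventually_smallest_gap:
  defines "X \<equiv> \<lambda>h. pad a b (Suc m) (near_face a b m p h z r)"
  shows "\<forall>\<^sub>F h in at_right 0. \<forall>i\<le>Suc m. i \<noteq> p \<longrightarrow> X h (Suc p) - X h p < X h (Suc i) - X h i"
proof -
  have lim: "((\<lambda>h. X h i) \<longlongrightarrow> dup p (pad a b m z) i) (at_right 0)" for i
    unfolding X_def pad_near_face[OF p]
    by (rule tendsto_eq_intros tendsto_ident_at refl | simp)+
  have "\<forall>\<^sub>F h in at_right 0. i \<noteq> p \<longrightarrow> X h (Suc p) - X h p < X h (Suc i) - X h i" if i: "i \<le> Suc m" for i
  proof (cases "i = p")
    case False
    then have lt: "dup p (pad a b m z) (Suc p) - dup p (pad a b m z) p < dup p (pad a b m z) (Suc i) - dup p (pad a b m z) i"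
      using gap_dup(1)[OF i] gap_dup(2)[OF i] by simp
    from order_tendstoD(2)[OF tendsto_diff[OF tendsto_diff[OF lim lim] tendsto_diff[OF lim lim]], of _ _ _ _ 0]
    have "\<forall>\<^sub>F h in at_right 0. (X h (Suc p) - X h p) - (X h (Suc i) - X h i) < 0"
      using lt by simp
    then show ?thesis by eventually_elim simp
  qed simp
  then have "\<forall>\<^sub>F h in at_right 0. \<forall>i\<in>{..Suc m}. i \<noteq> p \<longrightarrow> X h (Suc p) - X h p < X h (Suc i) - X h i"
    by (intro eventually_ball_finite) auto
  then show ?thesis by eventually_elim auto
qed

lemma eventually_collides_near:
  assumes V: "\<And>i. open (V i)" "\<And>i. i \<le> Suc (Suc m) \<Longrightarrow> dup p (pad a b m z) i \<in> V i"
  shows "\<forall>\<^sub>F h in at_right 0. let x = near_face a b m p h z r; \<tau> = first_collision a b (Suc m) x;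
      y = heat (Suc m) (- \<tau>) (pad a b (Suc m) x) in
    x \<in> colliding a b (Suc m) \<and> \<tau> \<le> h \<and> y p = y (Suc p) \<and> (\<forall>i\<le>Suc (Suc m). y i \<in> V i)"
proof -
  let ?n = "Suc m" and ?x = "\<lambda>h. near_face a b m p h z r"
  let ?Y = "\<lambda>h s. heat ?n (- s) (pad a b ?n (?x h))"
  have near: "\<forall>\<^sub>F h in at_right 0. \<forall>s\<in>{0..h}. ?Y h s i \<in> V i" if "i \<le> Suc ?n" for i
    unfolding heat_near_face
    by (rule eventually_near_origin) (use V that in \<open>auto intro!: isCont_heat_minus continuous_intros\<close>)
  then have "\<forall>\<^sub>F h in at_right 0. \<forall>i\<in>{..Suc ?n}. \<forall>s\<in>{0..h}. ?Y h s i \<in> V i"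
    by (intro eventually_ball_finite) auto
  moreover have "\<forall>\<^sub>F h in at_right 0. \<forall>i\<in>{..?n} - {p}. \<forall>s\<in>{0..h}. ?Y h s (Suc i) - ?Y h s i \<in> {0<..}"
  proof (intro eventually_ball_finite ballI)
    fix i assume i: "i \<in> {..?n} - {p}"
    let ?e = "inserted_direction ?n p" and ?\<iota> = "dup p (pad a b m z)"
    have "\<forall>\<^sub>F h in at_right 0. \<forall>s\<in>{0..h}. (heat ?n (- s) ?\<iota> (Suc i) - heat ?n (- s) ?\<iota> i)
        + h * (r * heat ?n (- s) ?e (Suc i) - r * heat ?n (- s) ?e i) \<in> {0<..}"
      by (rule eventually_near_origin)
         (use gap_dup(1)[of i] i in \<open>auto intro!: isCont_heat_minus continuous_intros\<close>)
    then show "\<forall>\<^sub>F h in at_right 0. \<forall>s\<in>{0..h}. ?Y h s (Suc i) - ?Y h s i \<in> {0<..}"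
      unfolding heat_near_face by eventually_elim (simp add: algebra_simps)
  qed simp
  moreover have "\<forall>\<^sub>F h in at_right 0. (0::real) < h" by (simp add: eventually_at_right_less)
  ultimately show ?thesis
    using eventually_in_simplex eventually_gap_closed
  proof eventually_elim
    case (elim h)
    have h: "0 \<le> h" using elim by simp
    note X = simplexD(2)[OF elim(4)]
    define \<tau> where "\<tau> = first_collision a b ?n (?x h)"
    note \<tau> = collision_time[OF X h elim(5), folded \<tau>_def]
    have wi: "?Y h \<tau> i \<le> ?Y h \<tau> (Suc i)" if "i \<le> ?n" for i
      unfolding \<tau>_def by (rule collision_time_weakly_increasing[OF X h elim(5) that])
    have "?x h \<in> colliding a b ?n" using elim(4,5) h by (auto simp: colliding_def)
    moreover have s: "\<tau> \<in> {0..h}" using \<tau> by simp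
    moreover have "?Y h \<tau> p = ?Y h \<tau> (Suc p)"
    proof -
      obtain i where i: "i \<le> ?n" "\<not> ?Y h \<tau> i < ?Y h \<tau> (Suc i)" using \<tau>(3) by (auto simp: increasing_upto_def)
      then have "i = p" using elim(2) s by force
      then show ?thesis using i wi[OF i(1)] by simp
    qed
    moreover have "\<forall>i\<le>Suc ?n. ?Y h \<tau> i \<in> V i" using elim(1) s by auto
    ultimately show ?case by (simp add: Let_def \<tau>_def)
  qed
qed

text \<open>
  Entries of the duplicated tuple are original particles, or ends, or the particle about to be
  absorbed at an end.
\<close>

lemma dup_inside:
  assumes "i \<le> Suc (Suc m)"
  shows "i = 0 \<or> i = Suc (Suc m) \<or> (p = 0 \<and> i = 1) \<or> (p = Suc m \<and> i = Suc m)
    \<or> (\<exists>j\<in>{1..m}. dup p (pad a b m z) i = z j)"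
proof (cases "i \<le> p")
  case True
  then show ?thesis using assms p by (cases "i \<le> m") (auto simp: dup_def pad_def)
next
  case False
  then show ?thesis using assms p
    by (cases "i - 1 = 0"; cases "i - 1 \<le> m") (auto simp: dup_def pad_def)
qed

lemma eventually_void:
  assumes A: "closed A" and zA: "z ` {1..m} \<inter> A = {}"
  shows "\<forall>\<^sub>F h in at_right 0. let x = near_face a b m p h z r in
    x \<in> colliding a b (Suc m) \<and> first_collision a b (Suc m) x \<le> h \<and> after_collision a b (Suc m) x \<inter> A = {}"
proof -
  let ?\<iota> = "dup p (pad a b m z)"
  define V where "V i = (if \<exists>j\<in>{1..m}. ?\<iota> i = z j then - A else UNIV)" for i
  have "\<forall>\<^sub>F h in at_right 0. let x = near_face a b m p h z r; \<tau> = first_collision a b (Suc m) x;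
      y = heat (Suc m) (- \<tau>) (pad a b (Suc m) x) in
    x \<in> colliding a b (Suc m) \<and> \<tau> \<le> h \<and> y p = y (Suc p) \<and> (\<forall>i\<le>Suc (Suc m). y i \<in> V i)"
    by (rule eventually_collides_near) (use A zA in \<open>auto simp: V_def\<close>)
  then show ?thesis
  proof eventually_elim
    case (elim h)
    define x where "x = near_face a b m p h z r"
    define y where "y = heat (Suc m) (- first_collision a b (Suc m) x) (pad a b (Suc m) x)"
    have e: "x \<in> colliding a b (Suc m)" "first_collision a b (Suc m) x \<le> h" "y p = y (Suc p)"
      "\<And>i. i \<le> Suc (Suc m) \<Longrightarrow> y i \<in> V i"
      using elim by (auto simp: Let_def x_def y_def)
    have ends: "y 0 = a" "y (Suc (Suc m)) = b" by (simp_all add: y_def heat_end pad_def)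
    have "y i \<notin> A" if i: "i \<le> Suc (Suc m)" "y i \<in> {a<..<b}" for i
    proof -
      have "\<exists>j\<in>{1..m}. ?\<iota> i = z j"
        using dup_inside[OF i(1)] i(2) ends e(3) by (auto simp: One_nat_def)
      then show ?thesis using e(4)[OF i(1)] by (simp add: V_def)
    qed
    then have "after_collision a b (Suc m) x \<inter> A = {}"
      by (auto simp: after_collision_def y_def)
    then show ?case using e by (simp add: Let_def x_def)
  qed
qed

lemma eventually_hit:
  assumes A: "open A" and zA: "z ` {1..m} \<inter> A \<noteq> {}"
  shows "\<forall>\<^sub>F h in at_right 0. let x = near_face a b m p h z r in
    x \<in> colliding a b (Suc m) \<and> first_collision a b (Suc m) x \<le> h \<and> after_collision a b (Suc m) x \<inter> A \<noteq> {}"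
proof -
  let ?\<iota> = "dup p (pad a b m z)"
  obtain j where j: "j \<in> {1..m}" "z j \<in> A" using zA by blast
  have zj: "z j \<in> {a<..<b}" using simplexD(3)[OF z] j by blast
  define i where "i = (if j \<le> p then j else Suc j)"
  have i: "i \<le> Suc (Suc m)" "?\<iota> i = z j" using j by (auto simp: i_def dup_def pad_def)
  define V where "V i' = (if i' = i then A \<inter> {a<..<b} else UNIV)" for i'
  have "\<forall>\<^sub>F h in at_right 0. let x = near_face a b m p h z r; \<tau> = first_collision a b (Suc m) x;
      y = heat (Suc m) (- \<tau>) (pad a b (Suc m) x) in
    x \<in> colliding a b (Suc m) \<and> \<tau> \<le> h \<and> y p = y (Suc p) \<and> (\<forall>i\<le>Suc (Suc m). y i \<in> V i)"
    by (rule eventually_collides_near) (use A i j zj in \<open>auto simp: V_def\<close>)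
  then show ?thesis
  proof eventually_elim
    case (elim h)
    define x where "x = near_face a b m p h z r"
    define y where "y = heat (Suc m) (- first_collision a b (Suc m) x) (pad a b (Suc m) x)"
    have e: "x \<in> colliding a b (Suc m)" "first_collision a b (Suc m) x \<le> h" "y i \<in> V i"
      using elim i(1) by (auto simp: Let_def x_def y_def)
    then have "y i \<in> after_collision a b (Suc m) x \<inter> A"
      using i(1) by (auto simp: V_def after_collision_def y_def)
    then show ?case using e by (auto simp: Let_def x_def)
  qed
qed

end

section \<open>The collided configuration is uniform\<close>

lemma measurable_near_face [measurable]:
  assumes "p \<le> Suc m"
  shows "(\<lambda>(z, r). near_face a b m p h z r) \<in> Leb m \<Otimes>\<^sub>M lborel \<rightarrow>\<^sub>M Leb (Suc m)"
proof -
  have "(\<lambda>q. (fst q, pad a b m (fst q) p + inserted_side (Suc m) p * h * snd q)) \<in> Leb m \<Otimes>\<^sub>M lborel \<rightarrow>\<^sub>M Leb m \<Otimes>\<^sub>M lborel"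
    by measurable
  from measurable_compose[OF this measurable_ins[OF inserted_index_range[OF assms]]]
  show ?thesis by (simp add: near_face_def case_prod_beta)
qed

text \<open>
  In the coordinates \<open>(z, r)\<close> volume is \<open>h dr dz\<close>.
\<close>

lemma emeasure_near_face:
  assumes p: "p \<le> Suc m" and W [measurable]: "W \<in> sets (Leb (Suc m))" and h: "0 < h"
  shows "ennreal h * (\<integral>\<^sup>+z. \<integral>\<^sup>+r. indicator W (near_face a b m p h z r) \<partial>lborel \<partial>Leb m) = emeasure (Leb (Suc m)) W"
proof -
  note k = inserted_index_range[OF p]
  note measurable_ins[OF k, measurable] measurable_near_face[OF p, measurable]
  have m: "(\<lambda>z. \<integral>\<^sup>+r. indicator W (near_face a b m p h z r) \<partial>lborel) \<in> borel_measurable (Leb m)"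
  proof (rule lborel.borel_measurable_nn_integral)
    have "(\<lambda>q. indicator W (case q of (z, r) \<Rightarrow> near_face a b m p h z r) :: ennreal) \<in> borel_measurable (Leb m \<Otimes>\<^sub>M lborel)"
      by measurable
    then show "(\<lambda>(z, r). indicator W (near_face a b m p h z r) :: ennreal) \<in> borel_measurable (Leb m \<Otimes>\<^sub>M lborel)"
      by (simp add: case_prod_beta)
  qed
  have "emeasure (Leb (Suc m)) W = (\<integral>\<^sup>+x. indicator W x \<partial>Leb (Suc m))" by simp
  also have "\<dots> = (\<integral>\<^sup>+z. \<integral>\<^sup>+y. indicator W (ins m (inserted_index (Suc m) p) z y) \<partial>lborel \<partial>Leb m)"
    by (rule nn_integral_ins[OF k]) simp
  also have "\<dots> = (\<integral>\<^sup>+z. ennreal h * (\<integral>\<^sup>+r. indicator W (near_face a b m p h z r) \<partial>lborel) \<partial>Leb m)"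
  proof (rule nn_integral_cong)
    fix z assume z: "z \<in> space (Leb m)"
    have "(\<lambda>y. (z, y)) \<in> lborel \<rightarrow>\<^sub>M Leb m \<Otimes>\<^sub>M lborel" using z by measurable
    from measurable_compose[OF this measurable_ins[OF k]]
    have [measurable]: "(\<lambda>y. ins m (inserted_index (Suc m) p) z y) \<in> borel \<rightarrow>\<^sub>M Leb (Suc m)" by simp
    have c: "inserted_side (Suc m) p * h \<noteq> 0" "\<bar>inserted_side (Suc m) p * h\<bar> = h"
      using h by (auto simp: inserted_side_def)
    have "(\<integral>\<^sup>+y. indicator W (ins m (inserted_index (Suc m) p) z y) \<partial>lborel)
      = ennreal \<bar>inserted_side (Suc m) p * h\<bar> *
        (\<integral>\<^sup>+r. indicator W (ins m (inserted_index (Suc m) p) z (pad a b m z p + inserted_side (Suc m) p * h * r)) \<partial>lborel)"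
      by (rule nn_integral_real_affine[OF _ c(1)]) measurable
    then show "(\<integral>\<^sup>+y. indicator W (ins m (inserted_index (Suc m) p) z y) \<partial>lborel)
      = ennreal h * (\<integral>\<^sup>+r. indicator W (near_face a b m p h z r) \<partial>lborel)"
      unfolding c(2) near_face_def .
  qed
  also have "\<dots> = ennreal h * (\<integral>\<^sup>+z. \<integral>\<^sup>+r. indicator W (near_face a b m p h z r) \<partial>lborel \<partial>Leb m)"
    by (rule nn_integral_cmult[OF m])
  finally show ?thesis by simp
qed

lemma flux_nonneg:
  assumes "z \<in> ordered_simplex a b m" "p \<le> Suc m"
  shows "0 \<le> flux (Suc m) (pad a b m z) p"
  using increasing_less[OF simplexD(2)[OF assms(1)], of "p - 1" "min (Suc p) (Suc m)"] assms(2)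
  by (simp add: flux_eq less_imp_le)

lemma sets_colliding_into [measurable]:
  assumes "E \<in> sets (config_space {a..b})"
  shows "{x \<in> colliding a b n. after_collision a b n x \<in> E} \<in> sets (Leb n)"
proof -
  have "{x \<in> space (restrict_space (Leb n) (colliding a b n)). after_collision a b n x \<in> E}
      \<in> sets (restrict_space (Leb n) (colliding a b n))"
    using assms by measurable
  then show ?thesis by (subst (asm) sets_restrict_space_iff) (auto simp: space_colliding)
qed

lemma emeasure_early_collision:
  assumes E: "E \<in> sets (config_space {a..b})" and h: "0 \<le> h" and fin: "0 < n" "a < b"
  defines "c \<equiv> measure (collided_volume a b n) E"
  shows "{x \<in> colliding a b n. after_collision a b n x \<in> E \<and> first_collision a b n x \<le> h} \<in> sets (Leb n)"
    and "emeasure (Leb n) {x \<in> colliding a b n. after_collision a b n x \<in> E \<and> first_collision a b n x \<le> h}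
      \<le> ennreal (2 * real n * h * c)"
proof -
  interpret C: finite_measure "collided_volume a b n"
    by standard (simp add: emeasure_collided_volume_space[OF fin])
  let ?E = "{x \<in> colliding a b n. after_collision a b n x \<in> E}"
  have late: "{x \<in> colliding a b n. h < first_collision a b n x \<and> after_collision a b n x \<in> E} = ?E \<inter> alive a b n h"
    using collidingD(4)[of _ a b n h] by blast
  have early: "{x \<in> colliding a b n. after_collision a b n x \<in> E \<and> first_collision a b n x \<le> h} = ?E - ?E \<inter> alive a b n h"
    unfolding late[symmetric] by auto
  show "{x \<in> colliding a b n. after_collision a b n x \<in> E \<and> first_collision a b n x \<le> h} \<in> sets (Leb n)"
    unfolding early using E by measurable
  have c: "emeasure (Leb n) ?E = ennreal c" "0 \<le> c"
    unfolding emeasure_collided_volume[OF E, symmetric] c_def by (simp_all add: C.emeasure_eq_measure)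
  let ?q = "exp (- (2 * h * real n))"
  have l: "emeasure (Leb n) (?E \<inter> alive a b n h) = ennreal (?q * c)"
    using emeasure_late_collision[OF E h, of n] c unfolding late by (simp add: ennreal_mult)
  have "emeasure (Leb n) (?E - ?E \<inter> alive a b n h) = ennreal c - ennreal (?q * c)"
    unfolding c(1)[symmetric] l[symmetric] by (rule emeasure_Diff) (use E l in auto)
  also have "\<dots> = ennreal (c - ?q * c)" using c by (intro ennreal_minus) simp
  also have "\<dots> \<le> ennreal (2 * real n * h * c)"
  proof (rule ennreal_leI)
    \<comment> \<open>\<open>1 - exp (- x) \<le> x\<close>, sharp to first order in \<open>h\<close>\<close>
    have "1 - ?q \<le> 2 * real n * h" using exp_ge_add_one_self[of "- (2 * h * real n)"] by (simp add: mult.commute mult.left_commute)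
    then have "(1 - ?q) * c \<le> 2 * real n * h * c" using c(2) by (rule mult_right_mono)
    then show "c - ?q * c \<le> 2 * real n * h * c" by (simp add: left_diff_distrib)
  qed
  finally show "emeasure (Leb n) {x \<in> colliding a b n. after_collision a b n x \<in> E \<and> first_collision a b n x \<le> h}
      \<le> ennreal (2 * real n * h * c)" unfolding early .
qed

text \<open>
  A lower bound for the collided volume from the tuples that collide before a small time \<open>h\<close>:
  near each face parametrize them by the collided tuple \<open>z\<close> and the rescaled gap \<open>r\<close>. As
  \<open>h \<rightarrow> 0\<close>, all \<open>r\<close> below the flux at \<open>z\<close> contribute, by Fatou's lemma.
\<close>

lemma collided_volume_lower_bound:
  assumes ab: "a < b" and E [measurable]: "E \<in> sets (config_space {a..b})"
    and ev: "\<And>z p r. z \<in> ordered_simplex a b m \<Longrightarrow> z ` {1..m} \<in> E \<Longrightarrow> p \<le> Suc m \<Longrightarrow> 0 < r \<Longrightarrow>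
      r < flux (Suc m) (pad a b m z) p \<Longrightarrow>
      \<forall>\<^sub>F h in at_right 0. let x = near_face a b m p h z r in
        x \<in> colliding a b (Suc m) \<and> first_collision a b (Suc m) x \<le> h \<and> after_collision a b (Suc m) x \<in> E"
  shows "(b - a) * measure (Leb m) {z \<in> ordered_simplex a b m. z ` {1..m} \<in> E}
    \<le> real (Suc m) * measure (collided_volume a b (Suc m)) E"
proof -
  define n where "n = Suc m"
  have n: "0 < n" by (simp add: n_def)
  define c where "c = measure (collided_volume a b n) E"
  define D where "D = {z \<in> ordered_simplex a b m. z ` {1..m} \<in> E}"
  have "D = ordered_simplex a b m \<inter> {z \<in> space (Leb m). points a b m z \<in> E}"
    using points_simplex simplexD(1) by (auto simp: D_def)
  then have D [measurable]: "D \<in> sets (Leb m)" by simp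
  define X where "X x i = pad a b n x (Suc i) - pad a b n x i" for x i
  define W where "W p h = {x \<in> colliding a b n. after_collision a b n x \<in> E \<and> first_collision a b n x \<le> h}
      \<inter> {x \<in> space (Leb n). \<forall>i\<le>n. i \<noteq> p \<longrightarrow> X x p < X x i}" for p and h :: real
  have W [measurable]: "W p h \<in> sets (Leb n)" if "0 \<le> h" for p h
    unfolding W_def X_def by (intro sets.Int emeasure_early_collision(1)[OF E that n ab]) measurable
  define \<phi> :: "nat \<Rightarrow> (nat \<Rightarrow> real) \<Rightarrow> real \<Rightarrow> ennreal"
    where "\<phi> j z r = (\<Sum>p\<le>n. indicator (W p (inverse (real (Suc j)))) (near_face a b m p (inverse (real (Suc j))) z r))" for j z r
  define g :: "nat \<Rightarrow> nat \<Rightarrow> (nat \<Rightarrow> real) \<Rightarrow> real \<Rightarrow> ennreal"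
    where "g j p z r = indicator (W p (inverse (real (Suc j)))) (near_face a b m p (inverse (real (Suc j))) z r)" for j p z r
  have g: "(\<lambda>(z, r). g j p z r) \<in> borel_measurable (Leb m \<Otimes>\<^sub>M lborel)" if "p \<le> n" for j p
  proof -
    have "W p (inverse (real (Suc j))) \<in> sets (Leb (Suc m))" using W[of "inverse (real (Suc j))" p] by (simp add: n_def)
    then have "(\<lambda>q. indicator (W p (inverse (real (Suc j)))) (case q of (z, r) \<Rightarrow> near_face a b m p (inverse (real (Suc j))) z r) :: ennreal)
        \<in> borel_measurable (Leb m \<Otimes>\<^sub>M lborel)"
      by (intro measurable_compose[OF measurable_near_face borel_measurable_indicator]) (use that in \<open>simp add: n_def\<close>)
    then show ?thesis by (simp add: g_def case_prod_beta)
  qed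
  have g1: "g j p z \<in> borel_measurable lborel" if "p \<le> n" "z \<in> space (Leb m)" for j p z
    using measurable_compose[OF measurable_Pair1'[OF that(2)] g[OF that(1), of j]] by simp
  have g2: "(\<lambda>z. \<integral>\<^sup>+r. g j p z r \<partial>lborel) \<in> borel_measurable (Leb m)" if "p \<le> n" for j p
    by (rule lborel.borel_measurable_nn_integral[OF g[OF that]])
  have \<phi>g: "\<phi> j z r = (\<Sum>p\<le>n. g j p z r)" for j z r by (simp add: \<phi>_def g_def)
  have \<phi>1: "\<phi> j z \<in> borel_measurable lborel" if "z \<in> space (Leb m)" for j z
    unfolding \<phi>g using g1[OF _ that] by (intro borel_measurable_sum) auto
  have \<phi>s: "(\<integral>\<^sup>+r. \<phi> j z r \<partial>lborel) = (\<Sum>p\<le>n. \<integral>\<^sup>+r. g j p z r \<partial>lborel)" if "z \<in> space (Leb m)" for j z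
    unfolding \<phi>g using g1[OF _ that] by (intro nn_integral_sum) auto
  have \<phi>2: "(\<lambda>z. \<integral>\<^sup>+r. \<phi> j z r \<partial>lborel) \<in> borel_measurable (Leb m)" for j
    using g2 by (subst measurable_cong[OF \<phi>s]) (auto intro!: borel_measurable_sum)
  have upper: "(\<integral>\<^sup>+z. \<integral>\<^sup>+r. \<phi> j z r \<partial>lborel \<partial>Leb m) \<le> ennreal (2 * real n * c)" for j
  proof -
    define h where "h = inverse (real (Suc j))"
    have h: "0 < h" by (simp add: h_def)
    have "ennreal h * (\<integral>\<^sup>+z. \<integral>\<^sup>+r. \<phi> j z r \<partial>lborel \<partial>Leb m)
      = ennreal h * (\<Sum>p\<le>n. \<integral>\<^sup>+z. \<integral>\<^sup>+r. g j p z r \<partial>lborel \<partial>Leb m)"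
      using g2 by (subst nn_integral_sum[symmetric]) (auto simp: \<phi>s cong: nn_integral_cong)
    also have "\<dots> = (\<Sum>p\<le>n. emeasure (Leb n) (W p h))"
      unfolding sum_distrib_left
    proof (rule sum.cong[OF refl])
      fix p assume "p \<in> {..n}"
      then have "p \<le> Suc m" by (simp add: n_def)
      moreover have "W p h \<in> sets (Leb (Suc m))" using W[of h p] h by (simp add: n_def)
      ultimately show "ennreal h * (\<integral>\<^sup>+z. \<integral>\<^sup>+r. g j p z r \<partial>lborel \<partial>Leb m) = emeasure (Leb n) (W p h)"
        using emeasure_near_face[of p m "W p h" h a b] h unfolding g_def h_def[symmetric] n_def by simp
    qed
    also have "\<dots> = emeasure (Leb n) (\<Union>p\<in>{..n}. W p h)"
    proof (rule sum_emeasure)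
      show "disjoint_family_on (\<lambda>p. W p h) {..n}"
        unfolding disjoint_family_on_def
      proof (intro ballI impI)
        fix p q assume "p \<in> {..n}" "q \<in> {..n}" "p \<noteq> q"
        then have "X x p < X x q" if "x \<in> W p h" for x using that by (simp add: W_def)
        moreover have "X x q < X x p" if "x \<in> W q h" for x
          using that \<open>p \<in> _\<close> \<open>p \<noteq> q\<close> by (simp add: W_def)
        ultimately have "\<not> (x \<in> W p h \<and> x \<in> W q h)" for x by fastforce
        then show "W p h \<inter> W q h = {}" by blast
      qed
    qed (use W[of h] h in auto)
    also have "\<dots> \<le> emeasure (Leb n) {x \<in> colliding a b n. after_collision a b n x \<in> E \<and> first_collision a b n x \<le> h}"
      by (rule emeasure_mono) (use emeasure_early_collision(1)[OF E _ n ab, of h] h in \<open>auto simp: W_def\<close>)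
    also have "\<dots> \<le> ennreal (2 * real n * h * c)"
      unfolding c_def by (rule emeasure_early_collision(2)[OF E _ n ab]) (use h in simp)
    finally have "ennreal (inverse h) * (ennreal h * (\<integral>\<^sup>+z. \<integral>\<^sup>+r. \<phi> j z r \<partial>lborel \<partial>Leb m))
        \<le> ennreal (inverse h) * ennreal (2 * real n * h * c)"
      by (rule mult_left_mono) simp
    also have "\<dots> = ennreal (2 * real n * c)"
      using h by (subst ennreal_mult[symmetric]) (auto simp: c_def)
    also have "ennreal (inverse h) * (ennreal h * (\<integral>\<^sup>+z. \<integral>\<^sup>+r. \<phi> j z r \<partial>lborel \<partial>Leb m))
        = (\<integral>\<^sup>+z. \<integral>\<^sup>+r. \<phi> j z r \<partial>lborel \<partial>Leb m)"
      using h by (simp add: mult.assoc[symmetric] ennreal_mult[symmetric])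
    finally show ?thesis .
  qed
  have lim: "filterlim (\<lambda>j. inverse (real (Suc j))) (at_right 0) sequentially"
    by (intro tendsto_imp_filterlim_at_right LIMSEQ_inverse_real_of_nat) auto
  have lower: "(\<Sum>p\<le>n. indicator {0<..<flux n (pad a b m z) p} r) \<le> liminf (\<lambda>j. \<phi> j z r)" if z: "z \<in> D" for z r
  proof (rule Liminf_bounded)
    have "\<forall>\<^sub>F j in sequentially. indicator {0<..<flux n (pad a b m z) p} r \<le> g j p z r" if p: "p \<in> {..n}" for p
    proof (cases "r \<in> {0<..<flux n (pad a b m z) p}")
      case True
      have zs: "z \<in> ordered_simplex a b m" "z ` {1..m} \<in> E" and r: "0 < r" "r < flux (Suc m) (pad a b m z) p"
        and p: "p \<le> Suc m" using z True p by (auto simp: D_def n_def)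
      have "\<forall>\<^sub>F h in at_right 0. near_face a b m p h z r \<in> W p h"
        using ev[OF zs p r] eventually_smallest_gap[OF ab p zs(1) r]
      proof eventually_elim
        case (elim h)
        then show ?case using collidingD(2) by (auto simp: W_def X_def n_def Let_def)
      qed
      then have "\<forall>\<^sub>F j in sequentially. near_face a b m p (inverse (real (Suc j))) z r \<in> W p (inverse (real (Suc j)))"
        using lim by (rule eventually_compose_filterlim)
      then show ?thesis by eventually_elim (simp add: g_def indicator_def)
    qed simp
    then have "\<forall>\<^sub>F j in sequentially. \<forall>p\<in>{..n}. indicator {0<..<flux n (pad a b m z) p} r \<le> g j p z r"
      by (intro eventually_ball_finite) auto
    then show "\<forall>\<^sub>F j in sequentially. (\<Sum>p\<le>n. indicator {0<..<flux n (pad a b m z) p} r) \<le> \<phi> j z r"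
      unfolding \<phi>g by eventually_elim (auto intro!: sum_mono)
  qed
  have "ennreal (2 * (b - a)) * emeasure (Leb m) D = (\<integral>\<^sup>+z. ennreal (2 * (b - a)) * indicator D z \<partial>Leb m)"
    by (rule nn_integral_cmult_indicator[symmetric]) (rule D)
  also have "\<dots> \<le> (\<integral>\<^sup>+z. liminf (\<lambda>j. \<integral>\<^sup>+r. \<phi> j z r \<partial>lborel) \<partial>Leb m)"
  proof (rule nn_integral_mono)
    fix z assume zs: "z \<in> space (Leb m)"
    show "ennreal (2 * (b - a)) * indicator D z \<le> liminf (\<lambda>j. \<integral>\<^sup>+r. \<phi> j z r \<partial>lborel)"
    proof (cases "z \<in> D")
      case True
      then have z: "z \<in> ordered_simplex a b m" by (simp add: D_def)
      have "ennreal (2 * (b - a)) = ennreal (\<Sum>p\<le>n. flux n (pad a b m z) p)"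
        unfolding sum_flux[OF n] by (simp add: pad_def n_def)
      also have "\<dots> = (\<Sum>p\<le>n. ennreal (flux n (pad a b m z) p))"
        by (rule sum_ennreal[symmetric]) (use flux_nonneg[OF z] in \<open>auto simp: n_def\<close>)
      also have "\<dots> = (\<Sum>p\<le>n. \<integral>\<^sup>+r. indicator {0<..<flux n (pad a b m z) p} r \<partial>lborel)"
        by (intro sum.cong refl) (use flux_nonneg[OF z] in \<open>auto simp: n_def\<close>)
      also have "\<dots> = (\<integral>\<^sup>+r. (\<Sum>p\<le>n. indicator {0<..<flux n (pad a b m z) p} r) \<partial>lborel)"
        by (rule nn_integral_sum[symmetric]) simp
      also have "\<dots> \<le> (\<integral>\<^sup>+r. liminf (\<lambda>j. \<phi> j z r) \<partial>lborel)"
        by (rule nn_integral_mono) (rule lower[OF True])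
      also have "\<dots> \<le> liminf (\<lambda>j. \<integral>\<^sup>+r. \<phi> j z r \<partial>lborel)"
        by (rule nn_integral_liminf) (rule \<phi>1[OF zs])
      finally show ?thesis using True by simp
    qed simp
  qed
  also have "\<dots> \<le> liminf (\<lambda>j. \<integral>\<^sup>+z. \<integral>\<^sup>+r. \<phi> j z r \<partial>lborel \<partial>Leb m)"
    by (rule nn_integral_liminf) (rule \<phi>2)
  also have "\<dots> \<le> limsup (\<lambda>j. \<integral>\<^sup>+z. \<integral>\<^sup>+r. \<phi> j z r \<partial>lborel \<partial>Leb m)"
    by (rule Liminf_le_Limsup) simp
  also have "\<dots> \<le> ennreal (2 * real n * c)"
    by (rule Limsup_bounded) (rule always_eventually, rule allI, rule upper)
  finally have le: "ennreal (2 * (b - a)) * emeasure (Leb m) D \<le> ennreal (2 * real n * c)" .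
  have "emeasure (Leb m) D \<le> emeasure (Leb m) (ordered_simplex a b m)"
    by (rule emeasure_mono) (auto simp: D_def)
  then have "emeasure (Leb m) D \<noteq> \<top>" using emeasure_simplex[OF ab, of m] by (auto simp: top_unique)
  then have "emeasure (Leb m) D = ennreal (measure (Leb m) D)" by (rule emeasure_eq_ennreal_measure)
  then have "ennreal (2 * (b - a) * measure (Leb m) D) \<le> ennreal (2 * real n * c)"
    using le ab by (simp add: ennreal_mult)
  then have "2 * (b - a) * measure (Leb m) D \<le> 2 * real n * c"
    by (subst (asm) ennreal_le_iff) (auto simp: c_def)
  then have "2 * ((b - a) * measure (Leb m) D) \<le> 2 * (real n * c)" by (simp only: mult.assoc)
  then have "(b - a) * measure (Leb m) D \<le> real n * c" by (rule mult_left_le_imp_le) simp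
  then show ?thesis unfolding D_def c_def n_def .
qed

definition simplex_volume :: "real \<Rightarrow> real \<Rightarrow> nat \<Rightarrow> real set measure" where
  "simplex_volume a b n =
     distr (restrict_space (Leb n) (ordered_simplex a b n)) (config_space {a..b}) (points a b n)"

lemma sets_simplex_volume [measurable_cong]: "sets (simplex_volume a b n) = sets (config_space {a..b})"
  by (simp add: simplex_volume_def)

lemma space_simplex: "space (restrict_space (Leb n) (ordered_simplex a b n)) = ordered_simplex a b n"
  using simplexD(1) by (auto simp: space_restrict_space)

lemma emeasure_simplex_volume:
  assumes "E \<in> sets (config_space {a..b})"
  shows "emeasure (simplex_volume a b n) E = emeasure (Leb n) {x \<in> ordered_simplex a b n. x ` {1..n} \<in> E}"
proof -
  have "points a b n \<in> restrict_space (Leb n) (ordered_simplex a b n) \<rightarrow>\<^sub>M config_space {a..b}"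
    by (rule measurable_restrict_space1) measurable
  then have "emeasure (simplex_volume a b n) E = emeasure (restrict_space (Leb n) (ordered_simplex a b n))
      (points a b n -` E \<inter> ordered_simplex a b n)"
    unfolding simplex_volume_def using assms by (subst emeasure_distr) (auto simp: space_simplex)
  also have "points a b n -` E \<inter> ordered_simplex a b n = {x \<in> ordered_simplex a b n. x ` {1..n} \<in> E}"
    using points_simplex by auto
  finally show ?thesis by (subst (asm) emeasure_restrict_space) auto
qed

lemma emeasure_simplex_volume_space:
  assumes "a < b"
  shows "emeasure (simplex_volume a b n) (space (simplex_volume a b n)) = ennreal ((b - a) ^ n / fact n)"
proof -
  have "{x \<in> ordered_simplex a b n. x ` {1..n} \<in> space (config_space {a..b})} = ordered_simplex a b n"
    using simplexD(3) greaterThanLessThan_subseteq_atLeastAtMost_iff[of a b a b]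
    by (force simp: space_config_space)
  moreover have "space (simplex_volume a b n) = space (config_space {a..b})" by (simp add: simplex_volume_def)
  ultimately show ?thesis using assms by (simp add: emeasure_simplex_volume emeasure_simplex)
qed

lemma decreasing_hit_events:
  fixes A :: "real set"
  assumes A: "closed A" "A \<noteq> {}" and S: "finite S"
  shows "S \<inter> A \<noteq> {} \<longleftrightarrow> (\<forall>k. S \<inter> {x. infdist x A < inverse (real (Suc k))} \<noteq> {})"
proof
  assume "S \<inter> A \<noteq> {}"
  then obtain x where "x \<in> S" "x \<in> A" by blast
  then have "x \<in> S" "infdist x A = 0" by simp_all
  then show "\<forall>k. S \<inter> {x. infdist x A < inverse (real (Suc k))} \<noteq> {}" by (auto intro!: bexI[of _ x])
next
  assume r: "\<forall>k. S \<inter> {x. infdist x A < inverse (real (Suc k))} \<noteq> {}"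
  show "S \<inter> A \<noteq> {}"
  proof
    assume e: "S \<inter> A = {}"
    have "S \<noteq> {}" using r by auto
    define d where "d = Min ((\<lambda>x. infdist x A) ` S)"
    have "d \<in> (\<lambda>x. infdist x A) ` S" unfolding d_def using S \<open>S \<noteq> {}\<close> by (intro Min_in) auto
    then obtain x where x: "x \<in> S" "d = infdist x A" by auto
    then have "x \<notin> A" using e by auto
    then have "infdist x A \<noteq> 0" using in_closed_iff_infdist_zero[OF A] by auto
    then have "0 < d" using x infdist_nonneg[of x A] by simp
    then obtain k where k: "inverse (real (Suc k)) < d" using reals_Archimedean by blast
    obtain y where y: "y \<in> S" "infdist y A < inverse (real (Suc k))" using r by blast
    have "d \<le> infdist y A" unfolding d_def using S y by (intro Min_le) auto
    then show False using y k by simp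
  qed
qed

text \<open>
  The lower bound holds for void events of closed sets and for hitting events of open sets. A
  hitting event of a closed set is the limit of those of its open neighbourhoods, so the bound
  holds for it as well, and as it is complementary to the void event and the total masses agree,
  both bounds are equalities.
\<close>

lemma collided_volume_eq:
  assumes ab: "a < b"
  shows "collided_volume a b (Suc m) = scale_measure (ennreal ((b - a) / real (Suc m))) (simplex_volume a b m)"
    (is "?C = scale_measure (ennreal ?\<kappa>) ?D")
proof (rule config_measure_eqI)
  let ?\<Omega> = "space (config_space {a..b})"
  have \<kappa>: "0 < ?\<kappa>" using ab by simp
  have spC: "space ?C = ?\<Omega>" and spD: "space ?D = ?\<Omega>"
    by (simp_all add: collided_volume_def simplex_volume_def)
  show "sets ?C = sets (config_space {a..b})" "sets (scale_measure (ennreal ?\<kappa>) ?D) = sets (config_space {a..b})"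
    by (simp_all add: sets_collided_volume sets_simplex_volume)
  have totC: "emeasure ?C (space ?C) = ennreal ((b - a) ^ Suc m / fact (Suc m))"
    by (rule emeasure_collided_volume_space) (use ab in auto)
  note totD = emeasure_simplex_volume_space[OF ab, of m]
  show "emeasure ?C (space ?C) \<noteq> \<infinity>" unfolding totC by simp
  interpret C: finite_measure ?C by standard (simp add: totC)
  interpret D: finite_measure ?D by standard (simp add: totD)
  have tot: "measure ?C ?\<Omega> = ?\<kappa> * measure ?D ?\<Omega>"
  proof -
    have "measure ?C ?\<Omega> = (b - a) ^ Suc m / fact (Suc m)" "measure ?D ?\<Omega> = (b - a) ^ m / fact m"
      using totC totD ab by (simp_all add: measure_def spC spD del: power_Suc fact_Suc)
    then show ?thesis by simp
  qed
  have bound: "?\<kappa> * measure ?D E \<le> measure ?C E"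
    if E: "E \<in> sets (config_space {a..b})"
      and "(b - a) * measure (Leb m) {z \<in> ordered_simplex a b m. z ` {1..m} \<in> E} \<le> real (Suc m) * measure ?C E" for E
    using that(2) emeasure_simplex_volume[OF E, of m] by (simp add: measure_def field_simps)
  have hit_sets: "{S \<in> ?\<Omega>. S \<inter> A \<noteq> {}} \<in> sets (config_space {a..b})" if "A \<in> sets borel" for A
  proof -
    have "{S \<in> ?\<Omega>. S \<inter> A \<noteq> {}} = ?\<Omega> - {S \<in> ?\<Omega>. S \<inter> A = {}}" by auto
    then show ?thesis using sets_void_event[OF that, of "{a..b}"] by simp
  qed
  have after: "after_collision a b n x \<in> ?\<Omega>" for n x
    using finite_after_collision[of a b n x] by (auto simp: space_config_space)
  have void: "?\<kappa> * measure ?D {S \<in> ?\<Omega>. S \<inter> A = {}} \<le> measure ?C {S \<in> ?\<Omega>. S \<inter> A = {}}" if A: "closed A" for A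
  proof (rule bound, use A in simp, rule collided_volume_lower_bound[OF ab])
    fix z p r assume "z \<in> ordered_simplex a b m" "z ` {1..m} \<in> {S \<in> ?\<Omega>. S \<inter> A = {}}"
      "p \<le> Suc m" "0 < r" "r < flux (Suc m) (pad a b m z) p"
    then have "\<forall>\<^sub>F h in at_right 0. let x = near_face a b m p h z r in
      x \<in> colliding a b (Suc m) \<and> first_collision a b (Suc m) x \<le> h \<and> after_collision a b (Suc m) x \<inter> A = {}"
      by (intro eventually_void[OF ab _ _ _ _ A]) auto
    then show "\<forall>\<^sub>F h in at_right 0. let x = near_face a b m p h z r in
      x \<in> colliding a b (Suc m) \<and> first_collision a b (Suc m) x \<le> h \<and>
      after_collision a b (Suc m) x \<in> {S \<in> ?\<Omega>. S \<inter> A = {}}"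
      by eventually_elim (simp add: Let_def after)
  qed (use A in simp)
  have hit: "?\<kappa> * measure ?D {S \<in> ?\<Omega>. S \<inter> A \<noteq> {}} \<le> measure ?C {S \<in> ?\<Omega>. S \<inter> A \<noteq> {}}" if A: "open A" for A
  proof (rule bound, use A in \<open>intro hit_sets, simp\<close>, rule collided_volume_lower_bound[OF ab])
    fix z p r assume "z \<in> ordered_simplex a b m" "z ` {1..m} \<in> {S \<in> ?\<Omega>. S \<inter> A \<noteq> {}}"
      "p \<le> Suc m" "0 < r" "r < flux (Suc m) (pad a b m z) p"
    then have "\<forall>\<^sub>F h in at_right 0. let x = near_face a b m p h z r in
      x \<in> colliding a b (Suc m) \<and> first_collision a b (Suc m) x \<le> h \<and> after_collision a b (Suc m) x \<inter> A \<noteq> {}"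
      by (intro eventually_hit[OF ab _ _ _ _ A]) auto
    then show "\<forall>\<^sub>F h in at_right 0. let x = near_face a b m p h z r in
      x \<in> colliding a b (Suc m) \<and> first_collision a b (Suc m) x \<le> h \<and>
      after_collision a b (Suc m) x \<in> {S \<in> ?\<Omega>. S \<inter> A \<noteq> {}}"
      by eventually_elim (simp add: Let_def after)
  qed (use A in \<open>intro hit_sets, simp\<close>)
  fix A :: "real set" assume A: "closed A"
  have hit': "?\<kappa> * measure ?D {S \<in> ?\<Omega>. S \<inter> A \<noteq> {}} \<le> measure ?C {S \<in> ?\<Omega>. S \<inter> A \<noteq> {}}"
  proof (cases "A = {}")
    case False
    define H where "H k = {S \<in> ?\<Omega>. S \<inter> {x. infdist x A < inverse (real (Suc k))} \<noteq> {}}" for k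
    have op: "open {x. infdist x A < inverse (real (Suc k))}" for k
      by (intro open_Collect_less continuous_intros)
    have Hs: "range H \<subseteq> sets (config_space {a..b})"
      unfolding H_def using op by (auto intro!: hit_sets)
    have dec: "decseq H"
    proof (rule decseq_SucI, rule subsetI)
      fix k S assume "S \<in> H (Suc k)"
      then obtain x where x: "S \<in> ?\<Omega>" "x \<in> S" "infdist x A < inverse (real (Suc (Suc k)))" by (auto simp: H_def)
      have "inverse (real (Suc (Suc k))) \<le> inverse (real (Suc k))" by (simp add: field_simps)
      then have "infdist x A < inverse (real (Suc k))" by (rule less_le_trans[OF x(3)])
      then have "S \<in> ?\<Omega>" "x \<in> S \<inter> {x. infdist x A < inverse (real (Suc k))}" using x by simp_all
      then show "S \<in> H k" unfolding H_def by blast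
    qed
    have eq: "{S \<in> ?\<Omega>. S \<inter> A \<noteq> {}} = (\<Inter>k. H k)"
    proof (rule set_eqI)
      fix S show "S \<in> {S \<in> ?\<Omega>. S \<inter> A \<noteq> {}} \<longleftrightarrow> S \<in> (\<Inter>k. H k)"
      proof (cases "S \<in> ?\<Omega>")
        case True
        then have "finite S" by (simp add: space_config_space)
        show ?thesis unfolding H_def using True decreasing_hit_events[OF A False \<open>finite S\<close>] by blast
      next
        case False
        then show ?thesis unfolding H_def by blast
      qed
    qed
    have "(\<lambda>k. measure ?C (H k)) \<longlonglongrightarrow> measure ?C (\<Inter>k. H k)"
      by (rule C.finite_Lim_measure_decseq[OF _ dec]) (use Hs in \<open>simp add: sets_collided_volume\<close>)
    moreover have "(\<lambda>k. ?\<kappa> * measure ?D (H k)) \<longlonglongrightarrow> ?\<kappa> * measure ?D (\<Inter>k. H k)"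
      by (intro tendsto_mult tendsto_const D.finite_Lim_measure_decseq[OF _ dec]) (use Hs in \<open>simp add: sets_simplex_volume\<close>)
    moreover have "?\<kappa> * measure ?D (H k) \<le> measure ?C (H k)" for k
      unfolding H_def by (rule hit[OF op])
    ultimately show ?thesis unfolding eq by (intro LIMSEQ_le[of _ _ _ "measure ?C (\<Inter>k. H k)"]) blast+
  qed simp
  have Ab: "A \<in> sets borel" using A by simp
  have compl: "{S \<in> ?\<Omega>. S \<inter> A \<noteq> {}} = ?\<Omega> - {S \<in> ?\<Omega>. S \<inter> A = {}}" by auto
  have "measure ?C {S \<in> ?\<Omega>. S \<inter> A \<noteq> {}} = measure ?C ?\<Omega> - measure ?C {S \<in> ?\<Omega>. S \<inter> A = {}}"
    "measure ?D {S \<in> ?\<Omega>. S \<inter> A \<noteq> {}} = measure ?D ?\<Omega> - measure ?D {S \<in> ?\<Omega>. S \<inter> A = {}}"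
    unfolding compl using C.finite_measure_compl[of "{S \<in> ?\<Omega>. S \<inter> A = {}}"] D.finite_measure_compl[of "{S \<in> ?\<Omega>. S \<inter> A = {}}"]
      sets_void_event[OF Ab, of "{a..b}"] by (simp_all add: spC spD sets_collided_volume sets_simplex_volume)
  then have "measure ?C {S \<in> ?\<Omega>. S \<inter> A = {}} = ?\<kappa> * measure ?D {S \<in> ?\<Omega>. S \<inter> A = {}}"
    using hit' void[OF A] tot by (simp add: right_diff_distrib)
  then show "emeasure ?C {S \<in> space ?C. S \<inter> A = {}} =
      emeasure (scale_measure (ennreal ?\<kappa>) ?D) {S \<in> space (scale_measure (ennreal ?\<kappa>) ?D). S \<inter> A = {}}"
    using \<kappa> by (simp add: spC spD space_scale_measure C.emeasure_eq_measure D.emeasure_eq_measure ennreal_mult[symmetric] del: of_nat_Suc)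
qed

section \<open>Measurability of the coarsening map\<close>

text \<open>
  The ordered tuple of a finite set, the inverse of taking the set of coordinates.
\<close>

definition svec :: "real set \<Rightarrow> nat \<Rightarrow> real" where
  "svec S = (\<lambda>i\<in>{1..card S}. sorted_list_of_set S ! (i - 1))"

lemma svec_image:
  assumes "finite S"
  shows "svec S ` {1..card S} = S"
proof -
  have "svec S ` {1..card S} = (\<lambda>i. sorted_list_of_set S ! i) ` ((\<lambda>i. i - 1) ` {1..card S})"
    by (auto simp: svec_def image_image)
  also have "(\<lambda>i. i - 1) ` {1..card S} = {0..<card S}"
  proof (rule set_eqI)
    fix j show "j \<in> (\<lambda>i. i - 1) ` {1..card S} \<longleftrightarrow> j \<in> {0..<card S}"
      by (auto intro!: image_eqI[of _ _ "Suc j"] simp: One_nat_def)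
  qed
  also have "(\<lambda>i. sorted_list_of_set S ! i) ` {0..<card S} = set (sorted_list_of_set S)"
    using nth_image[of "card S" "sorted_list_of_set S"] by simp
  finally show ?thesis using assms by simp
qed

lemma svec_in_simplex:
  assumes S: "finite S" "S \<subseteq> {a<..<b}" and ab: "a < b"
  shows "svec S \<in> ordered_simplex a b (card S)"
proof -
  let ?n = "card S" and ?xs = "sorted_list_of_set S"
  have len: "length ?xs = ?n" by simp
  have nth: "?xs ! i \<in> {a<..<b}" if "i < ?n" for i
    using nth_mem[of i ?xs] that S by auto
  have mono: "?xs ! i < ?xs ! j" if "i < j" "j < ?n" for i j
    using sorted_wrt_nth_less[OF strict_sorted_list_of_set that(1)] that(2) by simp
  have pad: "pad a b ?n (svec S) i = (if i = 0 then a else if i \<le> ?n then ?xs ! (i - 1) else b)" for i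
    by (auto simp: pad_def svec_def)
  have "pad a b ?n (svec S) i < pad a b ?n (svec S) (Suc i)" if i: "i \<le> ?n" for i
  proof -
    consider "i = 0" "?n = 0" | "i = 0" "0 < ?n" | "0 < i" "i < ?n" | "0 < i" "i = ?n" using i by linarith
    then show ?thesis
    proof cases
      case 1 then show ?thesis using ab by (simp add: pad_def)
    next
      case 2 then show ?thesis using nth[of 0] by (simp add: pad)
    next
      case 3 then show ?thesis using mono[of "i - 1" i] by (simp add: pad)
    next
      case 4 then show ?thesis using nth[of "i - 1"] by (simp add: pad)
    qed
  qed
  then show ?thesis by (auto simp: ordered_simplex_def increasing_upto_def space_PiM svec_def)
qed

text \<open>
  Order statistics are determined by counts, which makes \<^const>\<open>svec\<close> measurable.
\<close>

lemma svec_le_iff: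
  assumes S: "finite S" and i: "i \<in> {1..card S}"
  shows "svec S i \<le> y \<longleftrightarrow> i \<le> card (S \<inter> {..y})"
proof -
  let ?xs = "sorted_list_of_set S"
  have len: "length ?xs = card S" by simp
  have sx: "svec S i = ?xs ! (i - 1)" using i by (simp add: svec_def)
  have mono: "?xs ! j \<le> ?xs ! k" if "j \<le> k" "k < card S" for j k
    using sorted_nth_mono[OF sorted_sorted_list_of_set that(1)] that(2) by simp
  have card_take: "card (set (take k ?xs)) = k" if "k \<le> card S" for k
    using that by (simp add: distinct_card)
  have set_take: "x \<in> set (take k ?xs) \<longleftrightarrow> (\<exists>j<k. j < card S \<and> x = ?xs ! j)" for x k
    by (auto simp: in_set_conv_nth)
  show ?thesis
  proof
    assume "svec S i \<le> y"
    then have le: "?xs ! (i - 1) \<le> y" by (simp add: sx)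
    have "set (take i ?xs) \<subseteq> S \<inter> {..y}"
    proof
      fix x assume "x \<in> set (take i ?xs)"
      then obtain j where j: "j < i" "j < card S" "x = ?xs ! j" using set_take by blast
      have "j \<le> i - 1" using j by simp
      then have "x \<le> ?xs ! (i - 1)" unfolding j(3) by (rule mono) (use i in auto)
      moreover have "x \<in> S" using nth_mem[of j ?xs] j S by simp
      ultimately show "x \<in> S \<inter> {..y}" using le by simp
    qed
    then have "card (set (take i ?xs)) \<le> card (S \<inter> {..y})" using S by (intro card_mono) auto
    then show "i \<le> card (S \<inter> {..y})" using card_take[of i] i by simp
  next
    assume c: "i \<le> card (S \<inter> {..y})"
    show "svec S i \<le> y"
    proof (rule ccontr)
      assume "\<not> svec S i \<le> y"
      then have gt: "y < ?xs ! (i - 1)" by (simp add: sx)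
      have "S \<inter> {..y} \<subseteq> set (take (i - 1) ?xs)"
      proof
        fix x assume x: "x \<in> S \<inter> {..y}"
        then have "x \<in> set ?xs" using S by simp
        then obtain j where j: "j < card S" "x = ?xs ! j" by (auto simp: in_set_conv_nth)
        have "j < i - 1"
        proof (rule ccontr)
          assume "\<not> j < i - 1"
          then have "?xs ! (i - 1) \<le> x" unfolding j(2) by (intro mono j(1)) simp
          then show False using gt x by simp
        qed
        then show "x \<in> set (take (i - 1) ?xs)" using set_take j by blast
      qed
      then have "card (S \<inter> {..y}) \<le> card (set (take (i - 1) ?xs))" by (intro card_mono) auto
      also have "\<dots> = i - 1" by (rule card_take) (use i in auto)
      finally show False using c i by auto
    qed
  qed
qed

lemma coarsen_inside: "coarsen a b t S = coarsen a b t (S \<inter> {a<..<b})"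
  by (simp add: coarsen_def)

lemma coarsen_config:
  assumes "finite S" "S \<subseteq> {a<..<b}" "a < b" "0 \<le> t"
  shows "coarsen a b t S = (let n = card S; x = svec S; \<tau> = first_collision a b n x in
    if increasing_upto n (heat n (- t) (pad a b n x)) then heat n (- t) (pad a b n x) ` {1..n}
    else coarsen a b (t - \<tau>) (after_collision a b n x))"
proof -
  let ?n = "card S" and ?x = "svec S"
  note x = simplexD(2)[OF svec_in_simplex[OF assms(1,2,3)]]
  show ?thesis
  proof (cases "increasing_upto ?n (heat ?n (- t) (pad a b ?n ?x))")
    case True
    from coarsen_alive[OF x assms(4,3) True, unfolded svec_image[OF assms(1)]] show ?thesis
      using True unfolding Let_def by (simp only: if_True)
  next
    case False
    from coarsen_collision[OF x assms(4,3) False, unfolded svec_image[OF assms(1)]] show ?thesis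
      using False unfolding Let_def by (simp only: if_False)
  qed
qed

lemma coarsen_empty:
  assumes "a < b" "0 \<le> t"
  shows "coarsen a b t {} = {}"
proof -
  have "increasing_upto 0 (heat 0 (- t) (pad a b 0 x))" for x
    using assms(1) by (simp add: increasing_upto_def heat_end pad_def)
  then show ?thesis
    using coarsen_config[of "{}" a b t] assms unfolding Let_def by (simp add: One_nat_def)
qed

lemma measurable_svec:
  "(\<lambda>S. svec (S \<inter> {a<..<b})) \<in> restrict_space (config_space B) {S. card (S \<inter> {a<..<b}) = n} \<rightarrow>\<^sub>M Leb n"
proof -
  let ?M = "restrict_space (config_space B) {S. card (S \<inter> {a<..<b}) = n}"
  have sp: "finite S" "card (S \<inter> {a<..<b}) = n" if "S \<in> space ?M" for S
    using that by (auto simp: space_restrict_space space_config_space)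
  have "(\<lambda>S. restrict (\<lambda>i. svec (S \<inter> {a<..<b}) i) {1..n}) \<in> ?M \<rightarrow>\<^sub>M Leb n"
  proof (rule measurable_into_Leb, rule borel_measurableI_le)
    fix i y assume i: "i \<in> {1..n}"
    have "{S \<in> space ?M. svec (S \<inter> {a<..<b}) i \<le> y} = {S \<in> space ?M. i \<le> card (S \<inter> ({a<..<b} \<inter> {..y}))}"
    proof (rule Collect_cong, rule conj_cong[OF refl])
      fix S assume S: "S \<in> space ?M"
      show "svec (S \<inter> {a<..<b}) i \<le> y \<longleftrightarrow> i \<le> card (S \<inter> ({a<..<b} \<inter> {..y}))"
        using svec_le_iff[of "S \<inter> {a<..<b}" i y] sp[OF S] i by (simp add: Int_assoc)
    qed
    also have "\<dots> \<in> sets ?M"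
    proof -
      have "(\<lambda>S. card (S \<inter> ({a<..<b} \<inter> {..y}))) \<in> ?M \<rightarrow>\<^sub>M count_space UNIV"
        by (rule measurable_restrict_space1) measurable
      then have "(\<lambda>S. card (S \<inter> ({a<..<b} \<inter> {..y}))) -` {i..} \<inter> space ?M \<in> sets ?M"
        by (rule measurable_sets) simp
      then show ?thesis by (simp add: vimage_def Int_def conj_commute)
    qed
    finally show "{S \<in> space ?M. svec (S \<inter> {a<..<b}) i \<le> y} \<in> sets ?M" .
  qed
  also have "?this \<longleftrightarrow> ?thesis"
  proof (rule measurable_cong)
    fix S assume "S \<in> space ?M"
    then have "card (S \<inter> {a<..<b}) = n" by (rule sp)
    then show "restrict (\<lambda>i. svec (S \<inter> {a<..<b}) i) {1..n} = svec (S \<inter> {a<..<b})"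
      by (auto simp: svec_def fun_eq_iff)
  qed
  finally show ?thesis .
qed

text \<open>
  \<^const>\<open>coarsen\<close> on configurations with at most \<open>n\<close> points, by recursion along the collisions.
\<close>

lemma measurable_coarsen_upto:
  assumes ab: "a < b"
  shows "(\<lambda>q. if card (snd q \<inter> {a<..<b}) \<le> n then coarsen a b (max 0 (fst q)) (snd q) else {})
    \<in> borel \<Otimes>\<^sub>M config_space {a..b} \<rightarrow>\<^sub>M config_space {a..b}"
proof (induction n)
  case 0
  have eq: "(if card (snd q \<inter> {a<..<b}) \<le> 0 then coarsen a b (max 0 (fst q)) (snd q) else {}) = {}"
    if "q \<in> space (borel \<Otimes>\<^sub>M config_space {a..b})" for q :: "real \<times> real set"
  proof (cases "card (snd q \<inter> {a<..<b}) \<le> 0")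
    case True
    have "finite (snd q)" using that by (auto simp: space_pair_measure space_config_space)
    then have "snd q \<inter> {a<..<b} = {}" using True by auto
    then show ?thesis
      using coarsen_inside[of a b "max 0 (fst q)" "snd q"] coarsen_empty[OF ab, of "max 0 (fst q)"] by simp
  qed simp
  have "(\<lambda>q :: real \<times> real set. {}) \<in> borel \<Otimes>\<^sub>M config_space {a..b} \<rightarrow>\<^sub>M config_space {a..b}"
    by (rule measurable_const) (simp add: space_config_space)
  then show ?case by (subst measurable_cong[OF eq])
next
  case (Suc n)
  let ?N = "Suc n"
  let ?P = "borel \<Otimes>\<^sub>M config_space {a..b} :: (real \<times> real set) measure"
  let ?c = "\<lambda>q :: real \<times> real set. card (snd q \<inter> {a<..<b})"
  define G where "G q = (if ?c q \<le> n then coarsen a b (max 0 (fst q)) (snd q) else {})" for q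
  have G [measurable]: "G \<in> ?P \<rightarrow>\<^sub>M config_space {a..b}" using Suc unfolding G_def .
  have [measurable]: "?c \<in> ?P \<rightarrow>\<^sub>M count_space UNIV"
    by (rule measurable_compose[OF measurable_snd measurable_card_Int]) simp
  define V where "V q = svec (snd q \<inter> {a<..<b})" for q :: "real \<times> real set"
  define C where "C = {q. ?c q = ?N}"
  define Al where "Al = {q. increasing_upto ?N (heat ?N (- max 0 (fst q)) (pad a b ?N (V q)))}"
  let ?M1 = "restrict_space ?P C"
  have V1: "V \<in> ?M1 \<rightarrow>\<^sub>M Leb ?N"
  proof -
    have "snd \<in> ?M1 \<rightarrow>\<^sub>M restrict_space (config_space {a..b}) {S. card (S \<inter> {a<..<b}) = ?N}"
      by (rule measurable_restrict_space2)
         (auto simp: C_def space_restrict_space intro: measurable_restrict_space1)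
    from measurable_compose[OF this measurable_svec] show ?thesis by (simp add: V_def[abs_def])
  qed
  have f1 [measurable]: "fst \<in> borel_measurable ?M1"
    by (rule measurable_restrict_space1) measurable
  have h1 [measurable]: "(\<lambda>q. heat ?N (- max 0 (fst q)) (pad a b ?N (V q)) i) \<in> borel_measurable ?M1" for i
    by (rule measurable_heat, intro borel_measurable_uminus borel_measurable_max borel_measurable_const f1)
       (rule measurable_compose[OF V1 measurable_pad])
  have Al1: "{q \<in> space ?M1. q \<in> Al} \<in> sets ?M1"
    unfolding Al_def increasing_upto_def mem_Collect_eq by measurable
  have sC: "q \<in> C \<Longrightarrow> q \<in> space ?P \<Longrightarrow> V q \<in> ordered_simplex a b ?N" for q
    using svec_in_simplex[of "snd q \<inter> {a<..<b}" a b] ab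
    by (auto simp: C_def V_def space_pair_measure space_config_space)
  have alive_branch: "(\<lambda>q. heat ?N (- max 0 (fst q)) (pad a b ?N (V q)) ` {1..?N} \<inter> {a..b}) \<in> ?M1 \<rightarrow>\<^sub>M config_space {a..b}"
  proof (rule measurable_config_spaceI)
    fix A :: "real set" assume "closed A"
    then have [measurable]: "A \<in> sets borel" by simp
    have "{q \<in> space ?M1. heat ?N (- max 0 (fst q)) (pad a b ?N (V q)) ` {1..?N} \<inter> {a..b} \<inter> A = {}}
       = {q \<in> space ?M1. \<forall>i\<in>{1..?N}. heat ?N (- max 0 (fst q)) (pad a b ?N (V q)) i \<notin> {a..b} \<inter> A}"
      by blast
    also have "\<dots> \<in> sets ?M1" by measurable
    finally show "{q \<in> space ?M1. heat ?N (- max 0 (fst q)) (pad a b ?N (V q)) ` {1..?N} \<inter> {a..b} \<inter> A = {}} \<in> sets ?M1" .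
  qed auto
  let ?M2 = "restrict_space ?M1 {q. \<not> q \<in> Al}"
  have V2: "V \<in> ?M2 \<rightarrow>\<^sub>M restrict_space (Leb ?N) (colliding a b ?N)"
  proof (rule measurable_restrict_space2)
    show "V \<in> space ?M2 \<rightarrow> colliding a b ?N"
    proof
      fix q assume q: "q \<in> space ?M2"
      then have "V q \<in> ordered_simplex a b ?N" using sC by (auto simp: space_restrict_space)
      moreover have "\<not> increasing_upto ?N (heat ?N (- max 0 (fst q)) (pad a b ?N (V q)))"
        using q by (simp add: space_restrict_space Al_def)
      ultimately show "V q \<in> colliding a b ?N"
        unfolding colliding_def by (auto intro!: exI[of _ "max 0 (fst q)"])
    qed
  qed (rule measurable_restrict_space1[OF V1])
  have f2 [measurable]: "fst \<in> borel_measurable ?M2" by (rule measurable_restrict_space1[OF f1])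
  have \<tau>2 [measurable]: "(\<lambda>q. first_collision a b ?N (V q)) \<in> borel_measurable ?M2"
    by (rule measurable_compose[OF V2 measurable_first_collision])
  have Z2 [measurable]: "(\<lambda>q. after_collision a b ?N (V q)) \<in> ?M2 \<rightarrow>\<^sub>M config_space {a..b}"
    by (rule measurable_compose[OF V2 measurable_after_collision])
  have dead_branch: "(\<lambda>q. G (max 0 (fst q) - first_collision a b ?N (V q), after_collision a b ?N (V q))) \<in> ?M2 \<rightarrow>\<^sub>M config_space {a..b}"
    by (rule measurable_compose[OF measurable_Pair G]) measurable
  define K where "K q = (if q \<in> Al then heat ?N (- max 0 (fst q)) (pad a b ?N (V q)) ` {1..?N} \<inter> {a..b}
      else G (max 0 (fst q) - first_collision a b ?N (V q), after_collision a b ?N (V q)))" for q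
  have "K \<in> ?M1 \<rightarrow>\<^sub>M config_space {a..b}"
    unfolding K_def
    by (subst measurable_If_restrict_space_iff[OF Al1])
       (intro conjI measurable_restrict_space1[OF alive_branch] dead_branch)
  then have K: "K \<in> restrict_space ?P {q. ?c q = ?N} \<rightarrow>\<^sub>M config_space {a..b}" by (simp add: C_def)
  have "(\<lambda>q. if ?c q = ?N then K q else G q) \<in> ?P \<rightarrow>\<^sub>M config_space {a..b}"
    by (subst measurable_If_restrict_space_iff) (measurable, use K measurable_restrict_space1[OF G] in blast)
  also have "?this \<longleftrightarrow> ?case"
  proof (rule measurable_cong)
    fix q assume q: "q \<in> space ?P"
    show "(if ?c q = ?N then K q else G q) = (if ?c q \<le> ?N then coarsen a b (max 0 (fst q)) (snd q) else {})"
    proof (cases "?c q = ?N")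
      case False
      then show ?thesis by (auto simp: G_def)
    next
      case True
      let ?S = "snd q \<inter> {a<..<b}" and ?t = "max 0 (fst q)"
      have S: "finite ?S" "?S \<subseteq> {a<..<b}" "card ?S = ?N" using q True by (auto simp: space_pair_measure space_config_space)
      have t: "0 \<le> ?t" by simp
      have Vs: "V q \<in> ordered_simplex a b ?N" using sC[of q] q True by (simp add: C_def)
      have co: "coarsen a b ?t (snd q) = (if q \<in> Al then heat ?N (- ?t) (pad a b ?N (V q)) ` {1..?N}
          else coarsen a b (?t - first_collision a b ?N (V q)) (after_collision a b ?N (V q)))"
        unfolding coarsen_inside[of a b ?t "snd q"] coarsen_config[OF S(1,2) ab t] S(3)
        by (simp add: Let_def Al_def V_def)
      show ?thesis
      proof (cases "q \<in> Al")
        case alive: True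
        have "heat ?N (- ?t) (pad a b ?N (V q)) ` {1..?N} \<subseteq> {a..b}"
        proof -
          have "heat_map a b ?N (- ?t) (V q) \<in> ordered_simplex a b ?N"
            using alive Vs by (simp add: Al_def ordered_simplex_def pad_heat_map heat_map_space)
          then have "heat_map a b ?N (- ?t) (V q) ` {1..?N} \<subseteq> {a<..<b}" by (rule simplexD)
          then show ?thesis by (auto simp: heat_map_def)
        qed
        then show ?thesis using co alive True by (simp add: K_def Int_absorb2)
      next
        case dead: False
        have X: "increasing_upto ?N (pad a b ?N (V q))" using Vs by (rule simplexD)
        have nX: "\<not> increasing_upto ?N (heat ?N (- ?t) (pad a b ?N (V q)))" using dead by (simp add: Al_def)
        have "card (after_collision a b ?N (V q)) < ?N" by (rule card_after_collision[OF X t ab nX])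
        moreover have "after_collision a b ?N (V q) \<inter> {a<..<b} = after_collision a b ?N (V q)"
          using finite_after_collision by blast
        moreover have "first_collision a b ?N (V q) \<le> ?t" by (rule collision_time(2)[OF X t nX])
        ultimately show ?thesis using co dead True by (simp add: K_def G_def)
      qed
    qed
  qed
  finally show ?case .
qed

lemma coarsen_in_config:
  assumes "a < b" "S \<in> space (config_space {a..b})" "0 \<le> t"
  shows "coarsen a b t S \<in> space (config_space {a..b})"
  using measurable_space[OF measurable_coarsen_upto[OF assms(1), of "card (S \<inter> {a<..<b})"], of "(t, S)"] assms
  by (simp add: space_pair_measure)

lemma measurable_coarsen_pair:
  assumes ab: "a < b"
  shows "(\<lambda>q. coarsen a b (max 0 (fst q)) (snd q)) \<in> borel \<Otimes>\<^sub>M config_space {a..b} \<rightarrow>\<^sub>M config_space {a..b}"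
proof (rule measurable_config_spaceI)
  let ?P = "borel \<Otimes>\<^sub>M config_space {a..b} :: (real \<times> real set) measure"
  fix q assume "q \<in> space ?P"
  then have "snd q \<in> space (config_space {a..b})" by (auto simp: space_pair_measure)
  from coarsen_in_config[OF ab this, of "max 0 (fst q)"]
  show "finite (coarsen a b (max 0 (fst q)) (snd q)) \<and> coarsen a b (max 0 (fst q)) (snd q) \<subseteq> {a..b}"
    by (simp add: space_config_space)
next
  let ?P = "borel \<Otimes>\<^sub>M config_space {a..b} :: (real \<times> real set) measure"
  let ?c = "\<lambda>q :: real \<times> real set. card (snd q \<inter> {a<..<b})"
  define G where "G n q = (if ?c q \<le> n then coarsen a b (max 0 (fst q)) (snd q) else {})" for n q
  fix A :: "real set" assume "closed A"
  then have A: "{S \<in> space (config_space {a..b}). S \<inter> A = {}} \<in> sets (config_space {a..b})" by simp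
  have c: "?c \<in> ?P \<rightarrow>\<^sub>M count_space UNIV"
    by (rule measurable_compose[OF measurable_snd measurable_card_Int]) simp
  have "G n -` {S \<in> space (config_space {a..b}). S \<inter> A = {}} \<inter> space ?P \<in> sets ?P" for n
    unfolding G_def by (rule measurable_sets[OF measurable_coarsen_upto[OF ab] A])
  moreover have "?c -` {n} \<inter> space ?P \<in> sets ?P" for n by (rule measurable_sets[OF c]) simp
  ultimately have "(\<Union>n. (G n -` {S \<in> space (config_space {a..b}). S \<inter> A = {}} \<inter> space ?P) \<inter> (?c -` {n} \<inter> space ?P)) \<in> sets ?P"
    by (intro sets.countable_UN image_subsetI) (blast intro: sets.Int)
  also have "(\<Union>n. (G n -` {S \<in> space (config_space {a..b}). S \<inter> A = {}} \<inter> space ?P) \<inter> (?c -` {n} \<inter> space ?P))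
     = {q \<in> space ?P. coarsen a b (max 0 (fst q)) (snd q) \<inter> A = {}}" (is "?L = ?R")
  proof (rule set_eqI)
    fix q
    have "q \<in> space ?P \<Longrightarrow> coarsen a b (max 0 (fst q)) (snd q) \<in> space (config_space {a..b})"
      using coarsen_in_config[OF ab, of "snd q" "max 0 (fst q)"] by (auto simp: space_pair_measure)
    moreover have "q \<in> ?L \<longleftrightarrow> q \<in> space ?P \<and> G (?c q) q \<in> {S \<in> space (config_space {a..b}). S \<inter> A = {}}"
      by blast
    ultimately show "q \<in> ?L \<longleftrightarrow> q \<in> ?R" by (auto simp: G_def)
  qed
  finally show "{q \<in> space ?P. coarsen a b (max 0 (fst q)) (snd q) \<inter> A = {}} \<in> sets ?P" .
qed

lemma measurable_coarsen:
  assumes "a < b" "0 \<le> t"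
  shows "coarsen a b t \<in> config_space {a..b} \<rightarrow>\<^sub>M config_space {a..b}"
  using measurable_compose[OF measurable_Pair1'[of t borel "config_space {a..b}"] measurable_coarsen_pair[OF assms(1)]] assms(2)
  by simp

section \<open>Void probabilities of the coarsened configuration\<close>

lemma measure_Int_Ioo_Icc:
  assumes [measurable]: "A \<in> sets borel"
  shows "measure lborel (A \<inter> {a<..<b}) = measure lborel (A \<inter> {a..b :: real})"
proof (rule measure_eq_AE)
  have "AE x in lborel. x \<noteq> a" "AE x in lborel. x \<noteq> b" by (rule AE_lborel_singleton)+
  then show "AE x in lborel. x \<in> A \<inter> {a<..<b} \<longleftrightarrow> x \<in> A \<inter> {a..b}" by eventually_elim auto
qed auto

lemma emeasure_Int_Icc:
  assumes [measurable]: "A \<in> sets borel"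
  shows "emeasure lborel (A \<inter> {a..b :: real}) = ennreal (measure lborel (A \<inter> {a..b}))"
proof (rule emeasure_eq_ennreal_measure)
  have "emeasure lborel (A \<inter> {a..b}) \<le> emeasure lborel {a..b}" by (rule emeasure_mono) auto
  also have "\<dots> < \<top>" by (simp add: emeasure_lborel_Icc_eq)
  finally show "emeasure lborel (A \<inter> {a..b}) \<noteq> \<top>" by simp
qed

lemma measure_complement_Icc:
  assumes [measurable]: "A \<in> sets borel" and ab: "a \<le> (b :: real)"
  shows "measure lborel (- A \<inter> {a..b}) = b - a - measure lborel (A \<inter> {a..b})"
    and "measure lborel (A \<inter> {a..b}) \<le> b - a"
proof -
  have "measure lborel (A \<inter> {a..b} \<union> - A \<inter> {a..b}) = measure lborel (A \<inter> {a..b}) + measure lborel (- A \<inter> {a..b})"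
    by (rule measure_Union) (auto simp: emeasure_Int_Icc)
  moreover have "A \<inter> {a..b} \<union> - A \<inter> {a..b} = {a..b}" by auto
  ultimately show 1: "measure lborel (- A \<inter> {a..b}) = b - a - measure lborel (A \<inter> {a..b})"
    using ab by simp
  show "measure lborel (A \<inter> {a..b}) \<le> b - a"
    using measure_nonneg[of lborel "- A \<inter> {a..b}"] unfolding 1 by simp
qed

lemma emeasure_simplex_avoiding:
  assumes [measurable]: "A \<in> sets borel" and ab: "a < b"
  shows "emeasure (Leb n) {x \<in> ordered_simplex a b n. x ` {1..n} \<inter> A = {}}
    = ennreal ((b - a - measure lborel (A \<inter> {a..b})) ^ n / fact n)"
proof -
  have "{x \<in> ordered_simplex a b n. x ` {1..n} \<inter> A = {}} = {x \<in> ordered_simplex a b n. \<forall>i\<in>{1..n}. x i \<in> - A}"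
    by blast
  then show ?thesis
    using emeasure_simplex_all_in[of "- A" a b n] measure_complement_Icc(1)[of A a b] ab
    by (simp add: measure_Int_Ioo_Icc)
qed

text \<open>
  The integral over the time \<open>s\<close> of the first collision. The integrand is the derivative of
  \<open>- exp (- 2 n s) u(s)\<^sup>n / n!\<close> with \<open>u(s) = L - exp (- 2 (t - s)) q\<close>, because
  \<open>u(s) + exp (- 2 (t - s)) q = L\<close>; the term without collision cancels its value at \<open>s = t\<close>.
\<close>

lemma first_collision_integral:
  fixes L q t :: real and m :: nat
  assumes q: "0 \<le> q" "q \<le> L" and t: "0 \<le> t"
  defines "n \<equiv> real (Suc m)"
  shows "(\<integral>\<^sup>+s. ennreal (exponential_density (2 * n) s) *
        (if s \<le> t then ennreal (L / n) * ennreal ((L - exp (- 2 * (t - s)) * q) ^ m / fact m) else 0) \<partial>lborel)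
      + ennreal (exp (- (2 * t * n))) * ennreal ((L - q) ^ Suc m / fact (Suc m))
    = ennreal ((L - exp (- 2 * t) * q) ^ Suc m / fact (Suc m))"
proof -
  have n: "0 < n" by (simp add: n_def)
  define u where "u s = L - exp (- 2 * (t - s)) * q" for s
  define f where "f s = 2 * n * exp (- s * (2 * n)) * (L / n) * (u s ^ m / fact m)" for s
  define F where "F s = - (exp (- s * (2 * n)) * (u s ^ Suc m / fact (Suc m)))" for s
  have u: "0 \<le> u s" if "s \<le> t" for s
  proof -
    have "exp (- 2 * (t - s)) * q \<le> 1 * q" using that q by (intro mult_right_mono) auto
    then show ?thesis using q by (simp add: u_def)
  qed
  have f0: "0 \<le> f s" if "s \<le> t" for s using u[OF that] n q by (simp add: f_def)
  have fact: "fact (Suc m) = n * (fact m :: real)" by (simp add: n_def)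
  have F: "(F has_real_derivative f s) (at s)" for s
  proof -
    define E where "E = exp (- 2 * (t - s))"
    define W where "W = exp (- s * (2 * n))"
    have du: "(u has_real_derivative - (E * 2 * q)) (at s)"
      unfolding u_def E_def by (rule derivative_eq_intros refl | simp)+
    have dW: "((\<lambda>s. exp (- s * (2 * n))) has_real_derivative W * (- (2 * n))) (at s)"
      unfolding W_def by (rule derivative_eq_intros refl | simp)+
    have "(F has_real_derivative - ((W * (- (2 * n))) * (u s ^ Suc m / fact (Suc m))
        + (real (Suc m) * (- (E * 2 * q) * u s ^ (Suc m - Suc 0))) / fact (Suc m) * W)) (at s)"
      unfolding F_def using DERIV_minus[OF DERIV_mult[OF dW DERIV_cdivide[OF DERIV_power[OF du, of "Suc m"], of "fact (Suc m)"]]]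
      by (simp only: W_def)
    moreover have "- ((W * (- (2 * n))) * (u s ^ Suc m / fact (Suc m))
        + (real (Suc m) * (- (E * 2 * q) * u s ^ (Suc m - Suc 0))) / fact (Suc m) * W)
      = 2 * W * (u s + E * q) * (u s ^ m / fact m)"
      unfolding fact n_def[symmetric] using n by (simp add: field_simps)
    moreover have "u s + E * q = L" by (simp add: u_def E_def)
    moreover have "2 * W * L * (u s ^ m / fact m) = f s" using n by (simp add: f_def W_def)
    ultimately show ?thesis by simp
  qed
  have "(\<integral>\<^sup>+s. ennreal (exponential_density (2 * n) s) *
        (if s \<le> t then ennreal (L / n) * ennreal ((L - exp (- 2 * (t - s)) * q) ^ m / fact m) else 0) \<partial>lborel)
      = (\<integral>\<^sup>+s. ennreal (f s) * indicator {0..t} s \<partial>lborel)"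
  proof (rule nn_integral_cong)
    fix s
    show "ennreal (exponential_density (2 * n) s) *
        (if s \<le> t then ennreal (L / n) * ennreal ((L - exp (- 2 * (t - s)) * q) ^ m / fact m) else 0)
      = ennreal (f s) * indicator {0..t} s"
    proof (cases "0 \<le> s \<and> s \<le> t")
      case True
      have "0 \<le> 2 * n * exp (- s * (2 * n))" "0 \<le> L / n" "0 \<le> u s ^ m / fact m"
        using n q u[of s] True by simp_all
      then have "ennreal (f s) = ennreal (2 * n * exp (- s * (2 * n))) * (ennreal (L / n) * ennreal (u s ^ m / fact m))"
        unfolding f_def mult.assoc by (simp only: ennreal_mult[symmetric] mult_nonneg_nonneg mult.assoc)
      then show ?thesis using True by (simp add: exponential_density_def u_def)
    next
      case False
      then show ?thesis by (auto simp: exponential_density_def)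
    qed
  qed
  also have "\<dots> = ennreal (F t - F 0)"
  proof (rule nn_integral_FTC_Icc)
    show "f \<in> borel_measurable borel"
      unfolding f_def u_def by measurable
    fix s assume "s \<in> {0..t}"
    then show "(F has_real_derivative f s) (at s)" "0 \<le> f s"
      using F[of s] f0[of s] by auto
  qed (use t in auto)
  finally have I: "(\<integral>\<^sup>+s. ennreal (exponential_density (2 * n) s) *
        (if s \<le> t then ennreal (L / n) * ennreal ((L - exp (- 2 * (t - s)) * q) ^ m / fact m) else 0) \<partial>lborel)
      = ennreal (F t - F 0)" .
  have le: "F 0 \<le> F t"
    by (rule DERIV_nonneg_imp_nondecreasing[OF t]) (use F f0 in blast)
  have Ft: "F t = - (exp (- (2 * t * n)) * ((L - q) ^ Suc m / fact (Suc m)))"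
    by (simp add: F_def u_def mult.commute mult.left_commute)
  have F0: "F 0 = - ((L - exp (- 2 * t) * q) ^ Suc m / fact (Suc m))"
    by (simp add: F_def u_def)
  have nn: "0 \<le> (L - q) ^ Suc m / fact (Suc m)" using q by simp
  have "ennreal (F t - F 0) + ennreal (exp (- (2 * t * n))) * ennreal ((L - q) ^ Suc m / fact (Suc m))
    = ennreal (F t - F 0) + ennreal (exp (- (2 * t * n)) * ((L - q) ^ Suc m / fact (Suc m)))"
    using nn by (subst ennreal_mult) simp_all
  also have "\<dots> = ennreal (F t - F 0 + exp (- (2 * t * n)) * ((L - q) ^ Suc m / fact (Suc m)))"
    by (rule ennreal_plus[symmetric], use le in simp, rule mult_nonneg_nonneg[OF exp_ge_zero nn])
  also have "F t - F 0 + exp (- (2 * t * n)) * ((L - q) ^ Suc m / fact (Suc m)) = (L - exp (- 2 * t) * q) ^ Suc m / fact (Suc m)"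
    unfolding Ft F0 by simp
  finally show ?thesis unfolding I .
qed

text \<open>
  Condition on the first collision: it happens at rate \<open>2n\<close>, and afterwards the evolution starts
  afresh from \<open>n - 1\<close> uniform particles.
\<close>

lemma emeasure_simplex_coarsen_avoiding:
  assumes A: "closed A" and ab: "a < b"
  defines "q \<equiv> measure lborel (A \<inter> {a..b})"
  shows "0 \<le> t \<Longrightarrow> emeasure (Leb n) {x \<in> ordered_simplex a b n. coarsen a b t (x ` {1..n}) \<inter> A = {}}
    = ennreal ((b - a - exp (- 2 * t) * q) ^ n / fact n)"
proof (induction n arbitrary: t)
  case 0
  have "{x \<in> ordered_simplex a b 0. coarsen a b t (x ` {1..0}) \<inter> A = {}} = ordered_simplex a b 0"
    using coarsen_empty[OF ab 0] by (simp add: One_nat_def)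
  then show ?case using emeasure_simplex[OF ab, of 0] by simp
next
  case (Suc m)
  let ?n = "Suc m" let ?\<Omega> = "space (config_space {a..b})"
  have Ab [measurable]: "A \<in> sets borel" using A by simp
  have q: "0 \<le> q" "q \<le> b - a" using measure_complement_Icc(2)[OF Ab, of a b] ab by (simp_all add: q_def)
  define B where "B = {x \<in> ordered_simplex a b ?n. x ` {1..?n} \<inter> A = {}}"
  have "B = ordered_simplex a b ?n \<inter> {x \<in> space (Leb ?n). \<forall>i\<in>{1..?n}. x i \<notin> A}"
    using simplexD(1) by (auto simp: B_def)
  then have B: "B \<in> sets (Leb ?n)" "B \<subseteq> ordered_simplex a b ?n" by (simp, simp add: B_def)
  define S1 where "S1 = {x \<in> alive a b ?n t. heat_map a b ?n (- t) x \<in> B}"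
  have S1: "emeasure (Leb ?n) S1 = ennreal (exp (- (2 * t * real ?n))) * ennreal ((b - a - q) ^ ?n / fact ?n)"
    unfolding S1_def emeasure_alive_preimage[OF Suc.prems B]
    using emeasure_simplex_avoiding[OF Ab ab, of ?n] by (simp only: B_def q_def)
  have S1s: "S1 \<in> sets (Leb ?n)"
  proof -
    have "S1 = alive a b ?n t \<inter> (heat_map a b ?n (- t) -` B \<inter> space (Leb ?n))"
      unfolding S1_def using simplexD(1) by (auto simp: alive_def)
    then show ?thesis using B(1) by simp
  qed
  let ?P = "borel \<Otimes>\<^sub>M config_space {a..b} :: (real \<times> real set) measure"
  define F where "F = {r \<in> space ?P. fst r \<le> t \<and> coarsen a b (max 0 (t - fst r)) (snd r) \<inter> A = {}}"
  have F: "F \<in> sets ?P"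
  proof -
    have "(\<lambda>r. (t - fst r, snd r)) \<in> ?P \<rightarrow>\<^sub>M ?P" by measurable
    from measurable_compose[OF this measurable_coarsen_pair[OF ab]]
    have c: "(\<lambda>r. coarsen a b (max 0 (t - fst r)) (snd r)) \<in> ?P \<rightarrow>\<^sub>M config_space {a..b}" by simp
    have "(\<lambda>r. coarsen a b (max 0 (t - fst r)) (snd r)) -` {S \<in> ?\<Omega>. S \<inter> A = {}} \<inter> space ?P \<in> sets ?P"
      by (rule measurable_sets[OF c sets_void_event[OF Ab]])
    moreover have "{r \<in> space ?P. fst r \<le> t} \<in> sets ?P" by measurable
    ultimately have "((\<lambda>r. coarsen a b (max 0 (t - fst r)) (snd r)) -` {S \<in> ?\<Omega>. S \<inter> A = {}} \<inter> space ?P) \<inter> {r \<in> space ?P. fst r \<le> t} \<in> sets ?P"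
      by (rule sets.Int)
    also have "((\<lambda>r. coarsen a b (max 0 (t - fst r)) (snd r)) -` {S \<in> ?\<Omega>. S \<inter> A = {}} \<inter> space ?P) \<inter> {r \<in> space ?P. fst r \<le> t} = F"
      unfolding F_def using measurable_space[OF c] by blast
    finally show ?thesis .
  qed
  let ?M = "restrict_space (Leb ?n) (colliding a b ?n)"
  define S2 where "S2 = {x \<in> colliding a b ?n. (first_collision a b ?n x, after_collision a b ?n x) \<in> F}"
  have pair: "(\<lambda>x. (first_collision a b ?n x, after_collision a b ?n x)) \<in> ?M \<rightarrow>\<^sub>M ?P" by measurable
  have S2v: "S2 = (\<lambda>x. (first_collision a b ?n x, after_collision a b ?n x)) -` F \<inter> space ?M"
    unfolding S2_def space_colliding by blast
  then have "S2 \<in> sets ?M" using measurable_sets[OF pair F] by simp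
  then have S2s: "S2 \<in> sets (Leb ?n)" by (subst (asm) sets_restrict_space_iff) auto
  define C where "C = collided_volume a b ?n"
  interpret C: finite_measure C
    unfolding C_def by standard (use ab in \<open>simp add: emeasure_collided_volume_space del: power_Suc fact_Suc\<close>)
  have Csec: "emeasure C (Pair s -` F) = (if s \<le> t then ennreal ((b - a) / real ?n) *
      ennreal ((b - a - exp (- 2 * (t - s)) * q) ^ m / fact m) else 0)" for s
  proof (cases "s \<le> t")
    case True
    have e: "{S \<in> ?\<Omega>. coarsen a b (t - s) S \<inter> A = {}} \<in> sets (config_space {a..b})"
    proof -
      have "coarsen a b (t - s) -` {S \<in> ?\<Omega>. S \<inter> A = {}} \<inter> ?\<Omega> \<in> sets (config_space {a..b})"
        by (rule measurable_sets[OF measurable_coarsen[OF ab] sets_void_event[OF Ab]]) (use True in simp)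
      also have "coarsen a b (t - s) -` {S \<in> ?\<Omega>. S \<inter> A = {}} \<inter> ?\<Omega> = {S \<in> ?\<Omega>. coarsen a b (t - s) S \<inter> A = {}}"
        using measurable_space[OF measurable_coarsen[OF ab, of "t - s"]] True by auto
      finally show ?thesis .
    qed
    have "Pair s -` F = {S \<in> ?\<Omega>. coarsen a b (t - s) S \<inter> A = {}}"
      using True by (auto simp: F_def space_pair_measure max_def)
    then have "emeasure C (Pair s -` F) = ennreal ((b - a) / real ?n) *
        emeasure (Leb m) {x \<in> ordered_simplex a b m. x ` {1..m} \<in> {S \<in> ?\<Omega>. coarsen a b (t - s) S \<inter> A = {}}}"
      unfolding C_def collided_volume_eq[OF ab] using emeasure_simplex_volume[OF e, of m] by simp
    also have "{x \<in> ordered_simplex a b m. x ` {1..m} \<in> {S \<in> ?\<Omega>. coarsen a b (t - s) S \<inter> A = {}}}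
        = {x \<in> ordered_simplex a b m. coarsen a b (t - s) (x ` {1..m}) \<inter> A = {}}"
    proof -
      have "x ` {1..m} \<in> ?\<Omega>" if "x \<in> ordered_simplex a b m" for x
        using simplexD(3)[OF that] by (force simp: space_config_space)
      then show ?thesis by blast
    qed
    finally show ?thesis using Suc.IH[of "t - s"] True by simp
  next
    case False
    then have "Pair s -` F = {}" by (auto simp: F_def)
    then show ?thesis using False by simp
  qed
  have "emeasure (Leb ?n) S2 = emeasure ?M S2"
    by (rule emeasure_restrict_space[symmetric]) (auto simp: S2_def)
  also have "\<dots> = emeasure (distr ?M ?P (\<lambda>x. (first_collision a b ?n x, after_collision a b ?n x))) F"
    unfolding S2v by (rule emeasure_distr[OF pair F, symmetric])
  also have "\<dots> = emeasure (density lborel (exponential_density (2 * real ?n)) \<Otimes>\<^sub>M C) F"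
    unfolding C_def by (subst joint_law_first_collision[OF _ ab]) simp_all
  also have "\<dots> = (\<integral>\<^sup>+s. emeasure C (Pair s -` F) \<partial>density lborel (exponential_density (2 * real ?n)))"
  proof (rule C.emeasure_pair_measure_alt)
    show "F \<in> sets (density lborel (\<lambda>x. ennreal (exponential_density (2 * real ?n) x)) \<Otimes>\<^sub>M C)"
      using F by (simp add: C_def sets_collided_volume cong: sets_pair_measure_cong)
  qed
  also have "\<dots> = (\<integral>\<^sup>+s. ennreal (exponential_density (2 * real ?n) s) * emeasure C (Pair s -` F) \<partial>lborel)"
  proof (rule nn_integral_density)
    show "(\<lambda>s. emeasure C (Pair s -` F)) \<in> borel_measurable lborel"
    proof (rule C.measurable_emeasure_Pair)
      show "F \<in> sets (lborel \<Otimes>\<^sub>M C)"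
        using F by (simp add: C_def sets_collided_volume cong: sets_pair_measure_cong)
    qed
    show "(\<lambda>s. ennreal (exponential_density (2 * real ?n) s)) \<in> borel_measurable lborel"
      using measurable_compose[OF borel_measurable_erlang_density measurable_ennreal] by simp
  qed
  finally have S2: "emeasure (Leb ?n) S2 = (\<integral>\<^sup>+s. ennreal (exponential_density (2 * real ?n) s) *
      (if s \<le> t then ennreal ((b - a) / real ?n) * ennreal ((b - a - exp (- 2 * (t - s)) * q) ^ m / fact m) else 0) \<partial>lborel)"
    unfolding Csec .
  have "{x \<in> ordered_simplex a b ?n. coarsen a b t (x ` {1..?n}) \<inter> A = {}} = S2 \<union> S1"
  proof (rule set_eqI)
    fix x
    show "x \<in> {x \<in> ordered_simplex a b ?n. coarsen a b t (x ` {1..?n}) \<inter> A = {}} \<longleftrightarrow> x \<in> S2 \<union> S1"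
    proof (cases "x \<in> ordered_simplex a b ?n")
      case xs: True
      note X = simplexD(2)[OF xs]
      show ?thesis
      proof (cases "x \<in> alive a b ?n t")
        case True
        then have al: "increasing_upto ?n (heat ?n (- t) (pad a b ?n x))" by (simp add: alive_def)
        have n2: "x \<notin> S2"
        proof
          assume "x \<in> S2"
          then have "x \<in> colliding a b ?n" "first_collision a b ?n x \<le> t" by (auto simp: S2_def F_def)
          then show False using collidingD(4) True by fastforce
        qed
        have hs: "heat_map a b ?n (- t) x \<in> ordered_simplex a b ?n"
          using heat_map_in_simplex_iff[OF simplexD(1)[OF xs] Suc.prems] True by simp
        have "heat_map a b ?n (- t) x ` {1..?n} = heat ?n (- t) (pad a b ?n x) ` {1..?n}"
          by (auto simp: heat_map_def)
        then have "x \<in> S1 \<longleftrightarrow> coarsen a b t (x ` {1..?n}) \<inter> A = {}"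
          using coarsen_alive[OF X Suc.prems ab al] True hs by (simp add: S1_def B_def)
        then show ?thesis using xs n2 by blast
      next
        case False
        then have dead: "\<not> increasing_upto ?n (heat ?n (- t) (pad a b ?n x))" using xs by (simp add: alive_def)
        have xc: "x \<in> colliding a b ?n" using xs dead Suc.prems by (auto simp: colliding_def)
        have \<tau>: "first_collision a b ?n x \<le> t" by (rule collision_time(2)[OF X Suc.prems dead])
        have "after_collision a b ?n x \<in> ?\<Omega>"
          using finite_after_collision[of a b ?n x] by (auto simp: space_config_space)
        then have "x \<in> S2 \<longleftrightarrow> coarsen a b t (x ` {1..?n}) \<inter> A = {}"
          unfolding coarsen_collision[OF X Suc.prems ab dead] using xc \<tau>
          by (simp add: S2_def F_def space_pair_measure)
        moreover have "x \<notin> S1" using False by (simp add: S1_def)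
        ultimately show ?thesis using xs by blast
      qed
    next
      case False
      then have "x \<notin> S2" "x \<notin> S1" using collidingD(1) by (auto simp: S2_def S1_def alive_def)
      then show ?thesis using False by blast
    qed
  qed
  moreover have "S2 \<inter> S1 = {}"
  proof -
    have False if "x \<in> S2" "x \<in> S1" for x
    proof -
      have "x \<in> colliding a b ?n" "first_collision a b ?n x \<le> t" "x \<in> alive a b ?n t"
        using that by (auto simp: S2_def F_def S1_def)
      then show False using collidingD(4) by fastforce
    qed
    then show ?thesis by blast
  qed
  ultimately have "emeasure (Leb ?n) {x \<in> ordered_simplex a b ?n. coarsen a b t (x ` {1..?n}) \<inter> A = {}}
      = emeasure (Leb ?n) S2 + emeasure (Leb ?n) S1"
    using plus_emeasure[OF S2s S1s] by simp
  also have "\<dots> = ennreal ((b - a - exp (- 2 * t) * q) ^ ?n / fact ?n)"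
    unfolding S1 S2 by (rule first_collision_integral[OF q Suc.prems])
  finally show ?case .
qed

section \<open>Coarsening has the same law as magnifying\<close>

text \<open>
  The part of \<open>S\<close> in the left fraction \<open>p\<close> of \<open>[a, b]\<close>, stretched to the whole interval.
\<close>

definition magnify :: "real \<Rightarrow> real \<Rightarrow> real \<Rightarrow> real set \<Rightarrow> real set" where
  "magnify a b p S = {y \<in> {a..b}. a + p * (y - a) \<in> S}"

text \<open>
  The image of \<open>A \<inter> [a, b]\<close> under the contraction towards \<open>a\<close> by the factor \<open>p\<close>, written as a
  preimage so that it is visibly a Borel set.
\<close>

definition shrink :: "real \<Rightarrow> real \<Rightarrow> real \<Rightarrow> real set \<Rightarrow> real set" where
  "shrink a b p A = {x. a + (1 / p) * (x - a) \<in> A \<inter> {a..b}}"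

lemma sets_shrink [measurable]:
  assumes "A \<in> sets borel"
  shows "shrink a b p A \<in> sets borel"
proof -
  have "shrink a b p A = (\<lambda>x. a + (1 / p) * (x - a)) -` (A \<inter> {a..b})" by (auto simp: shrink_def)
  also have "\<dots> \<in> sets borel"
    by (rule measurable_sets_borel[of _ borel]) (use assms in \<open>auto\<close>)
  finally show ?thesis .
qed

lemma shrink_iff: "0 < p \<Longrightarrow> a + p * (y - a) \<in> shrink a b p A \<longleftrightarrow> y \<in> A \<inter> {a..b}"
  by (simp add: shrink_def)

lemma shrink_subset:
  assumes "0 < p" "p \<le> 1"
  shows "shrink a b p A \<subseteq> {a..b}"
proof
  fix x assume "x \<in> shrink a b p A"
  then obtain y where y: "y \<in> {a..b}" "y = a + (1 / p) * (x - a)" by (simp add: shrink_def)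
  then have x: "x = a + p * (y - a)" using assms by simp
  have "0 \<le> p * (y - a)" using y(1) assms by simp
  moreover have "p * (y - a) \<le> 1 * (y - a)" using y(1) assms by (intro mult_right_mono) auto
  ultimately show "x \<in> {a..b}" using y(1) unfolding x by simp
qed

lemma measure_shrink:
  assumes [measurable]: "A \<in> sets borel" and p: "0 < p"
  shows "measure lborel (shrink a b p A) = p * measure lborel (A \<inter> {a..b})"
proof -
  have "emeasure lborel (A \<inter> {a..b}) = (\<integral>\<^sup>+y. indicator (A \<inter> {a..b}) y \<partial>lborel)" by simp
  also have "\<dots> = ennreal \<bar>1 / p\<bar> * (\<integral>\<^sup>+x. indicator (A \<inter> {a..b}) ((a - a / p) + (1 / p) * x) \<partial>lborel)"
    by (rule nn_integral_real_affine) (use p in \<open>simp_all\<close>)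
  also have "(\<integral>\<^sup>+x. indicator (A \<inter> {a..b}) ((a - a / p) + (1 / p) * x) \<partial>lborel) = (\<integral>\<^sup>+x. indicator (shrink a b p A) x \<partial>lborel)"
    by (rule nn_integral_cong) (auto simp: indicator_def shrink_def diff_divide_distrib algebra_simps)
  also have "\<dots> = emeasure lborel (shrink a b p A)" by simp
  finally have "ennreal p * emeasure lborel (A \<inter> {a..b}) = ennreal p * (ennreal (1 / p) * emeasure lborel (shrink a b p A))"
    using p by simp
  also have "\<dots> = emeasure lborel (shrink a b p A)"
    using p by (simp add: mult.assoc[symmetric] ennreal_mult[symmetric])
  finally have "ennreal (p * measure lborel (A \<inter> {a..b})) = emeasure lborel (shrink a b p A)"
    using p by (simp add: emeasure_Int_Icc ennreal_mult)
  then show ?thesis using p by (simp add: measure_def[of _ "shrink a b p A"] flip: \<open>ennreal _ = _\<close>)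
qed

lemma magnify_bij:
  assumes p: "0 < p"
  shows "bij_betw (\<lambda>y. a + p * (y - a)) (magnify a b p S \<inter> A) (S \<inter> shrink a b p A)"
proof (rule bij_betw_byWitness[where f' = "\<lambda>x. a + (1 / p) * (x - a)"])
  show "(\<lambda>y. a + p * (y - a)) ` (magnify a b p S \<inter> A) \<subseteq> S \<inter> shrink a b p A"
    using shrink_iff[OF p] by (auto simp: magnify_def)
  show "(\<lambda>x. a + (1 / p) * (x - a)) ` (S \<inter> shrink a b p A) \<subseteq> magnify a b p S \<inter> A"
    using p by (auto simp: magnify_def shrink_def)
qed (use p in auto)

lemma card_magnify: "0 < p \<Longrightarrow> card (magnify a b p S \<inter> A) = card (S \<inter> shrink a b p A)"
  by (rule bij_betw_same_card[OF magnify_bij])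

lemma magnify_void: "0 < p \<Longrightarrow> magnify a b p S \<inter> A = {} \<longleftrightarrow> S \<inter> shrink a b p A = {}"
  using magnify_bij[of p a b S A] by (auto simp: bij_betw_def)

lemma finite_magnify: "0 < p \<Longrightarrow> finite S \<Longrightarrow> finite (magnify a b p S)"
  using bij_betw_finite[OF magnify_bij[of p a b S UNIV]] by simp

lemma measurable_magnify:
  assumes p: "0 < p"
  shows "magnify a b p \<in> config_space B \<rightarrow>\<^sub>M config_space {a..b}"
proof (rule measurable_config_spaceI)
  fix S assume "S \<in> space (config_space B)"
  then show "finite (magnify a b p S) \<and> magnify a b p S \<subseteq> {a..b}"
    using finite_magnify[OF p] by (auto simp: space_config_space magnify_def)
next
  fix A :: "real set" assume "closed A"
  then have "shrink a b p A \<in> sets borel" by simp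
  then show "{S \<in> space (config_space B). magnify a b p S \<inter> A = {}} \<in> sets (config_space B)"
    unfolding magnify_void[OF p] by (rule sets_void_event)
qed

lemma sets_void_coarsen:
  assumes ab: "a < b" and t: "0 \<le> t" and A: "closed A"
  shows "{S \<in> space (config_space {a..b}). coarsen a b t S \<inter> A = {}} \<in> sets (config_space {a..b})"
proof -
  have "coarsen a b t -` {S \<in> space (config_space {a..b}). S \<inter> A = {}} \<inter> space (config_space {a..b}) \<in> sets (config_space {a..b})"
    by (rule measurable_sets[OF measurable_coarsen[OF ab t] sets_void_event]) (use A in simp)
  also have "coarsen a b t -` {S \<in> space (config_space {a..b}). S \<inter> A = {}} \<inter> space (config_space {a..b})
    = {S \<in> space (config_space {a..b}). coarsen a b t S \<inter> A = {}}"
    using measurable_space[OF measurable_coarsen[OF ab t]] by blast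
  finally show ?thesis .
qed

lemma simplex_points_config: "x \<in> ordered_simplex a b n \<Longrightarrow> x ` {1..n} \<in> space (config_space {a..b})"
  using simplexD(3)[of x a b n] by (force simp: space_config_space)

text \<open>
  Both sides equal the volume of the ordered tuples that avoid a set whose length is
  \<open>exp (- 2 t)\<close> times that of \<open>A\<close>.
\<close>

lemma coarsen_void_eq_magnify_void:
  assumes ab: "a < b" and t: "0 \<le> t" and A: "closed A"
  defines "p \<equiv> exp (- 2 * t)"
  shows "emeasure (simplex_volume a b n) {S \<in> space (config_space {a..b}). coarsen a b t S \<inter> A = {}}
    = emeasure (simplex_volume a b n) {S \<in> space (config_space {a..b}). magnify a b p S \<inter> A = {}}"
proof -
  have p: "0 < p" "p \<le> 1" using t by (auto simp: p_def)
  have Ab: "A \<in> sets borel" using A by simp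
  have "emeasure (simplex_volume a b n) {S \<in> space (config_space {a..b}). coarsen a b t S \<inter> A = {}}
     = emeasure (Leb n) {x \<in> ordered_simplex a b n. coarsen a b t (x ` {1..n}) \<inter> A = {}}"
    unfolding emeasure_simplex_volume[OF sets_void_coarsen[OF ab t A]]
    using simplex_points_config by (intro arg_cong2[where f = emeasure] refl) blast
  also have "\<dots> = ennreal ((b - a - p * measure lborel (A \<inter> {a..b})) ^ n / fact n)"
    unfolding p_def by (rule emeasure_simplex_coarsen_avoiding[OF A ab t])
  also have "p * measure lborel (A \<inter> {a..b}) = measure lborel (shrink a b p A \<inter> {a..b})"
    using measure_shrink[OF Ab p(1), of a b] shrink_subset[OF p, of a b A] by (simp add: Int_absorb2)
  also have "ennreal ((b - a - measure lborel (shrink a b p A \<inter> {a..b})) ^ n / fact n)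
     = emeasure (Leb n) {x \<in> ordered_simplex a b n. x ` {1..n} \<inter> shrink a b p A = {}}"
    by (rule emeasure_simplex_avoiding[symmetric, OF sets_shrink[OF Ab] ab])
  also have "\<dots> = emeasure (simplex_volume a b n) {S \<in> space (config_space {a..b}). S \<inter> shrink a b p A = {}}"
    unfolding emeasure_simplex_volume[OF sets_void_event[OF sets_shrink[OF Ab]]]
    using simplex_points_config by (intro arg_cong2[where f = emeasure] refl) blast
  finally show ?thesis unfolding magnify_void[OF p(1)] .
qed

definition uniform_given_card :: "real \<Rightarrow> real \<Rightarrow> real set measure \<Rightarrow> bool" where
  "uniform_given_card a b Q \<longleftrightarrow> sets Q = sets (config_space {a..b}) \<and> emeasure Q (space Q) \<noteq> \<infinity> \<and>
     (\<forall>n. \<exists>K. \<forall>E\<in>sets (config_space {a..b}).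
        emeasure Q {S \<in> E. card S = n} = K * emeasure (simplex_volume a b n) E)"

lemma sets_card_eq:
  assumes "E \<in> sets (config_space B)"
  shows "{S \<in> E. card S = n} \<in> sets (config_space B)"
proof -
  have "{S \<in> space (config_space B). card (S \<inter> UNIV) = n} \<in> sets (config_space B)" by measurable
  moreover have "{S \<in> E. card S = n} = E \<inter> {S \<in> space (config_space B). card (S \<inter> UNIV) = n}"
    using sets.sets_into_space[OF assms] by auto
  ultimately show ?thesis using assms by simp
qed

lemma emeasure_by_card:
  assumes Q: "sets Q = sets (config_space B)" and E: "E \<in> sets (config_space B)"
  shows "emeasure Q E = (\<Sum>n. emeasure Q {S \<in> E. card S = n})"
proof -
  have "(\<Sum>n. emeasure Q {S \<in> E. card S = n}) = emeasure Q (\<Union>n. {S \<in> E. card S = n})"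
    by (rule suminf_emeasure) (use sets_card_eq[OF E] Q in \<open>auto simp: disjoint_family_on_def\<close>)
  also have "(\<Union>n. {S \<in> E. card S = n}) = E" by auto
  finally show ?thesis by simp
qed

lemma distr_coarsen_eq_distr_magnify:
  assumes ab: "a < b" and t: "0 \<le> t" and Q: "uniform_given_card a b Q"
  shows "distr Q (config_space {a..b}) (coarsen a b t)
    = distr Q (config_space {a..b}) (magnify a b (exp (- 2 * t)))"
proof (rule config_measure_eqI)
  have sQ: "sets Q = sets (config_space {a..b})" and fQ: "emeasure Q (space Q) \<noteq> \<infinity>"
    using Q by (auto simp: uniform_given_card_def)
  have spQ: "space Q = space (config_space {a..b})" by (rule sets_eq_imp_space_eq[OF sQ])
  have mc: "coarsen a b t \<in> Q \<rightarrow>\<^sub>M config_space {a..b}"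
    using measurable_coarsen[OF ab t] by (simp add: measurable_cong_sets[OF sQ refl])
  have mg: "magnify a b (exp (- 2 * t)) \<in> Q \<rightarrow>\<^sub>M config_space {a..b}"
    using measurable_magnify[of "exp (- 2 * t)" a b "{a..b}"] by (simp add: measurable_cong_sets[OF sQ refl])
  show "emeasure (distr Q (config_space {a..b}) (coarsen a b t)) (space (distr Q (config_space {a..b}) (coarsen a b t))) \<noteq> \<infinity>"
  proof -
    have "coarsen a b t -` space (config_space {a..b}) \<inter> space Q = space Q"
      using measurable_space[OF mc] by blast
    then show ?thesis using fQ mc by (simp add: emeasure_distr)
  qed
  fix A :: "real set" assume A: "closed A"
  then have Ab: "A \<in> sets borel" by simp
  let ?\<Omega> = "space (config_space {a..b})"
  let ?C = "{S \<in> ?\<Omega>. coarsen a b t S \<inter> A = {}}" and ?G = "{S \<in> ?\<Omega>. magnify a b (exp (- 2 * t)) S \<inter> A = {}}"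
  have Gs: "?G \<in> sets (config_space {a..b})"
    unfolding magnify_void[OF exp_gt_zero] using sets_void_event[OF sets_shrink[OF Ab]] .
  have "emeasure (distr Q (config_space {a..b}) (coarsen a b t)) {S \<in> ?\<Omega>. S \<inter> A = {}} = emeasure Q ?C"
    using measurable_space[OF mc] sets_void_event[OF Ab]
    by (subst emeasure_distr[OF mc]) (auto intro!: arg_cong2[where f = emeasure] simp: spQ)
  also have "\<dots> = (\<Sum>n. emeasure Q {S \<in> ?C. card S = n})"
    by (rule emeasure_by_card[OF sQ sets_void_coarsen[OF ab t A]])
  also have "\<dots> = (\<Sum>n. emeasure Q {S \<in> ?G. card S = n})"
  proof (rule suminf_cong)
    fix n
    obtain K where K: "\<And>E. E \<in> sets (config_space {a..b}) \<Longrightarrow>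
        emeasure Q {S \<in> E. card S = n} = K * emeasure (simplex_volume a b n) E"
      using Q unfolding uniform_given_card_def by blast
    show "emeasure Q {S \<in> ?C. card S = n} = emeasure Q {S \<in> ?G. card S = n}"
      unfolding K[OF sets_void_coarsen[OF ab t A]] K[OF Gs] coarsen_void_eq_magnify_void[OF ab t A] ..
  qed
  also have "\<dots> = emeasure Q ?G" by (rule emeasure_by_card[OF sQ Gs, symmetric])
  also have "\<dots> = emeasure (distr Q (config_space {a..b}) (magnify a b (exp (- 2 * t)))) {S \<in> ?\<Omega>. S \<inter> A = {}}"
    using measurable_space[OF mg] sets_void_event[OF Ab]
    by (subst emeasure_distr[OF mg]) (auto intro!: arg_cong2[where f = emeasure] simp: spQ)
  finally show "emeasure (distr Q (config_space {a..b}) (coarsen a b t))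
      {S \<in> space (distr Q (config_space {a..b}) (coarsen a b t)). S \<inter> A = {}}
    = emeasure (distr Q (config_space {a..b}) (magnify a b (exp (- 2 * t))))
      {S \<in> space (distr Q (config_space {a..b}) (magnify a b (exp (- 2 * t)))). S \<inter> A = {}}" by simp
qed simp_all

section \<open>Independent uniform particles\<close>

context prob_space
begin

lemma prob_all_avoid:
  fixes X :: "nat \<Rightarrow> 'a \<Rightarrow> real"
  assumes ind: "indep_vars (\<lambda>_. borel) X {..<n}" and C: "\<And>i. i < n \<Longrightarrow> C i \<in> sets borel"
  shows "prob {\<omega> \<in> space M. \<forall>i<n. X i \<omega> \<in> C i} = (\<Prod>i<n. prob (X i -` C i \<inter> space M))"
proof (cases "n = 0")
  case True
  then show ?thesis by (simp add: prob_space)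
next
  case False
  have "{\<omega> \<in> space M. \<forall>i<n. X i \<omega> \<in> C i} = (\<Inter>i\<in>{..<n}. X i -` C i \<inter> space M)"
    using False by auto
  also have "prob \<dots> = (\<Prod>i<n. prob (X i -` C i \<inter> space M))"
    by (rule indep_varsD_finite[OF ind]) (use False C in auto)
  finally show ?thesis .
qed

lemma prob_uniform:
  assumes X: "X \<in> borel_measurable M" and u: "distr M borel X = uniform_measure lborel {a..b :: real}"
    and ab: "a < b" and C: "C \<in> sets borel"
  shows "prob (X -` C \<inter> space M) = measure lborel (C \<inter> {a..b}) / (b - a)"
proof -
  have "prob (X -` C \<inter> space M) = measure (distr M borel X) C"
    using X C by (simp add: measure_distr)
  also have "\<dots> = measure lborel ({a..b} \<inter> C) / measure lborel {a..b}"
    unfolding u using ab C by (subst measure_uniform_measure) (auto simp: emeasure_lborel_Icc_eq)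
  finally show ?thesis using ab by (simp add: Int_commute)
qed

text \<open>
  Split according to the set \<open>J\<close> of those indices whose particles are in \<open>C\<close>.
\<close>

lemma prob_count_binomial:
  fixes X :: "nat \<Rightarrow> 'a \<Rightarrow> real"
  assumes ind: "indep_vars (\<lambda>_. borel) X {..<n}" and C: "C \<in> sets borel"
    and p: "\<And>i. i < n \<Longrightarrow> prob (X i -` C \<inter> space M) = p" "0 \<le> p" "p \<le> 1"
  shows "prob {\<omega> \<in> space M. card {i. i < n \<and> X i \<omega> \<in> C} = k} = pmf (binomial_pmf n p) k"
proof -
  have X [measurable]: "X i \<in> borel_measurable M" if "i < n" for i
    using ind that by (auto simp: indep_vars_def)
  define Ev where "Ev J = {\<omega> \<in> space M. \<forall>i<n. X i \<omega> \<in> (if i \<in> J then C else - C)}" for J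
  have Ev_sets: "Ev J \<in> events" for J
  proof -
    have "(\<Union>i\<in>{..<n}. X i -` (- (if i \<in> J then C else - C)) \<inter> space M) \<in> events"
      by (rule sets.finite_UN) (use C in \<open>auto intro!: measurable_sets[OF X]\<close>)
    moreover have "Ev J = space M - (\<Union>i\<in>{..<n}. X i -` (- (if i \<in> J then C else - C)) \<inter> space M)"
      unfolding Ev_def by blast
    ultimately show ?thesis by simp
  qed
  have EvJ: "{i. i < n \<and> X i \<omega> \<in> C} = J" if "\<omega> \<in> Ev J" "J \<subseteq> {..<n}" for \<omega> J
  proof (rule set_eqI)
    fix i
    have "i \<in> J \<Longrightarrow> i < n" using that(2) by blast
    moreover have "i < n \<Longrightarrow> X i \<omega> \<in> (if i \<in> J then C else - C)" using that(1) by (simp add: Ev_def)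
    ultimately show "i \<in> {i. i < n \<and> X i \<omega> \<in> C} \<longleftrightarrow> i \<in> J" by (cases "i \<in> J") simp_all
  qed
  have Ev: "prob (Ev J) = p ^ card J * (1 - p) ^ (n - card J)" if J: "J \<subseteq> {..<n}" for J
  proof -
    have "prob (Ev J) = (\<Prod>i<n. prob (X i -` (if i \<in> J then C else - C) \<inter> space M))"
      unfolding Ev_def by (rule prob_all_avoid[OF ind]) (use C in auto)
    also have "\<dots> = (\<Prod>i<n. if i \<in> J then p else 1 - p)"
    proof (rule prod.cong[OF refl])
      fix i assume "i \<in> {..<n}"
      then have i: "i < n" by simp
      have "X i -` (- C) \<inter> space M = space M - (X i -` C \<inter> space M)" by auto
      then have "prob (X i -` (- C) \<inter> space M) = 1 - p"
        using prob_compl[of "X i -` C \<inter> space M"] p(1)[OF i] measurable_sets[OF X[OF i] C] by simp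
      then show "prob (X i -` (if i \<in> J then C else - C) \<inter> space M) = (if i \<in> J then p else 1 - p)"
        using p(1)[OF i] by simp
    qed
    also have "\<dots> = (\<Prod>i\<in>{..<n} \<inter> J. p) * (\<Prod>i\<in>{..<n} \<inter> - J. 1 - p)"
      by (subst prod.If_cases) auto
    also have "{..<n} \<inter> J = J" using J by auto
    also have "{..<n} \<inter> - J = {..<n} - J" by auto
    finally show ?thesis using J by (simp add: card_Diff_subset finite_subset[OF J])
  qed
  let ?\<J> = "{J. J \<subseteq> {..<n} \<and> card J = k}"
  have "{\<omega> \<in> space M. card {i. i < n \<and> X i \<omega> \<in> C} = k} = (\<Union>J\<in>?\<J>. Ev J)"
  proof (rule set_eqI, rule iffI)
    fix \<omega> assume w: "\<omega> \<in> {\<omega> \<in> space M. card {i. i < n \<and> X i \<omega> \<in> C} = k}"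
    then have "\<omega> \<in> Ev {i. i < n \<and> X i \<omega> \<in> C}" by (simp add: Ev_def)
    moreover have "{i. i < n \<and> X i \<omega> \<in> C} \<in> ?\<J>" using w by auto
    ultimately show "\<omega> \<in> (\<Union>J\<in>?\<J>. Ev J)" by blast
  next
    fix \<omega> assume "\<omega> \<in> (\<Union>J\<in>?\<J>. Ev J)"
    then obtain J where J: "J \<subseteq> {..<n}" "card J = k" "\<omega> \<in> Ev J" by blast
    then have "{i. i < n \<and> X i \<omega> \<in> C} = J" using EvJ by blast
    then show "\<omega> \<in> {\<omega> \<in> space M. card {i. i < n \<and> X i \<omega> \<in> C} = k}" using J by (simp add: Ev_def)
  qed
  also have "prob \<dots> = (\<Sum>J\<in>?\<J>. prob (Ev J))"
  proof (rule finite_measure_finite_Union)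
    show "disjoint_family_on Ev ?\<J>"
      unfolding disjoint_family_on_def
    proof (intro ballI impI)
      fix J J' assume J: "J \<in> ?\<J>" "J' \<in> ?\<J>" "J \<noteq> J'"
      have False if "\<omega> \<in> Ev J" "\<omega> \<in> Ev J'" for \<omega>
        using EvJ[OF that(1)] EvJ[OF that(2)] J by simp
      then show "Ev J \<inter> Ev J' = {}" by blast
    qed
  qed (use Ev_sets in auto)
  also have "\<dots> = (\<Sum>J\<in>?\<J>. p ^ k * (1 - p) ^ (n - k))"
    by (rule sum.cong[OF refl]) (use Ev in auto)
  also have "\<dots> = real (n choose k) * p ^ k * (1 - p) ^ (n - k)"
    using n_subsets[of "{..<n}" k] by simp
  finally show ?thesis using p by simp
qed

context
  fixes X :: "nat \<Rightarrow> 'a \<Rightarrow> real" and n :: nat and a b :: real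
  assumes ind: "indep_vars (\<lambda>_. borel) X {..<n}"
    and unif: "\<And>i. i < n \<Longrightarrow> distr M borel (X i) = uniform_measure lborel {a..b}"
    and ab: "a < b"
begin

lemma X_measurable: "i < n \<Longrightarrow> X i \<in> borel_measurable M"
  using ind by (auto simp: indep_vars_def)

lemma measurable_particles:
  "(\<lambda>\<omega>. (\<lambda>i. X i \<omega>) ` {..<n} \<inter> {a<..<b}) \<in> M \<rightarrow>\<^sub>M config_space {a..b}"
proof (rule measurable_config_spaceI)
  fix A :: "real set" assume "closed A"
  then have "A \<inter> {a<..<b} \<in> sets borel" by simp
  then have "(\<Union>i\<in>{..<n}. X i -` (A \<inter> {a<..<b}) \<inter> space M) \<in> sets M"
    using X_measurable by (intro sets.finite_UN measurable_sets) auto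
  moreover have "{\<omega> \<in> space M. (\<lambda>i. X i \<omega>) ` {..<n} \<inter> {a<..<b} \<inter> A = {}}
    = space M - (\<Union>i\<in>{..<n}. X i -` (A \<inter> {a<..<b}) \<inter> space M)" by blast
  ultimately show "{\<omega> \<in> space M. (\<lambda>i. X i \<omega>) ` {..<n} \<inter> {a<..<b} \<inter> A = {}} \<in> sets M" by simp
qed auto

text \<open>
  Both laws have the void probabilities \<open>((b - a - q) / (b - a)) ^ n\<close>.
\<close>

lemma law_particles:
  "distr M (config_space {a..b}) (\<lambda>\<omega>. (\<lambda>i. X i \<omega>) ` {..<n} \<inter> {a<..<b})
    = scale_measure (ennreal (fact n / (b - a) ^ n)) (simplex_volume a b n)" (is "?Q = scale_measure (ennreal ?k) ?V")
proof (rule config_measure_eqI)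
  let ?\<Omega> = "space (config_space {a..b})"
  have spV: "space ?V = ?\<Omega>" by (rule sets_eq_imp_space_eq[OF sets_simplex_volume])
  interpret Q: prob_space ?Q by (rule prob_space_distr[OF measurable_particles])
  show "emeasure ?Q (space ?Q) \<noteq> \<infinity>" by simp
  fix A :: "real set" assume A: "closed A"
  then have Ab: "A \<in> sets borel" by simp
  define q where "q = measure lborel (A \<inter> {a..b})"
  have q: "0 \<le> q" "q \<le> b - a" using measure_complement_Icc(2)[OF Ab, of a b] ab by (simp_all add: q_def)
  have "emeasure ?Q {S \<in> ?\<Omega>. S \<inter> A = {}} = emeasure M {\<omega> \<in> space M. \<forall>i<n. X i \<omega> \<in> - (A \<inter> {a<..<b})}"
    using measurable_space[OF measurable_particles] sets_void_event[OF Ab]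
    by (subst emeasure_distr[OF measurable_particles]) (auto intro!: arg_cong2[where f = emeasure])
  also have "\<dots> = ennreal (\<Prod>i<n. prob (X i -` (- (A \<inter> {a<..<b})) \<inter> space M))"
    unfolding emeasure_eq_measure using Ab by (subst prob_all_avoid[OF ind]) auto
  also have "(\<Prod>i<n. prob (X i -` (- (A \<inter> {a<..<b})) \<inter> space M)) = (\<Prod>i<n. (b - a - q) / (b - a))"
  proof (rule prod.cong[OF refl])
    fix i assume "i \<in> {..<n}"
    then have i: "i < n" by simp
    have "measure lborel (- (A \<inter> {a<..<b}) \<inter> {a..b}) = b - a - measure lborel (A \<inter> {a<..<b} \<inter> {a..b})"
      using measure_complement_Icc(1)[of "A \<inter> {a<..<b}" a b] Ab ab by simp
    also have "A \<inter> {a<..<b} \<inter> {a..b} = A \<inter> {a<..<b}" by auto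
    finally have "measure lborel (- (A \<inter> {a<..<b}) \<inter> {a..b}) = b - a - q"
      using measure_Int_Ioo_Icc[OF Ab] by (simp add: q_def)
    moreover have "prob (X i -` (- (A \<inter> {a<..<b})) \<inter> space M)
        = measure lborel (- (A \<inter> {a<..<b}) \<inter> {a..b}) / (b - a)"
      by (rule prob_uniform[OF X_measurable[OF i] unif[OF i] ab]) (use Ab in auto)
    ultimately show "prob (X i -` (- (A \<inter> {a<..<b})) \<inter> space M) = (b - a - q) / (b - a)"
      by (simp only:)
  qed
  also have "ennreal (\<Prod>i<n. (b - a - q) / (b - a)) = ennreal ?k * ennreal ((b - a - q) ^ n / fact n)"
    using ab q by (subst ennreal_mult[symmetric]) (auto simp: power_divide)
  also have "ennreal ((b - a - q) ^ n / fact n) = emeasure ?V {S \<in> ?\<Omega>. S \<inter> A = {}}"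
  proof -
    have "emeasure ?V {S \<in> ?\<Omega>. S \<inter> A = {}} = emeasure (Leb n) {x \<in> ordered_simplex a b n. x ` {1..n} \<inter> A = {}}"
      unfolding emeasure_simplex_volume[OF sets_void_event[OF Ab]]
      using simplex_points_config by (intro arg_cong2[where f = emeasure] refl) blast
    then show ?thesis using emeasure_simplex_avoiding[OF Ab ab, of n] by (simp add: q_def)
  qed
  finally show "emeasure ?Q {S \<in> space ?Q. S \<inter> A = {}} =
      emeasure (scale_measure (ennreal ?k) ?V) {S \<in> space (scale_measure (ennreal ?k) ?V). S \<inter> A = {}}"
    by (simp add: space_scale_measure spV)
qed (simp_all add: sets_simplex_volume)

lemma card_law_particles:
  assumes E: "E \<in> sets (config_space {a..b})"
  shows "emeasure (simplex_volume a b n) {S \<in> E. card S = k} = (if k = n then emeasure (simplex_volume a b n) E else 0)"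
proof -
  have c: "card (x ` {1..n}) = n" if "x \<in> ordered_simplex a b n" for x
    using card_image[OF inj_on_simplex[OF that]] by simp
  have "{x \<in> ordered_simplex a b n. x ` {1..n} \<in> {S \<in> E. card S = k}}
    = (if k = n then {x \<in> ordered_simplex a b n. x ` {1..n} \<in> E} else {})"
    using c by auto
  then show ?thesis
    unfolding emeasure_simplex_volume[OF sets_card_eq[OF E]] emeasure_simplex_volume[OF E] by simp
qed

lemma uniform_given_card_particles:
  "uniform_given_card a b (distr M (config_space {a..b}) (\<lambda>\<omega>. (\<lambda>i. X i \<omega>) ` {..<n} \<inter> {a<..<b}))"
  unfolding uniform_given_card_def
proof (intro conjI allI)
  interpret Q: prob_space "distr M (config_space {a..b}) (\<lambda>\<omega>. (\<lambda>i. X i \<omega>) ` {..<n} \<inter> {a<..<b})"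
    by (rule prob_space_distr[OF measurable_particles])
  show "emeasure (distr M (config_space {a..b}) (\<lambda>\<omega>. (\<lambda>i. X i \<omega>) ` {..<n} \<inter> {a<..<b}))
    (space (distr M (config_space {a..b}) (\<lambda>\<omega>. (\<lambda>i. X i \<omega>) ` {..<n} \<inter> {a<..<b}))) \<noteq> \<infinity>" by simp
  fix k
  show "\<exists>K. \<forall>E\<in>sets (config_space {a..b}).
      emeasure (distr M (config_space {a..b}) (\<lambda>\<omega>. (\<lambda>i. X i \<omega>) ` {..<n} \<inter> {a<..<b})) {S \<in> E. card S = k}
        = K * emeasure (simplex_volume a b k) E"
    unfolding law_particles
    by (rule exI[of _ "if k = n then ennreal (fact n / (b - a) ^ n) else 0"]) (simp add: card_law_particles)
qed simp

text \<open>
  Almost surely the particles are distinct: the law of the set of particles is that of the set of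
  coordinates of an ordered tuple, which has exactly \<open>n\<close> points.
\<close>

lemma AE_particles_distinct: "AE \<omega> in M. inj_on (\<lambda>i. X i \<omega>) {..<n} \<and> (\<lambda>i. X i \<omega>) ` {..<n} \<subseteq> {a<..<b}"
proof -
  let ?f = "\<lambda>\<omega>. (\<lambda>i. X i \<omega>) ` {..<n} \<inter> {a<..<b}" and ?\<Omega> = "space (config_space {a..b})"
  have s: "{S \<in> ?\<Omega>. card S = n} \<in> sets (config_space {a..b})" by (rule sets_card_eq) simp
  have "emeasure M (?f -` {S \<in> ?\<Omega>. card S = n} \<inter> space M) = emeasure (distr M (config_space {a..b}) ?f) {S \<in> ?\<Omega>. card S = n}"
    by (rule emeasure_distr[symmetric, OF measurable_particles s])
  also have "\<dots> = emeasure (distr M (config_space {a..b}) ?f) ?\<Omega>"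
    unfolding law_particles by (simp add: card_law_particles)
  also have "\<dots> = emeasure M (?f -` ?\<Omega> \<inter> space M)"
    by (rule emeasure_distr[OF measurable_particles]) simp
  also have "?f -` ?\<Omega> \<inter> space M = space M" using measurable_space[OF measurable_particles] by blast
  finally have "prob (?f -` {S \<in> ?\<Omega>. card S = n} \<inter> space M) = 1"
    by (simp add: emeasure_space_1 measure_def)
  then have "AE \<omega> in M. \<omega> \<in> ?f -` {S \<in> ?\<Omega>. card S = n} \<inter> space M"
    using measurable_sets[OF measurable_particles s] by (subst (asm) prob_eq_1) auto
  then show ?thesis
  proof eventually_elim
    case (elim \<omega>)
    then have c: "card (?f \<omega>) = n" by simp
    have "card (?f \<omega>) \<le> card ((\<lambda>i. X i \<omega>) ` {..<n})" by (intro card_mono) auto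
    moreover have "card ((\<lambda>i. X i \<omega>) ` {..<n}) \<le> n" using card_image_le[of "{..<n}" "\<lambda>i. X i \<omega>"] by simp
    ultimately have "card ((\<lambda>i. X i \<omega>) ` {..<n}) = n" using c by simp
    then have "inj_on (\<lambda>i. X i \<omega>) {..<n}" by (intro eq_card_imp_inj_on) auto
    moreover have "?f \<omega> = (\<lambda>i. X i \<omega>) ` {..<n}"
      by (rule card_subset_eq) (use c \<open>card (_ ` _) = n\<close> in auto)
    ultimately show ?case by blast
  qed
qed

lemma distr_card_particles:
  assumes C: "C \<in> sets borel" "C \<subseteq> {a..b}"
  defines "p \<equiv> measure lborel C / (b - a)"
  shows "distr M (count_space UNIV) (\<lambda>\<omega>. card ((\<lambda>i. X i \<omega>) ` {..<n} \<inter> {a<..<b} \<inter> C)) = measure_pmf (binomial_pmf n p)"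
proof (rule measure_eqI_countable[of _ UNIV])
  have p: "0 \<le> p" "p \<le> 1"
    using measure_complement_Icc(2)[OF C(1), of a b] C(2) ab by (simp_all add: p_def Int_absorb2)
  have m: "(\<lambda>\<omega>. card ((\<lambda>i. X i \<omega>) ` {..<n} \<inter> {a<..<b} \<inter> C)) \<in> M \<rightarrow>\<^sub>M count_space UNIV"
    by (rule measurable_compose[OF measurable_particles measurable_card_Int[OF C(1)]])
  let ?C = "C \<inter> {a<..<b}"
  have Cb: "?C \<in> sets borel" using C by simp
  have pr: "prob (X i -` ?C \<inter> space M) = p" if "i < n" for i
  proof -
    have "?C \<inter> {a..b} = C \<inter> {a<..<b}" by auto
    moreover have "C \<inter> {a..b} = C" using C(2) by blast
    ultimately show ?thesis
      using prob_uniform[OF X_measurable[OF that] unif[OF that] ab Cb] measure_Int_Ioo_Icc[OF C(1), of a b] by (simp add: p_def)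
  qed
  fix k
  have cnt: "card ((\<lambda>i. X i \<omega>) ` {..<n} \<inter> {a<..<b} \<inter> C) = card {i. i < n \<and> X i \<omega> \<in> ?C}"
    if "inj_on (\<lambda>i. X i \<omega>) {..<n}" for \<omega>
  proof -
    have "(\<lambda>i. X i \<omega>) ` {..<n} \<inter> {a<..<b} \<inter> C = (\<lambda>i. X i \<omega>) ` {i. i < n \<and> X i \<omega> \<in> ?C}" by auto
    moreover have "inj_on (\<lambda>i. X i \<omega>) {i. i < n \<and> X i \<omega> \<in> ?C}"
      by (rule inj_on_subset[OF that]) auto
    ultimately show ?thesis by (simp add: card_image)
  qed
  have s2: "{\<omega> \<in> space M. card {i. i < n \<and> X i \<omega> \<in> ?C} = k} \<in> sets M"
  proof -
    have ms: "(\<lambda>\<omega>. \<Sum>i<n. indicator ?C (X i \<omega>) :: real) \<in> borel_measurable M"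
      using X_measurable Cb by (intro borel_measurable_sum measurable_compose[OF _ borel_measurable_indicator]) auto
    have "(\<Sum>i<n. indicator ?C (X i \<omega>) :: real) = real (card {i. i < n \<and> X i \<omega> \<in> ?C})" for \<omega>
    proof -
      have "(\<Sum>i<n. indicator ?C (X i \<omega>) :: real) = (\<Sum>i\<in>{..<n}. if X i \<omega> \<in> ?C then 1 else 0)"
        by (rule sum.cong[OF refl]) (simp add: indicator_def)
      also have "\<dots> = (\<Sum>i\<in>{i \<in> {..<n}. X i \<omega> \<in> ?C}. 1)"
        by (rule sum.inter_filter[symmetric]) simp
      also have "\<dots> = real (card {i \<in> {..<n}. X i \<omega> \<in> ?C})" by (rule real_of_card[symmetric])
      also have "{i \<in> {..<n}. X i \<omega> \<in> ?C} = {i. i < n \<and> X i \<omega> \<in> ?C}" by blast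
      finally show ?thesis .
    qed
    then have eq: "(\<lambda>\<omega>. \<Sum>i<n. indicator ?C (X i \<omega>) :: real) = (\<lambda>\<omega>. real (card {i. i < n \<and> X i \<omega> \<in> ?C}))"
      by blast
    have "(\<lambda>\<omega>. real (card {i. i < n \<and> X i \<omega> \<in> ?C})) -` {real k} \<inter> space M \<in> sets M"
      using measurable_sets[OF ms, of "{real k}"] unfolding eq by simp
    moreover have "(\<lambda>\<omega>. real (card {i. i < n \<and> X i \<omega> \<in> ?C})) -` {real k} \<inter> space M
      = {\<omega> \<in> space M. card {i. i < n \<and> X i \<omega> \<in> ?C} = k}"
      unfolding vimage_def singleton_iff of_nat_eq_iff by blast
    ultimately show ?thesis by (simp only:)
  qed
  have "emeasure (distr M (count_space UNIV) (\<lambda>\<omega>. card ((\<lambda>i. X i \<omega>) ` {..<n} \<inter> {a<..<b} \<inter> C))) {k}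
    = emeasure M ((\<lambda>\<omega>. card ((\<lambda>i. X i \<omega>) ` {..<n} \<inter> {a<..<b} \<inter> C)) -` {k} \<inter> space M)"
    by (rule emeasure_distr[OF m]) simp
  also have "\<dots> = emeasure M {\<omega> \<in> space M. card {i. i < n \<and> X i \<omega> \<in> ?C} = k}"
  proof (rule emeasure_eq_AE)
    show "AE \<omega> in M. \<omega> \<in> (\<lambda>\<omega>. card ((\<lambda>i. X i \<omega>) ` {..<n} \<inter> {a<..<b} \<inter> C)) -` {k} \<inter> space M
        \<longleftrightarrow> \<omega> \<in> {\<omega> \<in> space M. card {i. i < n \<and> X i \<omega> \<in> ?C} = k}"
      using AE_particles_distinct
    proof eventually_elim
      case (elim \<omega>)
      then have "card ((\<lambda>i. X i \<omega>) ` {..<n} \<inter> {a<..<b} \<inter> C) = card {i. i < n \<and> X i \<omega> \<in> ?C}" using cnt by blast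
      then show ?case unfolding Int_iff vimage_eq singleton_iff mem_Collect_eq by (simp only: conj_commute)
    qed
    show "(\<lambda>\<omega>. card ((\<lambda>i. X i \<omega>) ` {..<n} \<inter> {a<..<b} \<inter> C)) -` {k} \<inter> space M \<in> sets M"
      by (rule measurable_sets[OF m]) simp
  qed (rule s2)
  also have "\<dots> = emeasure (measure_pmf (binomial_pmf n p)) {k}"
  proof -
    have "prob {\<omega> \<in> space M. card {i. i < n \<and> X i \<omega> \<in> ?C} = k} = pmf (binomial_pmf n p) k"
      by (rule prob_count_binomial[OF ind Cb pr p])
    then show ?thesis unfolding emeasure_eq_measure emeasure_pmf_single by (rule arg_cong)
  qed
  finally show "emeasure (distr M (count_space UNIV) (\<lambda>\<omega>. card ((\<lambda>i. X i \<omega>) ` {..<n} \<inter> {a<..<b} \<inter> C))) {k}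
    = emeasure (measure_pmf (binomial_pmf n p)) {k}" .
qed simp_all

end

end

section \<open>Poisson configurations\<close>

lemma poisson_lawD:
  assumes "poisson_law r L P"
  shows "prob_space P" "sets P = sets (config_space {-L..L})"
    "\<And>A k. A \<in> sets borel \<Longrightarrow> A \<subseteq> {-L..L} \<Longrightarrow> measure P {S \<in> space P. card (S \<inter> A) = k} =
          (r * measure lborel A) ^ k / fact k * exp (- (r * measure lborel A))"
    "\<And>(m::nat) A. (\<And>i. i < m \<Longrightarrow> A i \<in> sets borel \<and> A i \<subseteq> {-L..L}) \<Longrightarrow> disjoint_family_on A {..<m} \<Longrightarrow>
        prob_space.indep_vars P (\<lambda>_. count_space UNIV) (\<lambda>i S. card (S \<inter> A i)) {..<m}"
proof -
  note d = assms[unfolded poisson_law_def]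
  show "prob_space P" by (rule conjunct1[OF d])
  show "sets P = sets (config_space {-L..L})" by (rule conjunct1[OF conjunct2[OF d]])
  show "measure P {S \<in> space P. card (S \<inter> A) = k} =
      (r * measure lborel A) ^ k / fact k * exp (- (r * measure lborel A))"
    if "A \<in> sets borel" "A \<subseteq> {-L..L}" for A k
    by (rule conjunct1[OF conjunct2[OF conjunct2[OF d]], rule_format, OF that])
  show "prob_space.indep_vars P (\<lambda>_. count_space UNIV) (\<lambda>i S. card (S \<inter> A i)) {..<m}"
    if "\<And>i. i < m \<Longrightarrow> A i \<in> sets borel \<and> A i \<subseteq> {-L..L}" "disjoint_family_on A {..<m}" for m :: nat and A
    by (rule conjunct2[OF conjunct2[OF conjunct2[OF d]], rule_format]) (use that in blast)+
qed

lemma poisson_law_space: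
  assumes "poisson_law r L P"
  shows "space P = {S. finite S \<and> S \<subseteq> {-L..L}}"
  using sets_eq_imp_space_eq[OF poisson_lawD(2)[OF assms]] by (simp add: space_config_space)

lemma poisson_law_void:
  assumes P: "poisson_law r L P" and A: "A \<in> sets borel"
  shows "measure P {S \<in> space P. S \<inter> A = {}} = exp (- (r * measure lborel (A \<inter> {-L..L})))"
proof -
  have "{S \<in> space P. S \<inter> A = {}} = {S \<in> space P. card (S \<inter> (A \<inter> {-L..L})) = 0}"
    unfolding poisson_law_space[OF P] by (auto simp: card_eq_0_iff)
  then show ?thesis using poisson_lawD(3)[OF P, of "A \<inter> {-L..L}" 0] A by simp
qed

text \<open>
  A Poisson law is determined by its intensity, through its void probabilities.
\<close>

lemma poisson_law_unique:
  assumes P: "poisson_law r L P" and P': "poisson_law r L P'"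
  shows "P = P'"
proof (rule config_measure_eqI[OF poisson_lawD(2)[OF P] poisson_lawD(2)[OF P']])
  interpret P: prob_space P by (rule poisson_lawD(1)[OF P])
  interpret P': prob_space P' by (rule poisson_lawD(1)[OF P'])
  show "emeasure P (space P) \<noteq> \<infinity>" by simp
  fix A :: "real set" assume "closed A"
  then have "A \<in> sets borel" by simp
  then show "emeasure P {S \<in> space P. S \<inter> A = {}} = emeasure P' {S \<in> space P'. S \<inter> A = {}}"
    unfolding P.emeasure_eq_measure P'.emeasure_eq_measure
    by (simp only: poisson_law_void[OF P] poisson_law_void[OF P'])
qed

text \<open>
  For a Poisson configuration, \<open>n\<close> points in total and none in \<open>A\<close> means \<open>n\<close> points in the
  complement and none in \<open>A\<close>, two independent events.
\<close>

lemma poisson_law_void_card: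
  assumes P: "poisson_law r L P" and A: "A \<in> sets borel" and L: "0 \<le> L"
  shows "measure P {S \<in> space P. S \<inter> A = {} \<and> card S = n}
    = (r ^ n * exp (- (r * (2 * L)))) * ((2 * L - measure lborel (A \<inter> {-L..L})) ^ n / fact n)"
proof -
  interpret P: prob_space P by (rule poisson_lawD(1)[OF P])
  define B where "B i = (if i = 0 then A \<inter> {-L..L} else - A \<inter> {-L..L})" for i :: nat
  define q where "q = measure lborel (A \<inter> {-L..L})"
  have B: "B i \<in> sets borel \<and> B i \<subseteq> {-L..L}" for i using A by (auto simp: B_def)
  have ind: "P.indep_vars (\<lambda>_. count_space UNIV) (\<lambda>i S. card (S \<inter> B i)) {..<2}"
    by (rule poisson_lawD(4)[OF P B]) (auto simp: disjoint_family_on_def B_def)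
  have two: "{..<2::nat} = {0, 1}" by auto
  define k where "k i = (if i = 0 then 0 else n)" for i :: nat
  have "P.prob (\<Inter>i\<in>{..<2}. (\<lambda>S. card (S \<inter> B i)) -` {k i} \<inter> space P)
      = (\<Prod>i\<in>{..<2}. P.prob ((\<lambda>S. card (S \<inter> B i)) -` {k i} \<inter> space P))"
    by (rule P.indep_varsD_finite[OF ind]) (auto simp: two)
  also have "\<dots> = (\<Prod>i\<in>{..<2}. (r * measure lborel (B i)) ^ k i / fact (k i) * exp (- (r * measure lborel (B i))))"
  proof (rule prod.cong[OF refl])
    fix i :: nat
    have "(\<lambda>S. card (S \<inter> B i)) -` {k i} \<inter> space P = {S \<in> space P. card (S \<inter> B i) = k i}" by auto
    then show "P.prob ((\<lambda>S. card (S \<inter> B i)) -` {k i} \<inter> space P)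
        = (r * measure lborel (B i)) ^ k i / fact (k i) * exp (- (r * measure lborel (B i)))"
      using poisson_lawD(3)[OF P, of "B i" "k i"] B[of i] by simp
  qed
  also have "\<dots> = exp (- (r * measure lborel (B 0))) * ((r * measure lborel (B 1)) ^ n / fact n * exp (- (r * measure lborel (B 1))))"
    unfolding two by (simp add: k_def)
  also have "measure lborel (B 0) = q" by (simp add: B_def q_def)
  also have "measure lborel (B 1) = 2 * L - q"
    using measure_complement_Icc(1)[OF A, of "-L" L] L by (simp add: B_def q_def)
  also have "exp (- (r * q)) * ((r * (2 * L - q)) ^ n / fact n * exp (- (r * (2 * L - q))))
    = (r ^ n * exp (- (r * (2 * L)))) * ((2 * L - q) ^ n / fact n)"
  proof -
    have "exp (- (r * q)) * exp (- (r * (2 * L - q))) = exp (- (r * (2 * L)))"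
      by (simp add: exp_add[symmetric] right_diff_distrib)
    moreover have "exp (- (r * q)) * ((r * (2 * L - q)) ^ n / fact n * exp (- (r * (2 * L - q))))
      = (r ^ n * (exp (- (r * q)) * exp (- (r * (2 * L - q))))) * ((2 * L - q) ^ n / fact n)"
      by (simp only: power_mult_distrib times_divide_eq_left times_divide_eq_right ac_simps)
    ultimately show ?thesis by (simp only:)
  qed
  also have "(\<Inter>i\<in>{..<2}. (\<lambda>S. card (S \<inter> B i)) -` {k i} \<inter> space P) = {S \<in> space P. S \<inter> A = {} \<and> card S = n}"
  proof (rule set_eqI)
    fix S
    show "S \<in> (\<Inter>i\<in>{..<2}. (\<lambda>S. card (S \<inter> B i)) -` {k i} \<inter> space P) \<longleftrightarrow> S \<in> {S \<in> space P. S \<inter> A = {} \<and> card S = n}"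
    proof (cases "S \<in> space P")
      case True
      then have S: "finite S" "S \<subseteq> {-L..L}" by (auto simp: poisson_law_space[OF P])
      have "card (S \<inter> B 0) = 0 \<longleftrightarrow> S \<inter> A = {}" using S by (auto simp: B_def card_eq_0_iff)
      moreover have "S \<inter> B 1 = S" if "S \<inter> A = {}" using that S by (auto simp: B_def)
      ultimately show ?thesis using True unfolding two by (auto simp: k_def)
    qed (auto simp: two)
  qed
  finally show ?thesis by (simp add: q_def)
qed

lemma poisson_uniform_given_card:
  assumes P: "poisson_law r L P" and r: "0 < r" and L: "0 < L"
  shows "uniform_given_card (-L) L P"
  unfolding uniform_given_card_def
proof (intro conjI allI)
  interpret P: prob_space P by (rule poisson_lawD(1)[OF P])
  note sP = poisson_lawD(2)[OF P]
  show "sets P = sets (config_space {-L..L})" by (rule sP)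
  show "emeasure P (space P) \<noteq> \<infinity>" by simp
  fix n
  let ?C = "{S \<in> space P. card S = n}"
  let ?K = "r ^ n * exp (- (r * (2 * L)))"
  have spP: "space P = space (config_space {-L..L})" by (rule sets_eq_imp_space_eq[OF sP])
  have C: "?C \<in> sets P" unfolding sP spP by (rule sets_card_eq) simp
  have eq: "density P (indicator ?C) = scale_measure (ennreal ?K) (simplex_volume (-L) L n)"
  proof (rule config_measure_eqI)
    show "emeasure (density P (indicator ?C)) (space (density P (indicator ?C))) \<noteq> \<infinity>"
      using emeasure_restricted[OF C sets.top] by simp
    fix A :: "real set" assume "closed A"
    then have A: "A \<in> sets borel" by simp
    have V: "{S \<in> space P. S \<inter> A = {}} \<in> sets P" unfolding sP spP by (rule sets_void_event[OF A])
    have "emeasure (density P (indicator ?C)) {S \<in> space P. S \<inter> A = {}} = emeasure P (?C \<inter> {S \<in> space P. S \<inter> A = {}})"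
      by (rule emeasure_restricted[OF C V])
    also have "?C \<inter> {S \<in> space P. S \<inter> A = {}} = {S \<in> space P. S \<inter> A = {} \<and> card S = n}" by auto
    also have "emeasure P \<dots> = ennreal (?K * ((2 * L - measure lborel (A \<inter> {-L..L})) ^ n / fact n))"
      unfolding P.emeasure_eq_measure using poisson_law_void_card[OF P A] L by simp
    also have "\<dots> = ennreal ?K * ennreal ((L - - L - measure lborel (A \<inter> {-L..L})) ^ n / fact n)"
      using r measure_complement_Icc(2)[OF A, of "-L" L] L by (subst ennreal_mult[symmetric]) auto
    also have "ennreal ((L - - L - measure lborel (A \<inter> {-L..L})) ^ n / fact n)
        = emeasure (Leb n) {x \<in> ordered_simplex (-L) L n. x ` {1..n} \<inter> A = {}}"
      by (rule emeasure_simplex_avoiding[OF A, symmetric]) (use L in simp)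
    also have "\<dots> = emeasure (simplex_volume (-L) L n) {S \<in> space (config_space {-L..L}). S \<inter> A = {}}"
      unfolding emeasure_simplex_volume[OF sets_void_event[OF A]]
      using simplex_points_config by (intro arg_cong2[where f = emeasure] refl) blast
    finally show "emeasure (density P (indicator ?C)) {S \<in> space (density P (indicator ?C)). S \<inter> A = {}}
      = emeasure (scale_measure (ennreal ?K) (simplex_volume (-L) L n))
          {S \<in> space (scale_measure (ennreal ?K) (simplex_volume (-L) L n)). S \<inter> A = {}}"
      using sets_eq_imp_space_eq[OF sets_simplex_volume[of "-L" L n]] by (simp add: space_scale_measure)
  qed (simp_all add: sP sets_simplex_volume)
  show "\<exists>K. \<forall>E\<in>sets (config_space {-L..L}). emeasure P {S \<in> E. card S = n} = K * emeasure (simplex_volume (-L) L n) E"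
  proof (intro exI ballI)
    fix E assume E: "E \<in> sets (config_space {-L..L})"
    have "{S \<in> E. card S = n} = ?C \<inter> E" using sets.sets_into_space[OF E] by (auto simp: spP)
    then have "emeasure P {S \<in> E. card S = n} = emeasure (density P (indicator ?C)) E"
      using emeasure_restricted[OF C, of E] E by (simp add: sP)
    then show "emeasure P {S \<in> E. card S = n} = ennreal ?K * emeasure (simplex_volume (-L) L n) E"
      unfolding eq by simp
  qed
qed

text \<open>
  The image of a Poisson configuration under a map that only reindexes the counts by disjoint sets
  of proportional length; used for magnification and for restriction to a smaller interval.
\<close>

lemma poisson_law_image:
  assumes P: "poisson_law r L P"
    and g: "g \<in> P \<rightarrow>\<^sub>M config_space {-L'..L'}"
    and \<psi>: "\<And>A. A \<in> sets borel \<Longrightarrow> A \<subseteq> {-L'..L'} \<Longrightarrow>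
      \<psi> A \<in> sets borel \<and> \<psi> A \<subseteq> {-L..L} \<and> r * measure lborel (\<psi> A) = r' * measure lborel A"
    and disj: "\<And>A B. A \<inter> B = {} \<Longrightarrow> \<psi> A \<inter> \<psi> B = {}"
    and card: "\<And>S A. S \<in> space P \<Longrightarrow> A \<subseteq> {-L'..L'} \<Longrightarrow> card (g S \<inter> A) = card (S \<inter> \<psi> A)"
  shows "poisson_law r' L' (distr P (config_space {-L'..L'}) g)" (is "poisson_law r' L' ?Q")
  unfolding poisson_law_def
proof (intro conjI allI impI)
  interpret P: prob_space P by (rule poisson_lawD(1)[OF P])
  show Q: "prob_space ?Q" by (rule P.prob_space_distr[OF g])
  interpret Q: prob_space ?Q by (rule Q)
  show "sets ?Q = sets (config_space {-L'..L'})" by simp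
  {
    fix A :: "real set" and k assume A: "A \<in> sets borel" "A \<subseteq> {-L'..L'}"
    have E: "{S \<in> space (config_space {-L'..L'}). card (S \<inter> A) = k} \<in> sets (config_space {-L'..L'})"
      using A by measurable
    have "measure ?Q {S \<in> space ?Q. card (S \<inter> A) = k}
        = measure P (g -` {S \<in> space (config_space {-L'..L'}). card (S \<inter> A) = k} \<inter> space P)"
      using measure_distr[OF g E] by simp
    also have "g -` {S \<in> space (config_space {-L'..L'}). card (S \<inter> A) = k} \<inter> space P
        = {S \<in> space P. card (S \<inter> \<psi> A) = k}"
      using measurable_space[OF g] card[OF _ A(2)] by auto
    also have "measure P \<dots> = (r * measure lborel (\<psi> A)) ^ k / fact k * exp (- (r * measure lborel (\<psi> A)))"
      by (rule poisson_lawD(3)[OF P]) (use \<psi>[OF A] in auto)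
    also have "r * measure lborel (\<psi> A) = r' * measure lborel A" using \<psi>[OF A] by blast
    finally show "measure ?Q {S \<in> space ?Q. card (S \<inter> A) = k}
      = (r' * measure lborel A) ^ k / fact k * exp (- (r' * measure lborel A))" .
  }
  fix m :: nat and A :: "nat \<Rightarrow> real set"
  assume A: "\<forall>i<m. A i \<in> sets borel \<and> A i \<subseteq> {-L'..L'}" and dA: "disjoint_family_on A {..<m}"
  show "Q.indep_vars (\<lambda>_. count_space UNIV) (\<lambda>i S. card (S \<inter> A i)) {..<m}"
  proof (cases "m = 0")
    case True
    then show ?thesis by (simp add: Q.indep_vars_def Q.indep_sets_def)
  next
    case False
    let ?N = "\<lambda>_::nat. count_space UNIV :: nat measure"
    have ne: "{..<m} \<noteq> {}" using False by auto
    have ind: "P.indep_vars ?N (\<lambda>i S. card (S \<inter> \<psi> (A i))) {..<m}"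
    proof (rule poisson_lawD(4)[OF P])
      show "\<psi> (A i) \<in> sets borel \<and> \<psi> (A i) \<subseteq> {-L..L}" if "i < m" for i using \<psi> A that by blast
      show "disjoint_family_on (\<lambda>i. \<psi> (A i)) {..<m}"
        using dA disj unfolding disjoint_family_on_def by blast
    qed
    have rvP: "(\<lambda>S. card (S \<inter> \<psi> (A i))) \<in> P \<rightarrow>\<^sub>M count_space UNIV" if "i \<in> {..<m}" for i
      using ind that by (auto simp: P.indep_vars_def)
    have rvC: "(\<lambda>S. card (S \<inter> A i)) \<in> config_space {-L'..L'} \<rightarrow>\<^sub>M count_space UNIV" if "i \<in> {..<m}" for i
      using A that by (intro measurable_card_Int) auto
    have rvQ: "(\<lambda>S. card (S \<inter> A i)) \<in> ?Q \<rightarrow>\<^sub>M count_space UNIV" if "i \<in> {..<m}" for i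
      using rvC[OF that] by simp
    have c: "card (g S \<inter> A i) = card (S \<inter> \<psi> (A i))" if "S \<in> space P" "i \<in> {..<m}" for S i
      using card[OF that(1)] A that(2) by blast
    have joint: "(\<lambda>S. \<lambda>i\<in>{..<m}. card (S \<inter> A i)) \<in> config_space {-L'..L'} \<rightarrow>\<^sub>M PiM {..<m} ?N"
      using rvC by (rule measurable_restrict)
    have "distr ?Q (PiM {..<m} ?N) (\<lambda>S. \<lambda>i\<in>{..<m}. card (S \<inter> A i))
        = distr P (PiM {..<m} ?N) (\<lambda>S. \<lambda>i\<in>{..<m}. card (g S \<inter> A i))"
      using distr_distr[OF joint g] by (simp add: o_def)
    also have "\<dots> = distr P (PiM {..<m} ?N) (\<lambda>S. \<lambda>i\<in>{..<m}. card (S \<inter> \<psi> (A i)))"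
      by (rule distr_cong[OF refl refl]) (rule restrict_ext, rule c)
    also have "\<dots> = PiM {..<m} (\<lambda>i. distr P (count_space UNIV) (\<lambda>S. card (S \<inter> \<psi> (A i))))"
      using iffD1[OF P.indep_vars_iff_distr_eq_PiM'[OF ne rvP] ind] .
    also have "\<dots> = PiM {..<m} (\<lambda>i. distr ?Q (count_space UNIV) (\<lambda>S. card (S \<inter> A i)))"
    proof (rule PiM_cong[OF refl])
      fix i assume i: "i \<in> {..<m}"
      have "distr ?Q (count_space UNIV) (\<lambda>S. card (S \<inter> A i)) = distr P (count_space UNIV) (\<lambda>S. card (g S \<inter> A i))"
        using distr_distr[OF rvC[OF i] g] by (simp add: o_def)
      also have "\<dots> = distr P (count_space UNIV) (\<lambda>S. card (S \<inter> \<psi> (A i)))"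
        by (rule distr_cong[OF refl refl]) (rule c[OF _ i])
      finally show "distr P (count_space UNIV) (\<lambda>S. card (S \<inter> \<psi> (A i))) = distr ?Q (count_space UNIV) (\<lambda>S. card (S \<inter> A i))" by simp
    qed
    finally have eq: "distr ?Q (PiM {..<m} ?N) (\<lambda>S. \<lambda>i\<in>{..<m}. card (S \<inter> A i))
        = PiM {..<m} (\<lambda>i. distr ?Q (count_space UNIV) (\<lambda>S. card (S \<inter> A i)))" .
    have "Q.indep_vars ?N (\<lambda>i S. card (S \<inter> A i)) {..<m} \<longleftrightarrow>
        distr ?Q (PiM {..<m} ?N) (\<lambda>S. \<lambda>i\<in>{..<m}. card (S \<inter> A i))
        = PiM {..<m} (\<lambda>i. distr ?Q (count_space UNIV) (\<lambda>S. card (S \<inter> A i)))"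
      by (rule Q.indep_vars_iff_distr_eq_PiM'[OF ne]) (rule rvQ)
    then show ?thesis using eq by (rule iffD2)
  qed
qed

lemma poisson_law_coarsen:
  assumes P: "poisson_law l L P" and t: "0 \<le> t" and l: "0 < l" and L: "0 < L"
  shows "coarsen (-L) L t \<in> P \<rightarrow>\<^sub>M config_space {-L..L}"
    and "poisson_law (l * exp (-2 * t)) L (distr P (config_space {-L..L}) (coarsen (-L) L t))"
proof -
  let ?p = "exp (- 2 * t)"
  have p: "0 < ?p" "?p \<le> 1" using t by simp_all
  have ab: "-L < L" using L by simp
  note sP = poisson_lawD(2)[OF P]
  show "coarsen (-L) L t \<in> P \<rightarrow>\<^sub>M config_space {-L..L}"
    using measurable_coarsen[OF ab t] by (simp add: measurable_cong_sets[OF sP refl])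
  have g: "magnify (-L) L ?p \<in> P \<rightarrow>\<^sub>M config_space {-L..L}"
    using measurable_magnify[OF p(1), of "-L" L "{-L..L}"] by (simp add: measurable_cong_sets[OF sP refl])
  have "poisson_law (l * ?p) L (distr P (config_space {-L..L}) (magnify (-L) L ?p))"
  proof (rule poisson_law_image[OF P g, where \<psi> = "shrink (-L) L ?p"])
    fix A :: "real set" assume A: "A \<in> sets borel" "A \<subseteq> {-L..L}"
    have "A \<inter> {-L..L} = A" using A(2) by blast
    then show "shrink (-L) L ?p A \<in> sets borel \<and> shrink (-L) L ?p A \<subseteq> {-L..L} \<and>
        l * measure lborel (shrink (-L) L ?p A) = l * ?p * measure lborel A"
      using sets_shrink[OF A(1)] shrink_subset[OF p] measure_shrink[OF A(1) p(1), of "-L" L] by simp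
  next
    fix A B :: "real set" assume "A \<inter> B = {}"
    then show "shrink (-L) L ?p A \<inter> shrink (-L) L ?p B = {}" unfolding shrink_def by blast
  qed (rule card_magnify[OF p(1)])
  then show "poisson_law (l * exp (-2 * t)) L (distr P (config_space {-L..L}) (coarsen (-L) L t))"
    unfolding distr_coarsen_eq_distr_magnify[OF ab t poisson_uniform_given_card[OF P l L]] .
qed

lemma poisson_law_restrict:
  assumes P: "poisson_law r M P" and LM: "L \<le> M"
  shows "(\<lambda>S. S \<inter> {-L..L}) \<in> P \<rightarrow>\<^sub>M config_space {-L..L}"
    and "poisson_law r L (distr P (config_space {-L..L}) (\<lambda>S. S \<inter> {-L..L}))"
proof -
  note sP = poisson_lawD(2)[OF P]
  show g: "(\<lambda>S. S \<inter> {-L..L}) \<in> P \<rightarrow>\<^sub>M config_space {-L..L}"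
  proof (rule measurable_config_spaceI)
    fix S assume "S \<in> space P"
    then show "finite (S \<inter> {-L..L}) \<and> S \<inter> {-L..L} \<subseteq> {-L..L}" by (auto simp: poisson_law_space[OF P])
  next
    fix A :: "real set" assume "closed A"
    then have "{-L..L} \<inter> A \<in> sets borel" by simp
    from sets_void_event[OF this, of "{-M..M}"]
    show "{S \<in> space P. S \<inter> {-L..L} \<inter> A = {}} \<in> sets P"
      unfolding sP sets_eq_imp_space_eq[OF sP] by (simp add: Int_assoc)
  qed
  show "poisson_law r L (distr P (config_space {-L..L}) (\<lambda>S. S \<inter> {-L..L}))"
  proof (rule poisson_law_image[OF P g, where \<psi> = "\<lambda>A. A \<inter> {-L..L}"])
    fix A :: "real set" assume A: "A \<in> sets borel" "A \<subseteq> {-L..L}"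
    have "A \<inter> {-L..L} = A" using A(2) by blast
    then show "A \<inter> {-L..L} \<in> sets borel \<and> A \<inter> {-L..L} \<subseteq> {-M..M} \<and> r * measure lborel (A \<inter> {-L..L}) = r * measure lborel A"
      using A LM by auto
  next
    fix S A :: "real set" assume "A \<subseteq> {-L..L}"
    then have "S \<inter> {-L..L} \<inter> A = S \<inter> (A \<inter> {-L..L})" by blast
    then show "card (S \<inter> {-L..L} \<inter> A) = card (S \<inter> (A \<inter> {-L..L}))" by (rule arg_cong)
  qed blast
qed

text \<open>
  Magnify instead of coarsening: then the particles counted in \<open>A\<close> are the initial particles in a
  fixed set whose relative length is \<open>exp (- 2 t)\<close> times that of \<open>A\<close>.
\<close>

lemma binomial_law_coarsen:
  assumes "prob_space \<Omega>" and ind: "prob_space.indep_vars \<Omega> (\<lambda>_. borel) X {..<n}"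
    and unif: "\<And>i. i < n \<Longrightarrow> distr \<Omega> borel (X i) = uniform_measure lborel {a..b}"
    and ab: "a < b" and t: "0 \<le> t" and A: "A \<in> sets borel" "A \<subseteq> {a..b}"
  shows "(\<lambda>\<omega>. card (coarsen a b t ((\<lambda>i. X i \<omega>) ` {..<n}) \<inter> A)) \<in> \<Omega> \<rightarrow>\<^sub>M count_space UNIV"
    and "distr \<Omega> (count_space UNIV) (\<lambda>\<omega>. card (coarsen a b t ((\<lambda>i. X i \<omega>) ` {..<n}) \<inter> A)) =
          measure_pmf (binomial_pmf n (exp (-2 * t) * (measure lborel A / (b - a))))"
proof -
  interpret prob_space \<Omega> by fact
  let ?p = "exp (- 2 * t)" and ?N = "count_space UNIV :: nat measure" and ?\<C> = "config_space {a..b}"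
  have p: "0 < ?p" "?p \<le> 1" using t by simp_all
  let ?S = "\<lambda>\<omega>. (\<lambda>i. X i \<omega>) ` {..<n} \<inter> {a<..<b}"
  note S = measurable_particles[OF ind unif ab]
  note c = measurable_coarsen[OF ab t] and g = measurable_magnify[OF p(1), of a b "{a..b}"]
  note k = measurable_card_Int[OF A(1), of "{a..b}"]
  let ?Q = "distr \<Omega> ?\<C> ?S"
  have Sc: "coarsen a b t ((\<lambda>i. X i \<omega>) ` {..<n}) = coarsen a b t (?S \<omega>)" for \<omega> by (rule coarsen_inside)
  show "(\<lambda>\<omega>. card (coarsen a b t ((\<lambda>i. X i \<omega>) ` {..<n}) \<inter> A)) \<in> \<Omega> \<rightarrow>\<^sub>M ?N"
    unfolding Sc by (rule measurable_compose[OF measurable_compose[OF S c] k])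
  have cQ: "coarsen a b t \<in> ?Q \<rightarrow>\<^sub>M ?\<C>" and gQ: "magnify a b ?p \<in> ?Q \<rightarrow>\<^sub>M ?\<C>" using c g by simp_all
  have "distr \<Omega> ?N (\<lambda>\<omega>. card (coarsen a b t (?S \<omega>) \<inter> A)) = distr ?Q ?N (\<lambda>S. card (coarsen a b t S \<inter> A))"
    using distr_distr[OF measurable_compose[OF c k] S] by (simp add: o_def)
  also have "\<dots> = distr (distr ?Q ?\<C> (coarsen a b t)) ?N (\<lambda>S. card (S \<inter> A))"
    using distr_distr[OF k cQ] by (simp add: o_def)
  also have "distr ?Q ?\<C> (coarsen a b t) = distr ?Q ?\<C> (magnify a b ?p)"
    by (rule distr_coarsen_eq_distr_magnify[OF ab t uniform_given_card_particles[OF ind unif ab]])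
  also have "distr (distr ?Q ?\<C> (magnify a b ?p)) ?N (\<lambda>S. card (S \<inter> A)) = distr ?Q ?N (\<lambda>S. card (magnify a b ?p S \<inter> A))"
    using distr_distr[OF k gQ] by (simp add: o_def)
  also have "\<dots> = distr \<Omega> ?N (\<lambda>\<omega>. card (magnify a b ?p (?S \<omega>) \<inter> A))"
    using distr_distr[OF measurable_compose[OF g k] S] by (simp add: o_def)
  also have "\<dots> = distr \<Omega> ?N (\<lambda>\<omega>. card (?S \<omega> \<inter> shrink a b ?p A))" unfolding card_magnify[OF p(1)] ..
  also have "\<dots> = measure_pmf (binomial_pmf n (measure lborel (shrink a b ?p A) / (b - a)))"
    by (rule distr_card_particles[OF ind unif ab sets_shrink[OF A(1)] shrink_subset[OF p]])
  also have "measure lborel (shrink a b ?p A) / (b - a) = ?p * (measure lborel A / (b - a))"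
    using measure_shrink[OF A(1) p(1), of a b] A(2) by (simp add: Int_absorb2)
  finally show "distr \<Omega> ?N (\<lambda>\<omega>. card (coarsen a b t ((\<lambda>i. X i \<omega>) ` {..<n}) \<inter> A)) =
      measure_pmf (binomial_pmf n (exp (-2 * t) * (measure lborel A / (b - a))))" unfolding Sc .
qed

theorem corollary2p2:
  fixes t l L :: real
  assumes "t \<ge> 0" and "l > 0" and "L > 0"
  shows
    "(\<forall>(\<Omega> :: 'w measure) (n :: nat) (X :: nat \<Rightarrow> 'w \<Rightarrow> real) A.
        prob_space \<Omega> \<longrightarrow>
        prob_space.indep_vars \<Omega> (\<lambda>_. borel) X {..<n} \<longrightarrow>
        (\<forall>i<n. distr \<Omega> borel (X i) = uniform_measure lborel {-L..L}) \<longrightarrow>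
        A \<in> sets borel \<longrightarrow> A \<subseteq> {-L..L} \<longrightarrow>
        (\<lambda>\<omega>. card (coarsen (-L) L t ((\<lambda>i. X i \<omega>) ` {..<n}) \<inter> A)) \<in> \<Omega> \<rightarrow>\<^sub>M count_space UNIV \<and>
        distr \<Omega> (count_space UNIV) (\<lambda>\<omega>. card (coarsen (-L) L t ((\<lambda>i. X i \<omega>) ` {..<n}) \<inter> A)) =
          measure_pmf (binomial_pmf n (exp (-2 * t) * (measure lborel A / (2 * L)))))
     \<and>
     (\<forall>P. poisson_law l L P \<longrightarrow>
        coarsen (-L) L t \<in> P \<rightarrow>\<^sub>M config_space {-L..L} \<and>
        poisson_law (l * exp (-2 * t)) L (distr P (config_space {-L..L}) (coarsen (-L) L t)))
     \<and>
     (\<forall>M M' P P'. M \<ge> L \<longrightarrow> M' \<ge> L \<longrightarrow> poisson_law l M P \<longrightarrow> poisson_law l M' P' \<longrightarrow>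
        (\<lambda>S. coarsen (-M) M t S \<inter> {-L..L}) \<in> P \<rightarrow>\<^sub>M config_space {-L..L} \<and>
        (\<lambda>S. coarsen (-M') M' t S \<inter> {-L..L}) \<in> P' \<rightarrow>\<^sub>M config_space {-L..L} \<and>
        distr P (config_space {-L..L}) (\<lambda>S. coarsen (-M) M t S \<inter> {-L..L}) =
        distr P' (config_space {-L..L}) (\<lambda>S. coarsen (-M') M' t S \<inter> {-L..L}))"
proof (intro conjI allI impI)
  have ab: "-L < L" using \<open>L > 0\<close> by simp
  {
    fix \<Omega> :: "'w measure" and n :: nat and X :: "nat \<Rightarrow> 'w \<Rightarrow> real" and A
    assume *: "prob_space \<Omega>" "prob_space.indep_vars \<Omega> (\<lambda>_. borel) X {..<n}"
      "\<forall>i<n. distr \<Omega> borel (X i) = uniform_measure lborel {-L..L}" "A \<in> sets borel" "A \<subseteq> {-L..L}"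
    have unif: "\<And>i. i < n \<Longrightarrow> distr \<Omega> borel (X i) = uniform_measure lborel {-L..L}" using *(3) by blast
    note b = binomial_law_coarsen[OF *(1,2) unif ab \<open>t \<ge> 0\<close> *(4,5)]
    show "(\<lambda>\<omega>. card (coarsen (-L) L t ((\<lambda>i. X i \<omega>) ` {..<n}) \<inter> A)) \<in> \<Omega> \<rightarrow>\<^sub>M count_space UNIV"
      by (rule b(1))
    show "distr \<Omega> (count_space UNIV) (\<lambda>\<omega>. card (coarsen (-L) L t ((\<lambda>i. X i \<omega>) ` {..<n}) \<inter> A)) =
        measure_pmf (binomial_pmf n (exp (-2 * t) * (measure lborel A / (2 * L))))"
      using b(2) by simp
  }
  {
    fix P assume P: "poisson_law l L P"
    show "coarsen (-L) L t \<in> P \<rightarrow>\<^sub>M config_space {-L..L}"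
      by (rule poisson_law_coarsen(1)[OF P \<open>t \<ge> 0\<close> \<open>l > 0\<close> \<open>L > 0\<close>])
    show "poisson_law (l * exp (-2 * t)) L (distr P (config_space {-L..L}) (coarsen (-L) L t))"
      by (rule poisson_law_coarsen(2)[OF P \<open>t \<ge> 0\<close> \<open>l > 0\<close> \<open>L > 0\<close>])
  }
  have restricted: "(\<lambda>S. coarsen (-M) M t S \<inter> {-L..L}) \<in> P \<rightarrow>\<^sub>M config_space {-L..L} \<and>
      poisson_law (l * exp (-2 * t)) L (distr P (config_space {-L..L}) (\<lambda>S. coarsen (-M) M t S \<inter> {-L..L}))"
    if M: "M \<ge> L" and P: "poisson_law l M P" for M P
  proof -
    have "0 < M" using M \<open>L > 0\<close> by simp
    note c = poisson_law_coarsen[OF P \<open>t \<ge> 0\<close> \<open>l > 0\<close> \<open>0 < M\<close>]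
    note r = poisson_law_restrict[OF c(2) M]
    have r1: "(\<lambda>S. S \<inter> {-L..L}) \<in> config_space {-M..M} \<rightarrow>\<^sub>M config_space {-L..L}" using r(1) by simp
    show ?thesis
      using r(2) distr_distr[OF r1 c(1)] measurable_compose[OF c(1) r1] by (simp add: o_def)
  qed
  fix M M' P P' assume M: "M \<ge> L" "M' \<ge> L" and P: "poisson_law l M P" "poisson_law l M' P'"
  note r = restricted[OF M(1) P(1)] and r' = restricted[OF M(2) P(2)]
  show "(\<lambda>S. coarsen (-M) M t S \<inter> {-L..L}) \<in> P \<rightarrow>\<^sub>M config_space {-L..L}" using r by blast
  show "(\<lambda>S. coarsen (-M') M' t S \<inter> {-L..L}) \<in> P' \<rightarrow>\<^sub>M config_space {-L..L}" using r' by blast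
  show "distr P (config_space {-L..L}) (\<lambda>S. coarsen (-M) M t S \<inter> {-L..L}) =
      distr P' (config_space {-L..L}) (\<lambda>S. coarsen (-M') M' t S \<inter> {-L..L})"
    using r r' poisson_law_unique by blast
qed

end
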